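(* Let $n\ge 1$ and $1\le k\le n$ be integers, and let $\Pi$ be a spacelike hyperplane in the Minkowski space $\mathbb{R}^{n,1}$. Suppose $M$ is a connected, compact, smooth spacelike hypersurface with boundary $\partial M$ in $\mathbb{R}^{n,1}$, which is a graph on $\Pi$. If the $k$-th mean curvature $H_k$ of $M$ is constant, and $\partial M$ is on $\Pi$ with constant intersection angles (that is, $\partial M\subset\Pi$ and the function $\theta:\partial M\to\mathbb{R}$ defined in the context is constant), then $M$ is either a part of a hyperboloid, or entirely contained in $\Pi$.
   Context: The Minkowski space $\mathbb{R}^{n,1}$ is $\mathbb{R}^{n+1}$ endowed with the Lorentzian metric $\bar g=\langle\cdot,\cdot\rangle=\sum_{i=1}^n dx_i^2-dx_{n+1}^2$, i.e. $\langle Y,Z\rangle=y_1z_1+\cdots+y_nz_n-y_{n+1}z_{n+1}$. A vector $Y$ is timelike if $\langle Y,Y\rangle<0$, and a timelike vector is unit if $\langle Y,Y\rangle=-1$. A hypersurface is spacelike if its induced metric is Riemannian (up to and including the boundary); its normal vectors are then timelike. A spacelike hyperplane has the form $\Pi=\{x\in\mathbb{R}^{n,1}:\langle x,N_0\rangle+c=0\}$ with $N_0$ a timelike unit vector (the unit normal of $\Pi$) and $c\in\mathbb{R}$. Graph: $M$ is a graph on $\Pi$ if $M=\{x+\tilde u(x)N_0 : x\in\overline\Omega\}$, where $\Omega\subset\Pi$ is a bounded, connected, open subset of $\Pi$ with smooth boundary and $\tilde u$ is a smooth function on $\overline\Omega$. Intersection angles: let $N$ be the (smooth) timelike unit normal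 vector field of $M$. Define $\theta:\partial M\to\mathbb{R}$ by $\theta(p)=\bar g(N(p),N_0)$. $M$ has constant intersection angles with $\Pi$ if $\partial M\subset\Pi$ and $\theta$ is constant. Curvature: for a local parametrization $X$ of $M$, the second fundamental form is $h_{ij}=-\langle \frac{\partial^2X}{\partial x_i\partial x_j},N\rangle$, the induced metric is $g_{ij}=\langle\frac{\partial X}{\partial x_i},\frac{\partial X}{\partial x_j}\rangle$, and the principal curvatures $\lambda=(\lambda_1,\dots,\lambda_n)$ are the eigenvalues of the shape operator $A=(h_i^j)$, $h_i^j=g^{jl}h_{il}$ (equivalently $\frac{\partial N}{\partial x_i}=h_i^j\frac{\partial X}{\partial x_j}$). The $k$-th mean curvature is $H_k=\binom{n}{k}^{-1}\sigma_k(\lambda)$, where $\sigma_k$ is the $k$-th elementary symmetric polynomial. Hyperboloid: the model is $\{x_1^2+\cdots+x_n^2-x_{n+1}^2=-1\}$; "a hyperboloid" means any image of it under translations, pseudo-orthogonal transformations and scalings, i.e. a set $\{x\in\mathbb{R}^{n,1}:\langle x-a,x-a\rangle=-r^2\}$ for some $a\in\mathbb{R}^{n,1}$ and $r>0$. "Part of" means a subset of. *)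

theory Defs
  imports "HOL-Analysis.Analysis"
begin

text \<open>Used for open \<open>S\<close> in a finite-dimensional space only, where continuity of all iterated
  directional derivatives is the usual notion of \<open>C\<^sup>k\<close>.\<close>

primrec Ck_on :: "nat \<Rightarrow> 'a::real_normed_vector set \<Rightarrow> ('a \<Rightarrow> 'b::real_normed_vector) \<Rightarrow> bool" where
  "Ck_on 0 S f \<longleftrightarrow> continuous_on S f"
| "Ck_on (Suc k) S f \<longleftrightarrow>
     (\<forall>x\<in>S. f differentiable (at x)) \<and> (\<forall>v. Ck_on k S (\<lambda>x. frechet_derivative f (at x) v))"

definition smooth_on :: "'a::real_normed_vector set \<Rightarrow> ('a \<Rightarrow> 'b::real_normed_vector) \<Rightarrow> bool" where
  "smooth_on S f \<longleftrightarrow> (\<forall>k. Ck_on k S f)"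

text \<open>Smoothness on an arbitrary set: local extendability to smooth maps on open sets.\<close>

definition smooth_map :: "'a::real_normed_vector set \<Rightarrow> ('a \<Rightarrow> 'b::real_normed_vector) \<Rightarrow> bool" where
  "smooth_map A f \<longleftrightarrow>
     (\<forall>p\<in>A. \<exists>U g. open U \<and> p \<in> U \<and> smooth_on U g \<and> (\<forall>x\<in>A \<inter> U. g x = f x))"

text \<open>The second factor carries the time coordinate \<open>x\<^bsub>n+1\<^esub>\<close>; here \<open>n = CARD('n)\<close>.\<close>

type_synonym 'n minkowski = "(real ^ 'n) \<times> real"

definition lor :: "'n::finite minkowski \<Rightarrow> 'n minkowski \<Rightarrow> real" where
  "lor Y Z = fst Y \<bullet> fst Z - snd Y * snd Z"

definition timelike_unit :: "'n::finite minkowski \<Rightarrow> bool" where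
  "timelike_unit Y \<longleftrightarrow> lor Y Y = - 1"

definition hyperplane :: "'n::finite minkowski \<Rightarrow> real \<Rightarrow> 'n minkowski set" where
  "hyperplane N0 c = {x. lor x N0 + c = 0}"

definition hyperboloid :: "'n::finite minkowski \<Rightarrow> real \<Rightarrow> 'n minkowski set" where
  "hyperboloid a r = {x. lor (x - a) (x - a) = - r\<^sup>2}"

definition half_space :: "real ^ 'n \<Rightarrow> (real ^ 'n::finite) set" where
  "half_space a = {y. 0 \<le> a \<bullet> y}"

text \<open>A local parametrization of \<open>M\<close> has domain \<open>W \<inter> half_space a\<close>. The map \<open>X\<close> is required to be
  smooth on the open set \<open>W\<close>, so that derivatives at points of the bounding hyperplane are ordinary
  derivatives; by continuity they do not depend on the values of \<open>X\<close> outside the half-space.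
  Interior charts are those with \<open>W\<close> contained in the open half-space.\<close>

definition local_param ::
    "'n::finite minkowski set \<Rightarrow> real ^ 'n \<Rightarrow> (real ^ 'n) set \<Rightarrow> (real ^ 'n \<Rightarrow> 'n minkowski) \<Rightarrow> bool"
  where
  "local_param M a W X \<longleftrightarrow>
     a \<noteq> 0 \<and> open W \<and> smooth_on W X \<and>
     (\<forall>y\<in>W \<inter> half_space a. inj (frechet_derivative X (at y))) \<and>
     openin (top_of_set M) (X ` (W \<inter> half_space a)) \<and>
     (\<exists>Y. homeomorphism (W \<inter> half_space a) (X ` (W \<inter> half_space a)) X Y)"

definition smooth_hypersurface :: "'n::finite minkowski set \<Rightarrow> bool" where
  "smooth_hypersurface M \<longleftrightarrow>
     (\<forall>p\<in>M. \<exists>a W X. local_param M a W X \<and> p \<in> X ` (W \<inter> half_space a))"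

definition hypersurface_boundary :: "'n::finite minkowski set \<Rightarrow> 'n minkowski set" where
  "hypersurface_boundary M =
     {p. \<exists>a W X y. local_param M a W X \<and> y \<in> W \<and> a \<bullet> y = 0 \<and> p = X y}"

definition partial_deriv ::
    "(real ^ 'n \<Rightarrow> 'n::finite minkowski) \<Rightarrow> 'n \<Rightarrow> real ^ 'n \<Rightarrow> 'n minkowski" where
  "partial_deriv X i y = frechet_derivative X (at y) (axis i 1)"

definition induced_metric ::
    "(real ^ 'n \<Rightarrow> 'n::finite minkowski) \<Rightarrow> real ^ 'n \<Rightarrow> real ^ 'n ^ 'n" where
  "induced_metric X y = (\<chi> i j. lor (partial_deriv X i y) (partial_deriv X j y))"

definition spacelike :: "'n::finite minkowski set \<Rightarrow> bool" where
  "spacelike M \<longleftrightarrow>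
     (\<forall>a W X. local_param M a W X \<longrightarrow>
        (\<forall>y\<in>W \<inter> half_space a. \<forall>v. v \<noteq> 0 \<longrightarrow> 0 < v \<bullet> (induced_metric X y *v v)))"

definition unit_normal_field ::
    "'n::finite minkowski set \<Rightarrow> ('n minkowski \<Rightarrow> 'n minkowski) \<Rightarrow> bool" where
  "unit_normal_field M N \<longleftrightarrow>
     smooth_map M N \<and> (\<forall>p\<in>M. timelike_unit (N p)) \<and>
     (\<forall>a W X. local_param M a W X \<longrightarrow>
        (\<forall>y\<in>W \<inter> half_space a. \<forall>i. lor (N (X y)) (partial_deriv X i y) = 0))"

definition second_fundamental_form ::
    "('n::finite minkowski \<Rightarrow> 'n minkowski) \<Rightarrow> (real ^ 'n \<Rightarrow> 'n minkowski) \<Rightarrow> real ^ 'n \<Rightarrow> real ^ 'n ^ 'n"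
  where
  "second_fundamental_form N X y =
     (\<chi> i j. - lor (partial_deriv (partial_deriv X j) i y) (N (X y)))"

definition shape_operator ::
    "('n::finite minkowski \<Rightarrow> 'n minkowski) \<Rightarrow> (real ^ 'n \<Rightarrow> 'n minkowski) \<Rightarrow> real ^ 'n \<Rightarrow> real ^ 'n ^ 'n"
  where
  "shape_operator N X y =
     (\<chi> i j. \<Sum>l\<in>UNIV. matrix_inv (induced_metric X y) $ j $ l * second_fundamental_form N X y $ i $ l)"

text \<open>The entries of \<open>lam\<close> are the eigenvalues of \<open>A\<close>, listed with algebraic multiplicity.\<close>

definition eigenvalue_list :: "real ^ 'n ^ 'n \<Rightarrow> real ^ 'n::finite \<Rightarrow> bool" where
  "eigenvalue_list A lam \<longleftrightarrow> (\<forall>t. det (mat t - A) = (\<Prod>i\<in>UNIV. t - lam $ i))"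

text \<open>The shape operator of a spacelike hypersurface is self-adjoint for the positive definite
  induced metric, so a list of real eigenvalues exists; it is unique up to order, which is irrelevant
  for symmetric functions.\<close>

definition principal_curvatures ::
    "('n::finite minkowski \<Rightarrow> 'n minkowski) \<Rightarrow> (real ^ 'n \<Rightarrow> 'n minkowski) \<Rightarrow> real ^ 'n \<Rightarrow> real ^ 'n"
  where
  "principal_curvatures N X y = (SOME lam. eigenvalue_list (shape_operator N X y) lam)"

definition elem_sym :: "nat \<Rightarrow> real ^ 'n::finite \<Rightarrow> real" where
  "elem_sym k lam = (\<Sum>S | card S = k. \<Prod>i\<in>S. lam $ i)"

definition mean_curvature ::
    "nat \<Rightarrow> ('n::finite minkowski \<Rightarrow> 'n minkowski) \<Rightarrow> (real ^ 'n \<Rightarrow> 'n minkowski) \<Rightarrow> real ^ 'n \<Rightarrow> real"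
  where
  "mean_curvature k N X y = elem_sym k (principal_curvatures N X y) / real (CARD('n) choose k)"

definition constant_mean_curvature ::
    "nat \<Rightarrow> 'n::finite minkowski set \<Rightarrow> ('n minkowski \<Rightarrow> 'n minkowski) \<Rightarrow> bool" where
  "constant_mean_curvature k M N \<longleftrightarrow>
     (\<exists>H. \<forall>a W X. local_param M a W X \<longrightarrow>
        (\<forall>y\<in>W \<inter> half_space a. mean_curvature k N X y = H))"

text \<open>The boundary of \<open>D\<close> relative to the hyperplane is \<open>closure D - D\<close>, since \<open>D\<close> is relatively open
  and the hyperplane is closed; the ambient \<open>frontier D\<close> would be all of \<open>closure D\<close>. Near each
  boundary point, \<open>D\<close> is a strict sublevel set of a smooth function whose differential does not
  vanish on the directions \<open>v\<close> tangent to the hyperplane.\<close>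

definition smooth_domain :: "'n::finite minkowski \<Rightarrow> real \<Rightarrow> 'n minkowski set \<Rightarrow> bool" where
  "smooth_domain N0 c D \<longleftrightarrow>
     D \<subseteq> hyperplane N0 c \<and> openin (top_of_set (hyperplane N0 c)) D \<and> bounded D \<and> connected D \<and>
     (\<forall>p\<in>closure D - D. \<exists>U \<rho>. open U \<and> p \<in> U \<and> smooth_on U (\<rho> :: 'n minkowski \<Rightarrow> real) \<and>
        (\<exists>v. lor v N0 = 0 \<and> frechet_derivative \<rho> (at p) v \<noteq> 0) \<and>
        D \<inter> U = {x \<in> hyperplane N0 c \<inter> U. \<rho> x < 0})"

definition graph_on :: "'n::finite minkowski \<Rightarrow> real \<Rightarrow> 'n minkowski set \<Rightarrow> bool" where
  "graph_on N0 c M \<longleftrightarrow>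
     (\<exists>D (u :: 'n minkowski \<Rightarrow> real). smooth_domain N0 c D \<and> smooth_map (closure D) u \<and>
        M = {x + u x *\<^sub>R N0 | x. x \<in> closure D})"

definition constant_intersection_angles ::
    "'n::finite minkowski \<Rightarrow> real \<Rightarrow> 'n minkowski set \<Rightarrow> ('n minkowski \<Rightarrow> 'n minkowski) \<Rightarrow> bool" where
  "constant_intersection_angles N0 c M N \<longleftrightarrow>
     hypersurface_boundary M \<subseteq> hyperplane N0 c \<and>
     (\<exists>\<theta>. \<forall>p\<in>hypersurface_boundary M. lor (N p) N0 = \<theta>)"

end

theory Submission
  imports Defs "HOL-Computational_Algebra.Fundamental_Theorem_Algebra"
begin

text \<open>
  In coordinates on \<open>\<Pi>\<close> the hypersurface is the graph of a function \<open>u\<close> over a domain \<open>D \<subseteq> \<real>\<^sup>n\<close>; it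
  vanishes on the frontier of \<open>D\<close>. With \<open>w = 1 / \<surd>(1 - |Du|\<^sup>2)\<close> and \<open>W = w Du\<close> the shape operator is the
  Jacobian matrix \<open>A = DW\<close>, so its Newton tensors \<open>T\<^sub>j\<close> are divergence free (Piola), and \<open>w\<close> equals a
  constant \<open>w\<^sub>0\<close> on the frontier.

  Up to reflection \<open>u\<close> is negative somewhere. Then there is a point where \<open>A\<close> has positive eigenvalues,
  and as \<open>\<sigma>\<^sub>k(A)\<close> is constant, connectedness and Maclaurin's inequality put all eigenvalues in the
  Garding cone. Put \<open>R\<^sup>k = H\<^sub>k\<close> and \<open>q = w - w\<^sub>0 - R u\<close>. The field \<open>Z = T\<^sub>k\<^sub>-\<^sub>1 (R - A) W\<close> satisfies
  \<open>Dq \<bullet> Z \<le> 0\<close> by positivity of \<open>T\<^sub>k\<^sub>-\<^sub>1\<close> and \<open>div Z \<le> 0\<close> by the Newton-Maclaurin inequalities;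
  integrating \<open>div (q Z)\<close> over \<open>{q > 0}\<close> gives \<open>q \<le> 0\<close>. The field
  \<open>(w\<^sub>0 - w) T\<^sub>k\<^sub>-\<^sub>1 x + u A T\<^sub>k\<^sub>-\<^sub>1 x\<close> also vanishes on the frontier, and its divergence yields
  \<open>\<integral> (n - k + 1) \<sigma>\<^sub>k\<^sub>-\<^sub>1 (w\<^sub>0 - w) + k \<sigma>\<^sub>k u = 0\<close>, whose integrand is nonnegative because of
  \<open>q \<le> 0\<close>. Hence \<open>q = 0\<close>, equality holds in the Newton-Maclaurin inequalities, \<open>A = R I\<close>, and
  \<open>W - R x\<close> is constant, which is a hyperboloid.

  All fields that are integrated vanish on the frontier, so the divergence theorem is needed only in a
  form without boundary regularity.
\<close>

section \<open>Elementary symmetric functions of real numbers\<close>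

text \<open>On the model hyperboloid \<open>w\<close> is an affine function of \<open>u\<close> with
  slope \<open>R\<close>; so \<open>q\<close> measures the deviation from the model, and the
  constant angle makes it vanish on the frontier.

  The matrix \<open>A\<close> is not symmetric. It is the product of the positive definite
  \<open>G = I + W W^T\<close>, the inverse of the induced metric, and the symmetric
  \<open>w D^2 u\<close>. The product form gives \<open>A G = G A^T\<close>; a square root of
  \<open>G\<close> conjugates \<open>A\<close> to a symmetric matrix, whence real eigenvalues and
  the positivity of \<open>T_j G\<close> from that of the eigenvalues of \<open>T_j\<close>.

  The fields contain second derivatives of \<open>u\<close>, but as the \<open>T_j\<close> are
  divergence free no third derivatives enter their divergences. Bounded second derivatives suffice
  for every integral, and smoothness up to the boundary supplies them.

  Cutting off near the frontier requires the form \<open>f Z\<close> with \<open>f > 0\<close>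
  inside and \<open>f = 0\<close> on the frontier. Hence the second field is integrated in two
  pieces, with \<open>f = w_0 - w\<close> and \<open>f = - u\<close>; that both are positive inside
  is known only after \<open>u < 0\<close> and \<open>q \<le> 0\<close>.\<close>

definition esym :: "'a set \<Rightarrow> ('a \<Rightarrow> real) \<Rightarrow> nat \<Rightarrow> real" where
  "esym A f k = (\<Sum>S | S \<subseteq> A \<and> card S = k. \<Prod>i\<in>S. f i)"

lemma esym_0 [simp]: "finite A \<Longrightarrow> esym A f 0 = 1"
proof -
  assume "finite A"
  then have "{S. S \<subseteq> A \<and> card S = 0} = {{}}" by (auto dest: finite_subset)
  then show ?thesis by (simp add: esym_def)
qed

lemma esym_insert:
  assumes "finite A" "a \<notin> A"
  shows "esym (insert a A) f (Suc k) = esym A f (Suc k) + f a * esym A f k"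
proof -
  have fin: "finite {S. S \<subseteq> A \<and> card S = j}" for j
    using assms by auto
  have split: "{S. S \<subseteq> insert a A \<and> card S = Suc k} =
      {S. S \<subseteq> A \<and> card S = Suc k} \<union> insert a ` {S. S \<subseteq> A \<and> card S = k}" (is "?L = ?B \<union> ?C")
  proof
    show "?L \<subseteq> ?B \<union> ?C"
    proof
      fix S assume S: "S \<in> ?L"
      show "S \<in> ?B \<union> ?C"
      proof (cases "a \<in> S")
        case False then show ?thesis using S by auto
      next
        case True
        have "card (S - {a}) = k" using S True by simp
        moreover have "S - {a} \<subseteq> A" using S by auto
        moreover have "S = insert a (S - {a})" using True by auto
        ultimately show ?thesis by blast
      qed
    qed
    show "?B \<union> ?C \<subseteq> ?L"
    proof -
      have "card (insert a S) = Suc (card S)" if "S \<subseteq> A" for S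
        using that assms by (intro card_insert_disjoint) (auto dest: finite_subset)
      then show ?thesis by auto
    qed
  qed
  have "esym (insert a A) f (Suc k) = (\<Sum>S\<in>?B. prod f S) + (\<Sum>S\<in>?C. prod f S)"
    unfolding esym_def split using assms fin by (intro sum.union_disjoint) auto
  moreover have "(\<Sum>S\<in>?C. prod f S) = (\<Sum>S | S \<subseteq> A \<and> card S = k. f a * prod f S)"
  proof (subst sum.reindex)
    show "inj_on (insert a) {S. S \<subseteq> A \<and> card S = k}"
      using assms by (intro inj_onI) (metis (mono_tags, lifting) in_mono insert_ident mem_Collect_eq)
    show "sum (prod f \<circ> insert a) {S. S \<subseteq> A \<and> card S = k} = (\<Sum>S | S \<subseteq> A \<and> card S = k. f a * prod f S)"
      using assms by (intro sum.cong refl) (auto simp: finite_subset intro!: prod.insert)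
  qed
  ultimately show ?thesis by (simp add: esym_def sum_distrib_left)
qed

lemma esym_eq_0: "finite A \<Longrightarrow> card A < k \<Longrightarrow> esym A f k = 0"
proof -
  assume "finite A" "card A < k"
  then have "{S. S \<subseteq> A \<and> card S = k} = {}" by (auto dest: card_mono)
  then show ?thesis unfolding esym_def by (simp only: sum.empty)
qed

section \<open>Real-rooted polynomials and Newton's inequalities\<close>

lemma coeff_prod_linear:
  "finite A \<Longrightarrow> coeff (\<Prod>i\<in>A. [:1, f i:]) k = esym A f k"
proof (induction A arbitrary: k rule: finite_induct)
  case empty
  then show ?case by (cases k) (auto simp: esym_eq_0)
next
  case (insert a A)
  then show ?case by (cases k) (auto simp: esym_insert)
qed

text \<open>Factors with \<open>b = 0\<close> stand for roots at infinity. They keep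
  \<open>d\<close> a nominal degree: it counts every factor \<open>[:1, f i:]\<close>, also for
  \<open>f i = 0\<close>, and drops by exactly one under differentiation whatever the true degree
  is.\<close>

definition real_split :: "nat \<Rightarrow> real poly \<Rightarrow> bool" where
  "real_split d p \<longleftrightarrow> (\<exists>c xs. length xs = d \<and> p = smult c (\<Prod>(a, b)\<leftarrow>xs. [:a, b:]))"

lemma real_split_linear:
  assumes "finite A" shows "real_split (card A) (\<Prod>i\<in>A. [:1, f i:])"
proof -
  obtain xs where xs: "set xs = A" "distinct xs" using finite_distinct_list[OF assms] by blast
  have "(\<Prod>i\<in>A. [:1, f i:]) = (\<Prod>(a, b)\<leftarrow>map (\<lambda>i. (1, f i)) xs. [:a, b:])"
    using xs by (simp add: prod.distinct_set_conv_list[symmetric] comp_def)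
  then show ?thesis unfolding real_split_def
    using xs by (intro exI[of _ 1] exI[of _ "map (\<lambda>i. (1, f i)) xs"]) (auto simp: distinct_card)
qed

text \<open>The inductive step when a factor \<open>[:x, y:]\<close> is multiplied to a polynomial
  with lowest coefficients \<open>a\<close>, \<open>b\<close>, \<open>c\<close>. After scaling by
  \<open>d\<close> the new slack is \<open>(d + 1) x^2\<close> times the old one plus the square
  \<open>(d y a - x b)^2\<close>.\<close>

lemma Laguerre_aux:
  fixes d :: real assumes "d > 0" and h: "2 * d * a * c \<le> (d - 1) * b\<^sup>2"
  shows "2 * (d + 1) * (x * a) * (x * c + y * b) \<le> d * (x * b + y * a)\<^sup>2"
proof -
  have "2 * d * (x\<^sup>2 * (a * c)) \<le> (d - 1) * (x\<^sup>2 * b\<^sup>2)"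
    using mult_left_mono[OF h, of "x\<^sup>2"] by (simp add: algebra_simps)
  then have "(d + 1) * (2 * d * (x\<^sup>2 * (a * c))) \<le> (d + 1) * ((d - 1) * (x\<^sup>2 * b\<^sup>2))"
    using assms by (intro mult_left_mono) auto
  moreover have "0 \<le> (d * y * a - x * b)\<^sup>2" by simp
  ultimately have "d * (2 * (d + 1) * (x * a) * (x * c + y * b)) \<le> d * (d * (x * b + y * a)\<^sup>2)"
    by (simp add: power2_eq_square algebra_simps)
  then show ?thesis using assms by (simp add: mult_le_cancel_left)
qed

text \<open>Newton's inequality for the three lowest coefficients; \<open>d\<close> is a nominal degree.\<close>

lemma real_split_Laguerre:
  assumes "real_split d p" "d \<ge> 1"
  shows "2 * real d * coeff p 0 * coeff p 2 \<le> (real d - 1) * (coeff p 1)\<^sup>2"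
proof -
  have main: "2 * real (length xs) * coeff q 0 * coeff q 2 \<le> (real (length xs) - 1) * (coeff q 1)\<^sup>2"
    if "q = (\<Prod>(a, b)\<leftarrow>xs. [:a, b:])" "xs \<noteq> []" for q and xs :: "(real \<times> real) list"
    using that
  proof (induction xs arbitrary: q)
    case (Cons z zs)
    obtain x y where z: "z = (x, y)" by force
    define r where "r = (\<Prod>(a, b)\<leftarrow>zs. [:a, b:])"
    have q: "q = [:x, y:] * r" using Cons.prems z by (simp add: r_def)
    have co: "coeff q 0 = x * coeff r 0" "coeff q 1 = x * coeff r 1 + y * coeff r 0"
      "coeff q 2 = x * coeff r 2 + y * coeff r 1"
      by (simp_all add: q numeral_2_eq_2)
    show ?case
    proof (cases "zs = []")
      case True
      then show ?thesis using co by (simp add: r_def)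
    next
      case False
      have "2 * real (length zs) * coeff r 0 * coeff r 2 \<le> (real (length zs) - 1) * (coeff r 1)\<^sup>2"
        using Cons.IH[OF r_def False] .
      from Laguerre_aux[OF _ this] False show ?thesis by (simp add: co[simplified] algebra_simps)
    qed
  qed auto
  obtain c xs where p: "length xs = d" "p = smult c (\<Prod>(a, b)\<leftarrow>xs. [:a, b:])"
    using assms by (auto simp: real_split_def)
  have "2 * real (length xs) * coeff (\<Prod>(a, b)\<leftarrow>xs. [:a, b:]) 0 * coeff (\<Prod>(a, b)\<leftarrow>xs. [:a, b:]) 2
      \<le> (real (length xs) - 1) * (coeff (\<Prod>(a, b)\<leftarrow>xs. [:a, b:]) 1)\<^sup>2" (is "?L \<le> ?R")
    using main[OF refl, of xs] p assms(2) by (cases "xs = []") simp_all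
  then have "c\<^sup>2 * ?L \<le> c\<^sup>2 * ?R" by (intro mult_left_mono) auto
  then show ?thesis using p by (simp add: power2_eq_square algebra_simps)
qed

lemma map_poly_of_real_mult:
  "map_poly complex_of_real (p * q) = map_poly of_real p * map_poly of_real q"
  by (rule poly_eqI) (simp add: coeff_map_poly coeff_mult)

lemma poly_map_poly_of_real: "poly (map_poly complex_of_real p) (of_real x) = of_real (poly p x)"
  by (induction p) (auto simp: map_poly_pCons)

lemma real_splitI:
  assumes "degree p \<le> d" "\<And>z. p \<noteq> 0 \<Longrightarrow> poly (map_poly complex_of_real p) z = 0 \<Longrightarrow> z \<in> \<real>"
  shows "real_split d p"
  using assms
proof (induction d arbitrary: p)
  case 0
  then obtain c where "p = [:c:]" using degree_eq_zeroE by blast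
  then show ?case by (auto simp: real_split_def)
next
  case (Suc d)
  show ?case
  proof (cases "degree p = 0")
    case True
    then obtain c where c: "p = [:c:]" using degree_eq_zeroE by blast
    \<comment> \<open>A constant, zero included, is padded with factors \<open>[:1, 0:] = 1\<close>
      up to the nominal degree.\<close>
    show ?thesis unfolding real_split_def
      by (rule exI[of _ c], rule exI[of _ "replicate (Suc d) (1, 0)"])
         (simp add: c prod_list_replicate flip: one_pCons)
  next
    case False
    then have p0: "p \<noteq> 0" by auto
    have "degree (map_poly complex_of_real p) = degree p" by (simp add: degree_map_poly)
    then have "\<not> constant (poly (map_poly complex_of_real p))"
      using False constant_degree by metis
    then obtain z where z: "poly (map_poly complex_of_real p) z = 0"
      using fundamental_theorem_of_algebra by blast
    then have "z \<in> \<real>" using Suc.prems(2) p0 by blast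
    then obtain x where x: "z = of_real x" by (auto elim: Reals_cases)
    have "of_real (poly p x) = (0::complex)" using z x by (simp add: poly_map_poly_of_real)
    then have "[:- x, 1:] dvd p" by (simp add: poly_eq_0_iff_dvd)
    then obtain q where q: "p = [:- x, 1:] * q" by (auto elim: dvdE)
    have q0: "q \<noteq> 0" using p0 q by auto
    have "degree p = Suc (degree q)" unfolding q using q0 by (subst degree_mult_eq) auto
    then have dq: "degree q \<le> d" using Suc.prems by auto
    have "real_split d q"
    proof (rule Suc.IH[OF dq])
      fix z assume "poly (map_poly complex_of_real q) z = 0"
      moreover have "map_poly complex_of_real p = map_poly complex_of_real [:- x, 1:] * map_poly complex_of_real q"
        unfolding q by (rule map_poly_of_real_mult)
      ultimately have "poly (map_poly complex_of_real p) z = 0" by simp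
      then show "z \<in> \<real>" using Suc.prems(2) p0 by blast
    qed
    then obtain c xs where "length xs = d" "q = smult c (\<Prod>(a, b)\<leftarrow>xs. [:a, b:])"
      by (auto simp: real_split_def)
    then show ?thesis unfolding real_split_def q
      by (intro exI[of _ c] exI[of _ "(- x, 1) # xs"]) auto
  qed
qed

text \<open>At a non-real \<open>z\<close> every summand of the logarithmic derivative \<open>\<Sum> b / (a + b z)\<close> has an
  imaginary part of the sign of \<open>- Im z\<close>, so a real-rooted polynomial has a real-rooted derivative.\<close>

lemma prod_linear_pderiv_root:
  fixes xs :: "(real \<times> real) list" and z :: complex
  assumes "Im z \<noteq> 0" "(0, 0) \<notin> set xs"
  defines "q \<equiv> (\<lambda>xs. \<Prod>(a, b)\<leftarrow>xs. [:complex_of_real a, complex_of_real b:])"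
  shows "poly (q xs) z \<noteq> 0"
    and "Im z * Im (poly (pderiv (q xs)) z / poly (q xs) z) \<le> 0"
    and "(\<exists>(a, b)\<in>set xs. b \<noteq> 0) \<Longrightarrow> Im z * Im (poly (pderiv (q xs)) z / poly (q xs) z) < 0"
proof -
  have nz: "complex_of_real a + z * of_real b \<noteq> 0" if "(a, b) \<noteq> (0, 0)" for a b
    using that assms(1) by (auto simp: complex_eq_iff)
  have im: "Im z * Im (of_real b / (of_real a + z * of_real b)) \<le> 0"
      "b \<noteq> 0 \<Longrightarrow> Im z * Im (of_real b / (of_real a + z * of_real b)) < 0" if "(a, b) \<noteq> (0, 0)" for a b :: real
  proof -
    define D where "D = (a + Re z * b)\<^sup>2 + (Im z * b)\<^sup>2"
    have "D > 0" using that assms(1) unfolding D_def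
      by (cases "b = 0") (auto simp: sum_power2_gt_zero_iff)
    have "Im z * Im (of_real b / (of_real a + z * of_real b)) = - (b\<^sup>2 * (Im z)\<^sup>2 / D)"
      by (simp add: Im_divide D_def power2_eq_square)
    then show "Im z * Im (of_real b / (of_real a + z * of_real b)) \<le> 0"
      "b \<noteq> 0 \<Longrightarrow> Im z * Im (of_real b / (of_real a + z * of_real b)) < 0"
      using \<open>D > 0\<close> assms(1) by auto
  qed
  have all: "poly (q xs) z \<noteq> 0 \<and> Im z * Im (poly (pderiv (q xs)) z / poly (q xs) z) \<le> 0 \<and>
    ((\<exists>(a, b)\<in>set xs. b \<noteq> 0) \<longrightarrow> Im z * Im (poly (pderiv (q xs)) z / poly (q xs) z) < 0)"
    using assms(2)
  proof (induction xs)
    case Nil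
    then show ?case by (simp add: q_def)
  next
    case (Cons t ts)
    obtain a b where t: "t = (a, b)" by force
    have ab: "(a, b) \<noteq> (0, 0)" using Cons.prems t by auto
    have IH: "poly (q ts) z \<noteq> 0" "Im z * Im (poly (pderiv (q ts)) z / poly (q ts) z) \<le> 0"
      "(\<exists>(a, b)\<in>set ts. b \<noteq> 0) \<longrightarrow> Im z * Im (poly (pderiv (q ts)) z / poly (q ts) z) < 0"
      using Cons by auto
    have q: "q (t # ts) = [:of_real a, of_real b:] * q ts" by (simp add: q_def t)
    have 1: "poly (q (t # ts)) z \<noteq> 0" using nz[OF ab] IH(1) unfolding q poly_mult by simp
    have "poly (pderiv (q (t # ts))) z / poly (q (t # ts)) z =
       of_real b / (of_real a + z * of_real b) + poly (pderiv (q ts)) z / poly (q ts) z"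
      using nz[OF ab] IH(1) unfolding q pderiv_mult poly_mult poly_add
      by (simp add: pderiv_pCons add_divide_distrib)
    then have 2: "Im z * Im (poly (pderiv (q (t # ts))) z / poly (q (t # ts)) z) =
       Im z * Im (of_real b / (of_real a + z * of_real b)) + Im z * Im (poly (pderiv (q ts)) z / poly (q ts) z)"
      by (simp add: distrib_left)
    show ?case unfolding 2 using 1 IH im[OF ab] t by auto
  qed
  then show "poly (q xs) z \<noteq> 0"
    and "Im z * Im (poly (pderiv (q xs)) z / poly (q xs) z) \<le> 0"
    and "(\<exists>(a, b)\<in>set xs. b \<noteq> 0) \<Longrightarrow> Im z * Im (poly (pderiv (q xs)) z / poly (q xs) z) < 0"
    by auto
qed

lemma map_poly_of_real_prod_list:
  "map_poly complex_of_real (\<Prod>(a, b)\<leftarrow>xs. [:a, b:]) = (\<Prod>(a, b)\<leftarrow>xs. [:of_real a, of_real b:])"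
  by (induction xs) (auto simp: map_poly_of_real_mult map_poly_pCons simp del: mult_pCons_left)

lemma real_split_pderiv:
  assumes "real_split (Suc d) p" shows "real_split d (pderiv p)"
proof -
  obtain c xs where p: "length xs = Suc d" "p = smult c (\<Prod>(a, b)\<leftarrow>xs. [:a, b:])"
    using assms by (auto simp: real_split_def)
  have degl: "degree (\<Prod>(a, b)\<leftarrow>ys. [:a, b:]) \<le> length ys" for ys :: "(real \<times> real) list"
  proof (induction ys)
    case (Cons t ts)
    obtain a b where t: "t = (a, b)" by force
    have "degree ([:a, b:] * (\<Prod>(a, b)\<leftarrow>ts. [:a, b:])) \<le> degree [:a, b:] + degree (\<Prod>(a, b)\<leftarrow>ts. [:a, b:])"
      by (rule degree_mult_le)
    also have "\<dots> \<le> Suc (length ts)" using Cons by auto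
    finally show ?case by (simp add: t del: mult_pCons_left)
  qed auto
  have "degree p \<le> Suc d" using degl[of xs] p order_trans[OF degree_smult_le] by auto
  then have deg: "degree (pderiv p) \<le> d" by (simp add: degree_pderiv)
  show ?thesis
  proof (rule real_splitI[OF deg], rule ccontr)
    fix z assume nz: "pderiv p \<noteq> 0" and rt: "poly (map_poly complex_of_real (pderiv p)) z = 0" and "z \<notin> \<real>"
    have im: "Im z \<noteq> 0" using \<open>z \<notin> \<real>\<close> complex_is_Real_iff by blast
    have pnz: "(\<Prod>(a, b)\<leftarrow>xs. [:a, b:]) \<noteq> 0" and c: "c \<noteq> 0"
      using nz p by auto
    have nn: "(0, 0) \<notin> set xs"
    proof
      assume "(0, 0) \<in> set xs"
      then have "0 \<in> set (map (\<lambda>(a, b). [:a, b:]) xs)" by force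
      then show False using pnz prod_list_zero_iff by blast
    qed
    have ex: "\<exists>(a, b)\<in>set xs. b \<noteq> 0"
    proof (rule ccontr)
      assume "\<not> ?thesis"
      then have "\<exists>c. (\<Prod>(a, b)\<leftarrow>xs. [:a, b:]) = [:c:]"
      proof (induction xs)
        case (Cons t ts)
        then obtain c where "(\<Prod>(a, b)\<leftarrow>ts. [:a, b:]) = [:c:]" by auto
        then show ?case using Cons.prems by (cases t) auto
      qed (auto simp: one_pCons)
      then have "degree (\<Prod>(a, b)\<leftarrow>xs. [:a, b:]) = 0" by auto
      then show False using nz p by (simp add: pderiv_eq_0_iff split: if_splits)
    qed
    have "map_poly complex_of_real (pderiv p) = pderiv (map_poly complex_of_real p)"
      by (rule poly_eqI) (simp add: coeff_pderiv coeff_map_poly)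
    also have "map_poly complex_of_real p = smult (of_real c) (\<Prod>(a, b)\<leftarrow>xs. [:of_real a, of_real b:])"
      unfolding p map_poly_of_real_prod_list[symmetric]
      by (rule poly_eqI) (simp add: coeff_map_poly)
    finally have "poly (pderiv (\<Prod>(a, b)\<leftarrow>xs. [:complex_of_real a, of_real b:])) z = 0"
      using rt c by (simp add: pderiv_smult)
    then show False using prod_linear_pderiv_root(3)[OF im nn ex] by simp
  qed
qed

text \<open>Differentiation preserves real-rootedness and shifts the coefficients down by one, so
  the inequality at index \<open>j\<close> is the one for the three lowest coefficients of the
  \<open>j\<close>-th derivative.\<close>

lemma real_split_Newton:
  assumes "real_split d p" "j + 1 \<le> d"
  shows "(real j + 2) * (real d - real j) * coeff p j * coeff p (j + 2)
    \<le> (real j + 1) * (real d - real j - 1) * (coeff p (j + 1))\<^sup>2"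
  using assms
proof (induction j arbitrary: d p)
  case 0
  then show ?case using real_split_Laguerre[of d p] by (simp add: numeral_2_eq_2)
next
  case (Suc j)
  then obtain d' where d: "d = Suc d'" by (cases d) auto
  have "(real j + 2) * (real d' - real j) * coeff (pderiv p) j * coeff (pderiv p) (j + 2)
    \<le> (real j + 1) * (real d' - real j - 1) * (coeff (pderiv p) (j + 1))\<^sup>2"
    using Suc real_split_pderiv d by auto
  then have "((real j + 1) * (real j + 2)) * ((real (Suc j) + 2) * (real d - real (Suc j)) * coeff p (Suc j) * coeff p (Suc j + 2))
    \<le> ((real j + 1) * (real j + 2)) * ((real (Suc j) + 1) * (real d - real (Suc j) - 1) * (coeff p (Suc j + 1))\<^sup>2)"
    unfolding d coeff_pderiv by (simp add: power2_eq_square algebra_simps)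
  then show ?case by (simp add: mult_le_cancel_left)
qed

text \<open>The product of the factors \<open>1 + f i t\<close> is the generating polynomial of the
  symmetric functions, and it is real-rooted of nominal degree \<open>card A\<close>.\<close>

lemma esym_Newton:
  assumes "finite A" "j + 1 \<le> card A"
  shows "(real j + 2) * (real (card A) - real j) * esym A f j * esym A f (j + 2)
    \<le> (real j + 1) * (real (card A) - real j - 1) * (esym A f (j + 1))\<^sup>2"
  using real_split_Newton[OF real_split_linear[OF assms(1), of f] assms(2)]
  by (simp add: coeff_prod_linear assms)

section \<open>Maclaurin's inequalities and the Garding cone\<close>

definition emean :: "'a set \<Rightarrow> ('a \<Rightarrow> real) \<Rightarrow> nat \<Rightarrow> real" where
  "emean A f k = esym A f k / real (card A choose k)"

lemma emean_0 [simp]: "finite A \<Longrightarrow> emean A f 0 = 1"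
  by (simp add: emean_def)

lemma esym_emean: "finite A \<Longrightarrow> esym A f k = real (card A choose k) * emean A f k"
  by (cases "k \<le> card A") (auto simp: emean_def esym_eq_0)

lemma choose_Suc_mult:
  "k \<le> m \<Longrightarrow> (real k + 1) * real (m choose Suc k) = (real m - real k) * real (m choose k)"
proof -
  assume "k \<le> m"
  have "Suc k * (m choose Suc k) = (m - k) * (m choose k)"
    by (simp only: binomial_absorption binomial_absorb_comp)
  then have "real (Suc k * (m choose Suc k)) = real ((m - k) * (m choose k))" by presburger
  then show ?thesis using \<open>k \<le> m\<close> by (simp add: of_nat_diff algebra_simps)
qed

lemma emean_Newton:
  assumes "finite A" "j + 2 \<le> card A"
  shows "emean A f j * emean A f (j + 2) \<le> (emean A f (j + 1))\<^sup>2"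
proof -
  define m where "m = real (card A)"
  define c0 c1 c2 where "c0 = real (card A choose j)" and "c1 = real (card A choose (j + 1))"
    and "c2 = real (card A choose (j + 2))"
  have pos: "c0 > 0" "c1 > 0" "c2 > 0" using assms by (auto simp: c0_def c1_def c2_def)
  have c1: "(real j + 1) * c1 = (m - real j) * c0"
    using choose_Suc_mult[of j "card A"] assms by (simp add: c0_def c1_def m_def)
  have c2: "(real j + 2) * c2 = (m - real j - 1) * c1"
    using choose_Suc_mult[of "Suc j" "card A"] assms by (simp add: c2_def c1_def m_def algebra_simps)
  have mj: "m - real j - 1 > 0" using assms by (simp add: m_def)
  have "(real j + 2) * (m - real j) * (c0 * emean A f j) * (c2 * emean A f (j + 2))
      \<le> (real j + 1) * (m - real j - 1) * (c1 * emean A f (j + 1))\<^sup>2"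
    using esym_Newton[OF assms(1), of j f] assms
    by (simp add: esym_emean c0_def c1_def c2_def m_def)
  also have "(real j + 2) * (m - real j) * (c0 * emean A f j) * (c2 * emean A f (j + 2)) =
      ((m - real j) * c0) * ((real j + 2) * c2) * (emean A f j * emean A f (j + 2))" by (simp add: algebra_simps)
  also have "\<dots> = ((real j + 1) * (m - real j - 1) * c1\<^sup>2) * (emean A f j * emean A f (j + 2))"
    unfolding c1[symmetric] c2 by (simp add: power2_eq_square algebra_simps)
  finally have "((real j + 1) * (m - real j - 1) * c1\<^sup>2) * (emean A f j * emean A f (j + 2))
      \<le> ((real j + 1) * (m - real j - 1) * c1\<^sup>2) * (emean A f (j + 1))\<^sup>2"
    by (simp add: power_mult_distrib mult.assoc)
  moreover have "(real j + 1) * (m - real j - 1) * c1\<^sup>2 > 0" using mj pos by auto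
  ultimately show ?thesis by (simp only: mult_le_cancel_left_pos)
qed

lemma emean_pos_iff:
  assumes "finite A" "j \<le> card A" shows "emean A f j > 0 \<longleftrightarrow> esym A f j > 0"
  using assms by (auto simp: emean_def zero_less_divide_iff)

text \<open>Newton's inequality says that the ratios of consecutive means decrease as long as the
  denominators are positive, so the last ratio is at most the first, which is
  \<open>emean A f 1\<close>. The sign of the last mean is free.\<close>

lemma emean_Suc_le:
  assumes "finite A" "\<forall>j. 1 \<le> j \<and> j \<le> k \<longrightarrow> esym A f j > 0" "k < card A"
  shows "emean A f (Suc k) \<le> emean A f 1 * emean A f k"
  using assms(2,3)
proof (induction k)
  case (Suc k)
  have p: "emean A f k > 0" "emean A f (Suc k) > 0"
    using Suc.prems assms(1) by (cases k; simp add: emean_pos_iff)+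
  have IH: "emean A f (Suc k) \<le> emean A f 1 * emean A f k" using Suc by auto
  have "emean A f k * emean A f (Suc (Suc k)) \<le> (emean A f (Suc k))\<^sup>2"
    using emean_Newton[OF assms(1), of k f] Suc.prems by simp
  also have "\<dots> \<le> emean A f (Suc k) * (emean A f 1 * emean A f k)"
    unfolding power2_eq_square using IH p by (intro mult_left_mono) auto
  finally have "emean A f k * emean A f (Suc (Suc k)) \<le> emean A f k * (emean A f 1 * emean A f (Suc k))"
    by (simp add: mult.commute mult.left_commute)
  then show ?case using p by (simp only: mult_le_cancel_left_pos)
qed (use assms in simp)

text \<open>The monotonicity of the \<open>k\<close>-th roots of the \<open>k\<close>-th means, in a
  form without roots: raise Newton's inequality to the power \<open>k + 1\<close>, insert the
  previous step and cancel.\<close>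

lemma emean_Maclaurin_step:
  assumes "finite A" "\<forall>j. 1 \<le> j \<and> j \<le> k \<longrightarrow> esym A f j > 0" "Suc k \<le> card A" "esym A f (Suc k) > 0"
  shows "(emean A f (Suc k)) ^ k \<le> (emean A f k) ^ Suc k"
  using assms(2,3,4)
proof (induction k)
  case (Suc k)
  have p: "emean A f k > 0" "emean A f (Suc k) > 0" "emean A f (Suc (Suc k)) > 0"
    using Suc.prems assms(1) by (cases k; simp add: emean_pos_iff)+
  have IH: "(emean A f (Suc k)) ^ k \<le> (emean A f k) ^ Suc k" using Suc by auto
  have "emean A f k * emean A f (Suc (Suc k)) \<le> (emean A f (Suc k))\<^sup>2"
    using emean_Newton[OF assms(1), of k f] Suc.prems by simp
  then have "(emean A f k * emean A f (Suc (Suc k))) ^ Suc k \<le> ((emean A f (Suc k))\<^sup>2) ^ Suc k"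
    using p by (intro power_mono) auto
  then have "emean A f k ^ Suc k * emean A f (Suc (Suc k)) ^ Suc k \<le> emean A f (Suc k) ^ k * emean A f (Suc k) ^ Suc (Suc k)"
    by (simp only: power_mult_distrib flip: power_mult power_add) (simp add: mult_2)
  moreover have "(emean A f (Suc k)) ^ k * emean A f (Suc (Suc k)) ^ Suc k \<le> emean A f k ^ Suc k * emean A f (Suc (Suc k)) ^ Suc k"
    using IH p by (intro mult_right_mono) auto
  ultimately have "emean A f (Suc k) ^ k * emean A f (Suc (Suc k)) ^ Suc k \<le> emean A f (Suc k) ^ k * emean A f (Suc k) ^ Suc (Suc k)"
    by linarith
  then show ?case using p by (simp only: mult_le_cancel_left_pos zero_less_power)
qed (use assms in simp)

text \<open>Downward induction from \<open>j = k\<close>, where equality holds.\<close>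

lemma emean_Maclaurin:
  assumes "finite A" "\<forall>j. 1 \<le> j \<and> j \<le> k \<longrightarrow> esym A f j > 0" "k \<le> card A"
    and R: "R > 0" "emean A f k = R ^ k" and "j \<le> k"
  shows "R ^ j \<le> emean A f j"
  using \<open>j \<le> k\<close>
proof (induction rule: inc_induct)
  case base
  then show ?case using R by simp
next
  case (step j)
  show ?case
  proof (cases "j = 0")
    case True then show ?thesis using assms by simp
  next
    case False
    have p: "emean A f j > 0" using False step assms by (simp add: emean_pos_iff)
    have "(R ^ j) ^ Suc j = (R ^ Suc j) ^ j" unfolding power_mult[symmetric] mult.commute[of j] ..
    also have "\<dots> \<le> emean A f (Suc j) ^ j" using step R by (intro power_mono) auto
    also have "\<dots> \<le> emean A f j ^ Suc j"
      using step assms by (intro emean_Maclaurin_step) auto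
    finally have "(R ^ j) ^ Suc j \<le> emean A f j ^ Suc j" .
    then show ?thesis using less_imp_le[OF p] by (rule power_le_imp_le_base)
  qed
qed

text \<open>Deleting a variable lowers the order of the cone by one; this makes the eigenvalues of
  the Newton tensor positive. If the next symmetric function of the remaining variables were
  nonpositive, the two cone conditions would force first \<open>f a > 0\<close>, then a positive
  second next one, and together \<open>E_{k+1}^2 < E_k E_{k+2}\<close>, against Newton's
  inequality.\<close>

lemma Garding_cone_remove:
  assumes "finite A" "a \<in> A" "\<forall>j. 1 \<le> j \<and> j \<le> Suc k \<longrightarrow> esym A f j > 0" "Suc k \<le> card A"
  shows "esym (A - {a}) f k > 0"
  using assms(3,4)
proof (induction k)
  case 0
  then show ?case using assms by simp
next
  case (Suc k)
  define E where "E = esym (A - {a}) f"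
  have A: "A = insert a (A - {a})" using assms by auto
  have rec: "esym A f (Suc j) = E (Suc j) + f a * E j" for j
    using esym_insert[of "A - {a}" a f j] A assms(1) by (simp add: E_def)
  have IH: "E k > 0" using Suc by (auto simp: E_def)
  have cA: "card (A - {a}) = card A - 1" using assms by simp
  have s: "E (Suc k) + f a * E k > 0" "E (Suc (Suc k)) + f a * E (Suc k) > 0"
    using Suc.prems(1) rec by (metis Suc_leD le_refl le_add1 plus_1_eq_Suc)+
  show ?case
  proof (rule ccontr)
    assume "\<not> ?thesis"
    then have neg: "E (Suc k) \<le> 0" by (simp add: E_def)
    then have "f a * E k > 0" using s by linarith
    then have fa: "f a > 0" using IH by (simp add: zero_less_mult_iff)
    then have e2: "E (Suc (Suc k)) > 0" using s(2) neg
      by (smt (verit) mult_nonneg_nonpos)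
    have kc: "k + 1 \<le> card (A - {a})" using Suc.prems cA by simp
    have N: "(real k + 2) * (real (card (A - {a})) - real k) * E k * E (Suc (Suc k))
       \<le> (real k + 1) * (real (card (A - {a})) - real k - 1) * (E (Suc k))\<^sup>2"
      using esym_Newton[OF _ kc, of f] assms by (simp add: E_def)
    define d where "d = real (card (A - {a})) - real k"
    have d: "d \<ge> 1" using kc by (simp add: d_def)
    have "(E (Suc k))\<^sup>2 \<le> (f a * E k) * (- E (Suc k))"
      using mult_right_mono[of "- E (Suc k)" "f a * E k" "- E (Suc k)"] s(1) neg
      by (simp add: power2_eq_square)
    also have "\<dots> = E k * (- (f a * E (Suc k)))" by simp
    also have "\<dots> < E k * E (Suc (Suc k))" using s(2) IH by (intro mult_strict_left_mono) auto
    finally have lt: "(E (Suc k))\<^sup>2 < E k * E (Suc (Suc k))" .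
    have "(real k + 1) * (d - 1) * (E (Suc k))\<^sup>2 \<le> ((real k + 2) * d) * (E (Suc k))\<^sup>2"
      using d by (intro mult_right_mono mult_mono) auto
    also have "\<dots> < ((real k + 2) * d) * (E k * E (Suc (Suc k)))"
      using d lt by (intro mult_strict_left_mono) auto
    finally show False using N unfolding d_def by (simp add: mult.assoc)
  qed
qed

lemma esym_1: "finite A \<Longrightarrow> esym A f 1 = sum f A"
proof (induction A rule: finite_induct)
  case (insert a A)
  then show ?case using esym_insert[of A a f 0] by simp
qed (simp add: esym_eq_0)

lemma sum_squares_esym: "finite A \<Longrightarrow> (\<Sum>i\<in>A. (f i)\<^sup>2) = (esym A f 1)\<^sup>2 - 2 * esym A f 2"
proof (induction A rule: finite_induct)
  case (insert a A)
  then show ?case using esym_insert[of A a f 0] esym_insert[of A a f 1]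
    by (simp add: numeral_2_eq_2 power2_eq_square algebra_simps)
qed (simp add: esym_eq_0)

text \<open>Equality in the first Newton inequality means that the values have variance
  zero.\<close>

lemma emean_eq_imp_all_equal:
  assumes "finite A" "card A \<ge> 2" "emean A f 2 = (emean A f 1)\<^sup>2" "i \<in> A"
  shows "f i = emean A f 1"
proof -
  define m where "m = real (card A)"
  define h where "h = emean A f 1"
  have m: "m \<ge> 2" using assms by (simp add: m_def)
  have e1: "esym A f 1 = m * h" using assms by (simp add: esym_emean m_def h_def)
  have "2 * real (card A choose 2) = m * (m - 1)"
    using choose_Suc_mult[of 1 "card A"] assms by (simp add: m_def numeral_2_eq_2)
  then have e2: "2 * esym A f 2 = m * (m - 1) * h\<^sup>2" using assms by (simp add: esym_emean h_def)
  have "(\<Sum>i\<in>A. (f i - h)\<^sup>2) = (\<Sum>i\<in>A. (f i)\<^sup>2) - 2 * h * esym A f 1 + m * h\<^sup>2"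
    unfolding esym_1[OF assms(1)] sum_distrib_left m_def
    by (simp add: power2_diff sum.distrib sum_subtractf mult_ac)
  also have "\<dots> = 0" unfolding sum_squares_esym[OF assms(1)] e1 e2
    by (simp add: power2_eq_square algebra_simps)
  finally have "(f i - h)\<^sup>2 = 0" using assms by (subst (asm) sum_nonneg_eq_0_iff) auto
  then show ?thesis by (simp add: h_def)
qed

text \<open>Up to the factor \<open>c\<close>, \<open>gap\<close> is \<open>k (h - R) R^k\<close>
  plus \<open>(m - k) (h R^k - emean A f (k + 1))\<close>; Maclaurin handles the first term and
  \<open>emean_Suc_le\<close> the second. If both vanish then \<open>h = R\<close>, and the second
  mean equals \<open>h^2\<close>: for \<open>k = 1\<close> by the second term, for
  \<open>k \<ge> 2\<close> because it lies between \<open>R^2\<close> and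
  \<open>h^2\<close>.\<close>

lemma esym_Garding_gap:
  assumes "finite A" "1 \<le> k" "k \<le> card A" "\<forall>j. 1 \<le> j \<and> j \<le> k \<longrightarrow> esym A f j > 0"
    and R: "R > 0" "emean A f k = R ^ k"
  defines "gap \<equiv> esym A f 1 * esym A f k - (real k + 1) * esym A f (Suc k) - R * real k * esym A f k"
  shows "gap \<ge> 0" and "gap = 0 \<Longrightarrow> i \<in> A \<Longrightarrow> f i = R"
proof -
  define m c where "m = real (card A)" and "c = real (card A choose k)"
  define h where "h = emean A f 1"
  have c: "c > 0" using assms by (simp add: c_def)
  have hR: "h \<ge> R" using emean_Maclaurin[OF assms(1,4,3) R, of 1] assms by (simp add: h_def)
  have e1: "esym A f 1 = m * h" using assms by (simp add: esym_emean m_def h_def)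
  have ek: "esym A f k = c * R ^ k" using assms by (simp add: esym_emean c_def)
  have ek1: "(real k + 1) * esym A f (Suc k) = (m - real k) * c * emean A f (Suc k)"
    using choose_Suc_mult[OF assms(3)] assms(1) by (simp add: esym_emean c_def m_def)
  have gap: "gap = c * (real k * (h - R) * R ^ k + (m - real k) * (h * R ^ k - emean A f (Suc k)))"
    unfolding gap_def e1 ek ek1 by (simp add: algebra_simps)
  have t1: "real k * (h - R) * R ^ k \<ge> 0" using hR R by auto
  have t2: "(m - real k) * (h * R ^ k - emean A f (Suc k)) \<ge> 0"
  proof (cases "k = card A")
    case False
    then have "emean A f (Suc k) \<le> h * R ^ k"
      using emean_Suc_le[OF assms(1,4)] assms(3) R by (simp add: h_def)
    then show ?thesis using assms(3) by (simp add: m_def)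
  qed (simp add: m_def)
  show "gap \<ge> 0" unfolding gap using t1 t2 c by simp
  assume g0: "gap = 0" and i: "i \<in> A"
  have z1: "real k * (h - R) * R ^ k = 0" and z2: "(m - real k) * (h * R ^ k - emean A f (Suc k)) = 0"
    using g0 t1 t2 c unfolding gap by (simp_all add: add_nonneg_eq_0_iff)
  have hR': "h = R" using z1 R assms(2) by simp
  show "f i = R"
  proof (cases "card A = 1")
    case True
    then obtain b where "A = {b}" by (auto simp: card_1_singleton_iff)
    then show ?thesis using e1 hR' i by (simp add: esym_1[unfolded One_nat_def] m_def)
  next
    case False
    then have c2: "card A \<ge> 2" using assms by linarith
    have "emean A f 2 = h\<^sup>2"
    proof (cases "k = 1")
      case True
      then show ?thesis using z2 R hR' c2 by (simp add: m_def numeral_2_eq_2)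
    next
      case False
      then have "R ^ 2 \<le> emean A f 2" using assms(2) by (intro emean_Maclaurin[OF assms(1,4,3) R]) auto
      moreover have "emean A f 2 \<le> h\<^sup>2" using emean_Newton[OF assms(1), of 0 f] c2 assms(1) by (simp add: h_def numeral_2_eq_2)
      ultimately show ?thesis using hR' by simp
    qed
    then show ?thesis using emean_eq_imp_all_equal[OF assms(1) c2 _ i, of f] hR' by (simp add: h_def)
  qed
qed

section \<open>Newton tensors\<close>

lemma matrix_diff_ldistrib: "(A::real^'n^'m) ** (B - C) = A ** B - A ** C"
  by (vector matrix_matrix_mult_def sum_subtractf[symmetric] right_diff_distrib)

lemma matrix_diff_rdistrib: "((B::real^'n^'m) - C) ** A = B ** A - C ** A"
  by (vector matrix_matrix_mult_def sum_subtractf[symmetric] left_diff_distrib)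

lemma matrix_add_rdistrib': "((B::real^'n^'m) + C) ** A = B ** A + C ** A"
  by (vector matrix_matrix_mult_def sum.distrib[symmetric] distrib_right)

lemma trace_scaleR: "trace (c *\<^sub>R (A::real^'n^'n)) = c * trace A"
  by (simp add: trace_def sum_distrib_left)

lemma bounded_bilinear_matrix_mult: "bounded_bilinear (\<lambda>(A::real^'n^'m) (B::real^'p^'n). A ** B)"
  by (subst bilinear_conv_bounded_bilinear[symmetric])
     (auto simp: bilinear_def linear_iff matrix_add_ldistrib matrix_add_rdistrib' matrix_scalar_ac
       simp flip: scalar_matrix_assoc)

lemma bounded_linear_trace: "bounded_linear (trace :: real^'n^'n \<Rightarrow> real)"
  by (simp add: linear_conv_bounded_linear[symmetric] linear_iff trace_add trace_scaleR)

text \<open>The Faddeev-LeVerrier recursion: the symmetric functions of the eigenvalues appear as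
  traces, so everything is polynomial in the entries of \<open>A\<close> and can be differentiated
  without reference to eigenvalues.\<close>

primrec newton_tensor :: "nat \<Rightarrow> real^'n^'n \<Rightarrow> real^'n^'n" where
  "newton_tensor 0 A = mat 1"
| "newton_tensor (Suc j) A =
     (trace (newton_tensor j A ** A) / real (Suc j)) *\<^sub>R mat 1 - newton_tensor j A ** A"

definition msigma :: "nat \<Rightarrow> real^'n^'n \<Rightarrow> real" where
  "msigma j A = (case j of 0 \<Rightarrow> 1 | Suc i \<Rightarrow> trace (newton_tensor i A ** A) / real (Suc i))"

lemma msigma_0 [simp]: "msigma 0 A = 1"
  by (simp add: msigma_def)

lemma trace_newton_tensor_mult: "trace (newton_tensor j A ** A) = (real j + 1) * msigma (Suc j) A"
proof -
  have "real (Suc j) = real j + 1" by simp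
  then show ?thesis by (simp only: msigma_def nat.case) simp
qed

lemma newton_tensor_Suc:
  "newton_tensor (Suc j) A = msigma (Suc j) A *\<^sub>R mat 1 - newton_tensor j A ** A"
  by (simp add: msigma_def)

lemma trace_newton_tensor:
  "trace (newton_tensor j (A::real^'n^'n)) = (real CARD('n) - real j) * msigma j A"
  by (cases j) (simp_all add: trace_I newton_tensor_Suc trace_sub trace_scaleR trace_newton_tensor_mult algebra_simps
    del: newton_tensor.simps(2))

lemma newton_tensor_commute: "newton_tensor j A ** A = A ** newton_tensor j A"
proof (induction j)
  case (Suc j)
  have "newton_tensor j A ** A ** A = A ** (newton_tensor j A ** A)"
    by (metis Suc.IH matrix_mul_assoc)
  then show ?case
    by (simp add: matrix_diff_ldistrib matrix_diff_rdistrib matrix_scalar_ac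
      scalar_matrix_assoc[symmetric] del: of_nat_Suc)
qed simp

section \<open>Newton's identities and the derivative of the symmetric functions\<close>

primrec matrix_pow :: "nat \<Rightarrow> real^'n^'n \<Rightarrow> real^'n^'n" where
  "matrix_pow 0 A = mat 1"
| "matrix_pow (Suc m) A = A ** matrix_pow m A"

lemma matrix_pow_add: "matrix_pow (i + j) A = matrix_pow i A ** matrix_pow j A"
  by (induction i) (auto simp: matrix_mul_assoc)

lemma matrix_pow_Suc': "matrix_pow (Suc m) A = matrix_pow m A ** A"
  using matrix_pow_add[of m 1 A] by simp

text \<open>Multiplied by \<open>A\<close> and traced, this expansion becomes Newton's identities
  between the \<open>msigma j A\<close> and the power traces, from which the \<open>msigma j\<close>
  are differentiated.\<close>

lemma newton_tensor_sum:
  "newton_tensor j A = (\<Sum>i\<le>j. ((-1) ^ i * msigma (j - i) A) *\<^sub>R matrix_pow i A)"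
proof (induction j)
  case (Suc j)
  have "(\<Sum>i\<le>Suc j. ((-1) ^ i * msigma (Suc j - i) A) *\<^sub>R matrix_pow i A) =
     msigma (Suc j) A *\<^sub>R mat 1 + (\<Sum>i\<le>j. ((-1) ^ Suc i * msigma (j - i) A) *\<^sub>R matrix_pow (Suc i) A)"
    by (subst sum.atMost_Suc_shift) simp
  also have "(\<Sum>i\<le>j. ((-1) ^ Suc i * msigma (j - i) A) *\<^sub>R matrix_pow (Suc i) A) =
     - ((\<Sum>i\<le>j. ((-1) ^ i * msigma (j - i) A) *\<^sub>R matrix_pow i A) ** A)"
    unfolding bounded_bilinear.sum_left[OF bounded_bilinear_matrix_mult] sum_negf[symmetric]
    by (intro sum.cong refl) (simp add: matrix_pow_Suc' scalar_matrix_assoc[symmetric] del: matrix_pow.simps)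
  finally show ?case by (simp add: Suc.IH[symmetric] newton_tensor_Suc del: newton_tensor.simps)
qed simp

lemma sum_triangle_swap:
  fixes g :: "nat \<Rightarrow> nat \<Rightarrow> real"
  shows "(\<Sum>i<j. \<Sum>l<j - i. g i l) = (\<Sum>l<j. \<Sum>i<j - l. g i l)"
  unfolding sum.Sigma[OF finite_lessThan ballI[OF finite_lessThan]]
  by (rule sum.reindex_bij_witness[of _ "\<lambda>(a, b). (b, a)" "\<lambda>(a, b). (b, a)"]) auto

text \<open>Differentiating Newton's identities \<open>(j + 1) s\<^sub>j\<^sub>+\<^sub>1 = \<Sum> (-1)\<^sup>i s\<^sub>j\<^sub>-\<^sub>i p\<^sub>i\<^sub>+\<^sub>1\<close> along a derivation
  with \<open>dp\<^sub>i\<^sub>+\<^sub>1 = (i + 1) q\<^sub>i\<close>.\<close>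

lemma Newton_identities_derivation:
  fixes s p q ds :: "nat \<Rightarrow> real"
  assumes s: "\<And>j. (real j + 1) * s (Suc j) = (\<Sum>i\<le>j. (-1) ^ i * s (j - i) * p (Suc i))"
    and ds0: "ds 0 = 0"
    and ds: "\<And>j. (real j + 1) * ds (Suc j) =
      (\<Sum>i\<le>j. (-1) ^ i * (ds (j - i) * p (Suc i) + s (j - i) * ((real i + 1) * q i)))"
  shows "ds (Suc j) = (\<Sum>i\<le>j. (-1) ^ i * s (j - i) * q i)"
proof (induction j rule: less_induct)
  case (less j)
  have ds': "ds (j - i) = (\<Sum>l<j - i. (-1) ^ l * s (j - i - 1 - l) * q l)" if "i < j" for i
  proof -
    have e: "j - i = Suc (j - i - 1)" using that by simp
    have "ds (Suc (j - i - 1)) = (\<Sum>l\<le>j - i - 1. (-1) ^ l * s (j - i - 1 - l) * q l)"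
      using that by (intro less) auto
    then show ?thesis using e by (metis lessThan_Suc_atMost)
  qed
  have s': "(real (j - l)) * s (j - l) = (\<Sum>i<j - l. (-1) ^ i * s (j - l - 1 - i) * p (Suc i))" if "l < j" for l
  proof -
    have e: "j - l = Suc (j - l - 1)" using that by simp
    have "(real (j - l - 1) + 1) * s (Suc (j - l - 1)) = (\<Sum>i\<le>j - l - 1. (-1) ^ i * s (j - l - 1 - i) * p (Suc i))"
      by (rule s)
    then show ?thesis using e by (metis lessThan_Suc_atMost of_nat_Suc add.commute)
  qed
  have "(\<Sum>i\<le>j. (-1) ^ i * (ds (j - i) * p (Suc i))) = (\<Sum>i<j. (-1) ^ i * (ds (j - i) * p (Suc i)))"
    by (simp add: ds0 lessThan_Suc_atMost[symmetric])
  also have "\<dots> = (\<Sum>i<j. \<Sum>l<j - i. (-1) ^ i * ((-1) ^ l * s (j - i - 1 - l) * q l * p (Suc i)))"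
    by (intro sum.cong refl) (simp add: ds' sum_distrib_left sum_distrib_right)
  \<comment> \<open>After the swap the inner sum is Newton's identity of order \<open>j - l\<close>
    and contributes the factor \<open>j - l\<close>. Added to the factor \<open>l + 1\<close> of the
    remaining term this gives \<open>j + 1\<close> for every \<open>l\<close>.\<close>
  also have "\<dots> = (\<Sum>l<j. \<Sum>i<j - l. (-1) ^ i * ((-1) ^ l * s (j - i - 1 - l) * q l * p (Suc i)))"
    by (rule sum_triangle_swap)
  also have "\<dots> = (\<Sum>l<j. (-1) ^ l * q l * (real (j - l) * s (j - l)))"
  proof (rule sum.cong[OF refl])
    fix l assume "l \<in> {..<j}"
    then have "l < j" by simp
    show "(\<Sum>i<j - l. (-1) ^ i * ((-1) ^ l * s (j - i - 1 - l) * q l * p (Suc i))) =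
        (-1) ^ l * q l * (real (j - l) * s (j - l))"
      unfolding s'[OF \<open>l < j\<close>] sum_distrib_left
      by (intro sum.cong refl) (simp add: mult_ac diff_commute add.commute)
  qed
  also have "\<dots> = (\<Sum>l\<le>j. (-1) ^ l * q l * (real (j - l) * s (j - l)))"
    by (simp add: lessThan_Suc_atMost[symmetric])
  finally have "(real j + 1) * ds (Suc j) =
      (\<Sum>l\<le>j. (-1) ^ l * q l * (real (j - l) * s (j - l))) + (\<Sum>i\<le>j. (-1) ^ i * (s (j - i) * ((real i + 1) * q i)))"
    unfolding ds by (simp add: distrib_left sum.distrib)
  also have "\<dots> = (real j + 1) * (\<Sum>i\<le>j. (-1) ^ i * s (j - i) * q i)"
    unfolding sum.distrib[symmetric] sum_distrib_left
    by (intro sum.cong refl) (simp add: of_nat_diff algebra_simps)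
  finally show ?case by simp
qed

lemma has_derivative_matrix_mult:
  assumes "(f has_derivative f') (at y)" "(g has_derivative g') (at y)"
  shows "((\<lambda>x. (f x :: real^'n^'m) ** (g x :: real^'p^'n)) has_derivative (\<lambda>v. f y ** g' v + f' v ** g y)) (at y)"
  using bounded_bilinear.FDERIV[OF bounded_bilinear_matrix_mult assms] .

lemma has_derivative_trace:
  assumes "(f has_derivative f') (at y)"
  shows "((\<lambda>x. trace (f x :: real^'n^'n)) has_derivative (\<lambda>v. trace (f' v))) (at y)"
  using bounded_linear.has_derivative[OF bounded_linear_trace assms] .

text \<open>\<open>A\<close> and \<open>A' v\<close> need not commute, so \<open>D v\<close> has no
  closed form with one term; traced against a power of \<open>A\<close>, its \<open>m\<close> terms
  coincide by cyclicity. For \<open>m = 0\<close> the truncated exponent \<open>r + m - 1\<close> is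
  harmless because of the factor \<open>m\<close>.\<close>

lemma has_derivative_matrix_pow:
  fixes A :: "'a::real_normed_vector \<Rightarrow> real^'n^'n"
  assumes "(A has_derivative A') (at y)"
  shows "\<exists>D. ((\<lambda>x. matrix_pow m (A x)) has_derivative D) (at y) \<and>
    (\<forall>v r. trace (matrix_pow r (A y) ** D v) = real m * trace (matrix_pow (r + m - 1) (A y) ** A' v))"
proof (induction m)
  case 0
  have "trace (0::real^'n^'n) = 0" by (simp add: trace_def)
  then show ?case by (intro exI[of _ "\<lambda>_. 0"]) auto
next
  case (Suc m)
  then obtain D where D: "((\<lambda>x. matrix_pow m (A x)) has_derivative D) (at y)"
    and tr: "\<And>v r. trace (matrix_pow r (A y) ** D v) = real m * trace (matrix_pow (r + m - 1) (A y) ** A' v)"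
    by blast
  have "trace (matrix_pow r (A y) ** (A y ** D v + A' v ** matrix_pow m (A y))) =
      real (Suc m) * trace (matrix_pow (r + Suc m - 1) (A y) ** A' v)" for v r
  proof -
    have "trace (matrix_pow r (A y) ** (A' v ** matrix_pow m (A y))) = trace (matrix_pow (m + r) (A y) ** A' v)"
      unfolding matrix_pow_add by (metis matrix_mul_assoc trace_mul_sym)
    moreover have "matrix_pow r (A y) ** (A y ** D v) = matrix_pow (Suc r) (A y) ** D v"
      unfolding matrix_pow_Suc' by (simp add: matrix_mul_assoc)
    moreover have "Suc r + m - 1 = m + r" by simp
    ultimately show ?thesis
      by (simp add: matrix_add_ldistrib trace_add tr algebra_simps del: matrix_pow.simps)
  qed
  then show ?case using has_derivative_matrix_mult[OF assms D] by auto
qed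

text \<open>The Newton tensor is the gradient of the next symmetric function. Newton's identities
  prove this for every matrix, without diagonalization, since the trace of \<open>A^{i+1}\<close>
  has derivative \<open>i + 1\<close> times the trace of \<open>A^i A'\<close>.\<close>

lemma has_derivative_sigma_newton_tensor:
  fixes A :: "'a::real_normed_vector \<Rightarrow> real^'n^'n"
  assumes A: "(A has_derivative A') (at y)"
  shows "((\<lambda>x. msigma (Suc j) (A x)) has_derivative (\<lambda>v. trace (newton_tensor j (A y) ** A' v))) (at y)"
    and "(\<lambda>x. newton_tensor j (A x)) differentiable (at y)"
proof -
  have diff: "(\<lambda>x. newton_tensor j (A x)) differentiable (at y)" for j
  proof (induction j)
    case (Suc j)
    then obtain T' where "((\<lambda>x. newton_tensor j (A x)) has_derivative T') (at y)"
      by (auto simp: differentiable_def)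
    note d = has_derivative_matrix_mult[OF this A]
    show ?case unfolding newton_tensor.simps
      by (rule differentiableI)
        (rule has_derivative_diff[OF has_derivative_scaleR_left[OF has_derivative_divide'[OF has_derivative_trace[OF d] has_derivative_const]] d], simp)
  qed simp
  then show "(\<lambda>x. newton_tensor j (A x)) differentiable (at y)" .
  have "(\<lambda>x. msigma j (A x)) differentiable (at y)" for j
  proof (cases j)
    case (Suc i)
    obtain T' where "((\<lambda>x. newton_tensor i (A x)) has_derivative T') (at y)"
      using diff by (auto simp: differentiable_def)
    note d = has_derivative_matrix_mult[OF this A]
    show ?thesis unfolding Suc msigma_def nat.case
      by (rule differentiableI) (rule has_derivative_divide'[OF has_derivative_trace[OF d] has_derivative_const], simp)
  qed simp
  then obtain S where S: "\<And>j. ((\<lambda>x. msigma j (A x)) has_derivative S j) (at y)"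
    unfolding differentiable_def by metis
  obtain D where D: "\<And>m. ((\<lambda>x. matrix_pow m (A x)) has_derivative D m) (at y)"
    and trD: "\<And>m v r. trace (matrix_pow r (A y) ** D m v) = real m * trace (matrix_pow (r + m - 1) (A y) ** A' v)"
    using has_derivative_matrix_pow[OF A] by metis
  have rec: "(real j + 1) * msigma (Suc j) (A x) = (\<Sum>i\<le>j. (-1) ^ i * msigma (j - i) (A x) * trace (matrix_pow (Suc i) (A x)))" for j x
    unfolding trace_newton_tensor_mult[symmetric] newton_tensor_sum
      bounded_bilinear.sum_left[OF bounded_bilinear_matrix_mult] linear_sum[OF bounded_linear.linear[OF bounded_linear_trace]]
    by (intro sum.cong refl)
      (simp add: matrix_pow_Suc' trace_scaleR scalar_matrix_assoc[symmetric] del: matrix_pow.simps)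
  have main: "S (Suc j) v = trace (newton_tensor j (A y) ** A' v)" for v j
  proof -
    have "S (Suc j) v = (\<Sum>i\<le>j. (-1) ^ i * msigma (j - i) (A y) * trace (matrix_pow i (A y) ** A' v))"
    proof (rule Newton_identities_derivation[where p = "\<lambda>i. trace (matrix_pow i (A y))" and ds = "\<lambda>j. S j v"])
      fix j
      show "(real j + 1) * msigma (Suc j) (A y) = (\<Sum>i\<le>j. (-1) ^ i * msigma (j - i) (A y) * trace (matrix_pow (Suc i) (A y)))"
        by (rule rec)
      have "((\<lambda>x. 1) has_derivative S 0) (at y)" using S[of 0] by simp
      then show "S 0 v = 0" using has_derivative_unique[OF _ has_derivative_const] by metis
      have "((\<lambda>x. (real j + 1) * msigma (Suc j) (A x)) has_derivative (\<lambda>v. (real j + 1) * S (Suc j) v)) (at y)"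
        by (intro has_derivative_mult_right S)
      moreover have "((\<lambda>x. \<Sum>i\<le>j. (-1) ^ i * (msigma (j - i) (A x) * trace (matrix_pow (Suc i) (A x)))) has_derivative
          (\<lambda>v. \<Sum>i\<le>j. (-1) ^ i * (msigma (j - i) (A y) * trace (D (Suc i) v) + S (j - i) v * trace (matrix_pow (Suc i) (A y))))) (at y)"
        by (intro has_derivative_sum has_derivative_mult_right has_derivative_mult S has_derivative_trace D)
      ultimately have "(\<lambda>v. (real j + 1) * S (Suc j) v) =
          (\<lambda>v. \<Sum>i\<le>j. (-1) ^ i * (msigma (j - i) (A y) * trace (D (Suc i) v) + S (j - i) v * trace (matrix_pow (Suc i) (A y))))"
        unfolding rec by (intro has_derivative_unique) (auto simp: mult.assoc)
      then have "(real j + 1) * S (Suc j) v =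
          (\<Sum>i\<le>j. (-1) ^ i * (msigma (j - i) (A y) * trace (D (Suc i) v) + S (j - i) v * trace (matrix_pow (Suc i) (A y))))"
        by metis
      moreover have "trace (D (Suc i) v) = (real i + 1) * trace (matrix_pow i (A y) ** A' v)" for i
        using trD[of 0 "Suc i" v] by simp
      ultimately show "(real j + 1) * S (Suc j) v =
          (\<Sum>i\<le>j. (-1) ^ i * (S (j - i) v * trace (matrix_pow (Suc i) (A y)) + msigma (j - i) (A y) * ((real i + 1) * trace (matrix_pow i (A y) ** A' v))))"
        by (simp add: add.commute)
    qed
    then show ?thesis
      unfolding newton_tensor_sum bounded_bilinear.sum_left[OF bounded_bilinear_matrix_mult] linear_sum[OF bounded_linear.linear[OF bounded_linear_trace]]
      by (simp add: trace_scaleR scalar_matrix_assoc[symmetric])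
  qed
  then have "S (Suc j) = (\<lambda>v. trace (newton_tensor j (A y) ** A' v))" by blast
  then show "((\<lambda>x. msigma (Suc j) (A x)) has_derivative (\<lambda>v. trace (newton_tensor j (A y) ** A' v))) (at y)"
    using S by metis
qed

section \<open>Diagonalizable matrices and the spectral theorem\<close>

definition diag :: "real^'n \<Rightarrow> real^'n^'n" where
  "diag l = (\<chi> i j. if i = j then l $ i else 0)"

lemma matrix_mult_diag: "((A::real^'n^'m) ** diag l) $ i $ j = A $ i $ j * l $ j"
  by (simp add: matrix_matrix_mult_def diag_def if_distrib cong: if_cong)

text \<open>Double counting: each set of \<open>j + 1\<close> indices arises once from each of its
  elements.\<close>

lemma sum_esym_remove:
  assumes "finite A"
  shows "(\<Sum>i\<in>A. f i * esym (A - {i}) f j) = (real j + 1) * esym A f (Suc j)"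
proof -
  have "(\<Sum>i\<in>A. f i * esym (A - {i}) f j) = (\<Sum>i\<in>A. \<Sum>S | S \<subseteq> A \<and> card S = Suc j \<and> i \<in> S. prod f S)"
  proof (intro sum.cong refl)
    fix i assume i: "i \<in> A"
    have "f i * esym (A - {i}) f j = (\<Sum>T | T \<subseteq> A - {i} \<and> card T = j. f i * prod f T)"
      by (simp add: esym_def sum_distrib_left)
    also have "\<dots> = (\<Sum>S | S \<subseteq> A \<and> card S = Suc j \<and> i \<in> S. prod f S)"
    proof (rule sum.reindex_bij_witness[of _ "\<lambda>S. S - {i}" "insert i"])
      fix T assume T: "T \<in> {T. T \<subseteq> A - {i} \<and> card T = j}"
      then have "finite T" "i \<notin> T" using assms by (auto intro: finite_subset)
      then show "insert i T \<in> {S. S \<subseteq> A \<and> card S = Suc j \<and> i \<in> S}" "insert i T - {i} = T"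
        "prod f (insert i T) = f i * prod f T"
        using T i by (auto simp: card_insert_if)
    qed auto
    finally show "f i * esym (A - {i}) f j = (\<Sum>S | S \<subseteq> A \<and> card S = Suc j \<and> i \<in> S. prod f S)" .
  qed
  also have "\<dots> = (\<Sum>S | S \<subseteq> A \<and> card S = Suc j. \<Sum>i | i \<in> A \<and> i \<in> S. prod f S)"
    using assms by (subst sum.swap_restrict[symmetric]) (auto intro!: sum.cong)
  also have "\<dots> = (\<Sum>S | S \<subseteq> A \<and> card S = Suc j. (real j + 1) * prod f S)"
  proof (intro sum.cong refl)
    fix S assume S: "S \<in> {S. S \<subseteq> A \<and> card S = Suc j}"
    then have "{i. i \<in> A \<and> i \<in> S} = S" by auto
    then show "(\<Sum>i | i \<in> A \<and> i \<in> S. prod f S) = (real j + 1) * prod f S" using S by simp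
  qed
  finally show ?thesis by (simp add: esym_def sum_distrib_left)
qed

lemma newton_tensor_diag: "newton_tensor j (diag l) = diag (\<chi> i. esym (UNIV - {i}) (($) l) j)"
  and msigma_diag_Suc: "msigma (Suc j) (diag l) = esym UNIV (($) l) (Suc j)"
proof -
  have tr: "trace (newton_tensor j (diag l) ** diag l) = (real j + 1) * esym UNIV (($) l) (Suc j)"
    if "newton_tensor j (diag l) = diag (\<chi> i. esym (UNIV - {i}) (($) l) j)" for j
    unfolding that sum_esym_remove[OF finite, symmetric]
    by (simp add: trace_def matrix_mult_diag) (simp add: diag_def mult.commute)
  have *: "newton_tensor j (diag l) = diag (\<chi> i. esym (UNIV - {i}) (($) l) j)" for j
  proof (induction j)
    case 0
    show ?case by (simp add: diag_def mat_def vec_eq_iff)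
  next
    case (Suc j)
    have rec: "esym (UNIV - {i}) (($) l) (Suc j) = esym UNIV (($) l) (Suc j) - l $ i * esym (UNIV - {i}) (($) l) j" for i
      using esym_insert[of "UNIV - {i}" i "($) l" j] by (simp add: insert_UNIV)
    have "newton_tensor (Suc j) (diag l) = esym UNIV (($) l) (Suc j) *\<^sub>R mat 1 - newton_tensor j (diag l) ** diag l"
      unfolding newton_tensor_Suc using tr[OF Suc] trace_newton_tensor_mult[of j "diag l"] by simp
    also have "\<dots> = diag (\<chi> i. esym (UNIV - {i}) (($) l) (Suc j))"
      unfolding Suc.IH by (auto simp: vec_eq_iff matrix_mult_diag) (auto simp: diag_def mat_def rec mult.commute)
    finally show ?case .
  qed
  show "newton_tensor j (diag l) = diag (\<chi> i. esym (UNIV - {i}) (($) l) j)" by (rule *)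
  show "msigma (Suc j) (diag l) = esym UNIV (($) l) (Suc j)"
    using tr[OF *] trace_newton_tensor_mult[of j "diag l"] by simp
qed

lemma msigma_diag: "msigma j (diag l) = esym UNIV (($) l) j"
  by (cases j) (auto simp: msigma_diag_Suc)

lemma trace_similar:
  fixes K :: "real^'n^'n"
  assumes "invertible K" "A ** K = K ** B" shows "trace A = trace B"
proof -
  obtain L where L: "K ** L = mat 1" "L ** K = mat 1" using assms(1) by (auto simp: invertible_def)
  have "trace B = trace (L ** (K ** B))" by (simp add: matrix_mul_assoc L)
  also have "\<dots> = trace (A ** K ** L)" unfolding assms(2)[symmetric] by (subst trace_mul_sym) (simp add: matrix_mul_assoc)
  also have "\<dots> = trace A" by (simp add: matrix_mul_assoc[symmetric] L)
  finally show ?thesis by simp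
qed

lemma newton_tensor_similar:
  fixes K :: "real^'n^'n"
  assumes "invertible K" "A ** K = K ** B"
  shows "newton_tensor j A ** K = K ** newton_tensor j B" and "msigma j A = msigma j B"
proof -
  have tr: "trace (newton_tensor j A ** A) = trace (newton_tensor j B ** B)"
    if "newton_tensor j A ** K = K ** newton_tensor j B" for j
    using that assms by (intro trace_similar[OF assms(1)]) (metis matrix_mul_assoc)
  have *: "newton_tensor j A ** K = K ** newton_tensor j B" for j
  proof (induction j)
    case (Suc j)
    have "newton_tensor j A ** A ** K = K ** (newton_tensor j B ** B)"
      using Suc assms(2) by (metis matrix_mul_assoc)
    then show ?case using tr[OF Suc]
      by (simp add: matrix_diff_ldistrib matrix_diff_rdistrib matrix_scalar_ac scalar_matrix_assoc[symmetric] del: of_nat_Suc)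
  qed simp
  show "newton_tensor j A ** K = K ** newton_tensor j B" by (rule *)
  show "msigma j A = msigma j B" using tr[OF *] by (cases j) (auto simp: msigma_def)
qed

lemma esym_scale: "esym A (\<lambda>i. c * f i) k = c ^ k * esym A f k"
  unfolding esym_def sum_distrib_left by (intro sum.cong refl) (auto simp: prod.distrib)

lemma msigma_diagonalized:
  fixes K :: "real^'n^'n"
  assumes "invertible K" "A ** K = K ** diag l"
  shows "msigma j A = esym UNIV (($) l) j"
  using newton_tensor_similar(2)[OF assms] msigma_diag by metis

lemma elem_sym_eq_esym: "elem_sym k l = esym UNIV (($) l) k"
  by (simp add: elem_sym_def esym_def)

text \<open>The transpose and the scalar \<open>c\<close> are there because
  \<open>shape_operator\<close> will turn out to be the transposed Jacobian up to the sign of the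
  normal.\<close>

lemma eigenvalue_list_diagonalized:
  fixes K :: "real^'n^'n"
  assumes "invertible K" "A ** K = K ** diag l"
  shows "eigenvalue_list (c *\<^sub>R transpose A) (c *\<^sub>R l)"
  unfolding eigenvalue_list_def
proof
  fix t
  have K: "det K \<noteq> 0" using assms(1) by (simp add: invertible_det_nz)
  have "det (mat t - c *\<^sub>R transpose A) = det (transpose (mat t - c *\<^sub>R A))"
    by (rule arg_cong[of _ _ det]) (auto simp: vec_eq_iff transpose_def mat_def)
  also have "\<dots> = det (mat t - c *\<^sub>R A)" by (rule det_transpose)
  also have "\<dots> = det (mat t - c *\<^sub>R diag l)"
  proof -
    have m: "mat t = t *\<^sub>R (mat 1 :: real^'n^'n)" by (simp add: vec_eq_iff mat_def)
    have "(mat t - c *\<^sub>R A) ** K = K ** (mat t - c *\<^sub>R diag l)"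
      unfolding m using assms(2)
      by (simp add: matrix_diff_ldistrib matrix_diff_rdistrib matrix_scalar_ac scalar_matrix_assoc[symmetric])
    then have "det (mat t - c *\<^sub>R A) * det K = det K * det (mat t - c *\<^sub>R diag l)"
      by (metis det_mul)
    then show ?thesis using K by simp
  qed
  also have "\<dots> = (\<Prod>i\<in>UNIV. (mat t - c *\<^sub>R diag l) $ i $ i)"
    by (rule det_diagonal) (simp add: mat_def diag_def)
  finally show "det (mat t - c *\<^sub>R transpose A) = (\<Prod>i\<in>UNIV. t - (c *\<^sub>R l) $ i)"
    by (simp add: mat_def diag_def)
qed

text \<open>\<open>principal_curvatures\<close> is an arbitrary choice among the eigenvalue lists.
  The substitution \<open>t = - 1 / s\<close> turns the characteristic polynomial into the
  generating polynomial of the symmetric functions, so these do not depend on the choice.\<close>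

lemma eigenvalue_list_esym_unique:
  fixes l m :: "real^'n"
  assumes "eigenvalue_list A l" "eigenvalue_list A m"
  shows "esym UNIV (($) l) k = esym UNIV (($) m) k"
proof -
  have eq: "(\<Prod>i\<in>UNIV. t - l $ i) = (\<Prod>i\<in>UNIV. t - m $ i)" for t
    using assms by (auto simp: eigenvalue_list_def)
  have "poly (\<Prod>i\<in>UNIV. [:1, l $ i:]) s = poly (\<Prod>i\<in>UNIV. [:1, m $ i:]) s" for s
  proof (cases "s = 0")
    case False
    have "(\<Prod>i\<in>UNIV. 1 + s * l $ i) = (- s) ^ CARD('n) * (\<Prod>i\<in>UNIV. - 1 / s - l $ i)" for l :: "real^'n"
    proof -
      have "(\<Prod>i\<in>UNIV. 1 + s * l $ i) = (\<Prod>i\<in>UNIV. (- s) * (- 1 / s - l $ i))"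
        using False by (intro prod.cong refl) (simp add: field_simps)
      then show ?thesis by (simp only: prod.distrib prod_constant)
    qed
    then show ?thesis using eq[of "- 1 / s"] by (simp add: poly_prod)
  qed (simp add: poly_prod)
  then have "(\<Prod>i\<in>UNIV. [:1, l $ i:]) = (\<Prod>i\<in>UNIV. [:1, m $ i:])"
    by (simp add: poly_eq_poly_eq_iff[symmetric] ext)
  then show ?thesis by (metis coeff_prod_linear finite)
qed

text \<open>A maximizer of the quadratic form on the unit sphere of the invariant subspace is an
  eigenvector, and its orthogonal complement in the subspace is again invariant.\<close>

lemma self_adjoint_eigenbasis:
  fixes f :: "'a::euclidean_space \<Rightarrow> 'a"
  assumes lin: "linear f" and sym: "\<And>x y. f x \<bullet> y = x \<bullet> f y"
  shows "subspace S \<Longrightarrow> f ` S \<subseteq> S \<Longrightarrow>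
    \<exists>B. B \<subseteq> S \<and> pairwise orthogonal B \<and> (\<forall>b\<in>B. norm b = 1 \<and> (\<exists>c. f b = c *\<^sub>R b)) \<and> span B = S"
proof (induction "dim S" arbitrary: S rule: less_induct)
  case less
  show ?case
  proof (cases "S \<subseteq> {0}")
    case True
    then have "S = {0}" using less.prems(1) subspace_0 by blast
    then show ?thesis by (intro exI[of _ "{}"]) auto
  next
    case False
    then obtain x0 where x0: "x0 \<in> S" "x0 \<noteq> 0" by auto
    let ?C = "S \<inter> sphere 0 1"
    have comp: "compact ?C"
      using closed_Int_compact[OF closed_subspace[OF less.prems(1)] compact_sphere] .
    have ne: "?C \<noteq> {}"
    proof -
      have "(1 / norm x0) *\<^sub>R x0 \<in> ?C" using x0 less.prems(1) by (auto simp: subspace_scale)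
      then show ?thesis by blast
    qed
    have cont: "continuous_on ?C (\<lambda>x. x \<bullet> f x)"
      by (intro continuous_intros linear_continuous_on linear_conv_bounded_linear[THEN iffD1] lin)
    obtain v where v: "v \<in> S" "norm v = 1" and max: "\<And>x. x \<in> S \<Longrightarrow> norm x = 1 \<Longrightarrow> x \<bullet> f x \<le> v \<bullet> f v"
      using continuous_attains_sup[OF comp ne cont] by auto
    define c where "c = v \<bullet> f v"
    have maxc: "x \<bullet> f x \<le> c * (x \<bullet> x)" if "x \<in> S" for x
    proof (cases "x = 0")
      case False
      have "((1 / norm x) *\<^sub>R x) \<bullet> f ((1 / norm x) *\<^sub>R x) \<le> c"
        unfolding c_def using that False less.prems(1) by (intro max) (auto simp: subspace_scale)
      then show ?thesis using False
        by (simp add: linear_cmul[OF lin] field_simps dot_square_norm power2_eq_square)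
    qed simp
    have vv: "v \<bullet> v = 1" using v by (simp add: dot_square_norm)
    have orth: "w \<bullet> f v = 0" if w: "w \<in> S" "w \<bullet> v = 0" for w
    proof -
      define b a where "b = w \<bullet> f v" and "a = c * (w \<bullet> w) - w \<bullet> f w"
      \<comment> \<open>The maximality of \<open>v\<close>, tested on \<open>v + t w\<close>: the
        terms of order zero cancel, and a linear term in \<open>t\<close> is bounded by a quadratic
        one.\<close>
      have q: "2 * t * b \<le> t\<^sup>2 * a" for t
      proof -
        have "(v + t *\<^sub>R w) \<bullet> f (v + t *\<^sub>R w) \<le> c * ((v + t *\<^sub>R w) \<bullet> (v + t *\<^sub>R w))"
          using w v less.prems(1) by (intro maxc subspace_add subspace_scale) auto
        moreover have "v \<bullet> f w = b" unfolding b_def using sym by (metis inner_commute)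
        ultimately show ?thesis using vv w(2)
          by (simp add: linear_add[OF lin] linear_cmul[OF lin] inner_add_left inner_add_right inner_commute[of v w]
             b_def a_def power2_eq_square algebra_simps) (simp add: c_def algebra_simps)
      qed
      show ?thesis
      proof (rule ccontr)
        assume "w \<bullet> f v \<noteq> 0"
        then have b: "b\<^sup>2 > 0" by (simp add: b_def)
        \<comment> \<open>With this \<open>s\<close>, the choice \<open>t = s b\<close> is so small
          that the quadratic term cannot compensate the linear one.\<close>
        define s where "s = 1 / (\<bar>a\<bar> + 1)"
        have s: "s > 0" "s * a < 1" by (auto simp: s_def field_simps)
        have "2 * s * b\<^sup>2 \<le> s * b\<^sup>2 * (s * a)" using q[of "s * b"] by (simp add: power2_eq_square algebra_simps)
        moreover have "s * b\<^sup>2 * (s * a) \<le> s * b\<^sup>2 * 1" using s b by (intro mult_left_mono) auto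
        ultimately have "s * b\<^sup>2 \<le> 0" by simp
        then show False using s b by (simp add: mult_le_0_iff)
      qed
    qed
    have fv: "f v = c *\<^sub>R v"
    proof -
      define z where "z = f v - c *\<^sub>R v"
      have "z \<in> S" unfolding z_def using v less.prems by (intro subspace_diff subspace_scale) auto
      moreover have "z \<bullet> v = 0" by (simp add: z_def inner_diff_left vv c_def inner_commute[of "f v" v])
      ultimately have "z \<bullet> f v = 0" by (rule orth)
      then have "z \<bullet> (f v - c *\<^sub>R v) = 0" using \<open>z \<bullet> v = 0\<close> by (simp add: inner_diff_right)
      then have "z \<bullet> z = 0" by (simp only: z_def)
      then show ?thesis by (simp add: z_def)
    qed
    define S' where "S' = {x \<in> S. x \<bullet> v = 0}"
    have sub: "subspace S'" using less.prems(1) unfolding S'_def subspace_def by (auto simp: inner_add_left)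
    have inv: "f ` S' \<subseteq> S'" using less.prems(2) by (auto simp: S'_def sym fv)
    have "v \<notin> S'" using vv by (auto simp: S'_def)
    moreover have "S' \<subseteq> S" by (auto simp: S'_def)
    ultimately have "S' \<subset> S" using v by blast
    then have "dim S' < dim S"
      using sub less.prems(1) by (metis dim_psubset span_eq_iff)
    from less.hyps[OF this sub inv] obtain B where B: "B \<subseteq> S'" "pairwise orthogonal B"
      "\<forall>b\<in>B. norm b = 1 \<and> (\<exists>c. f b = c *\<^sub>R b)" "span B = S'" by blast
    have "span (insert v B) = S"
    proof
      show "span (insert v B) \<subseteq> S" using B(1) v less.prems(1) by (intro span_minimal) (auto simp: S'_def)
      show "S \<subseteq> span (insert v B)"
      proof
        fix x assume x: "x \<in> S"
        have "x - (x \<bullet> v) *\<^sub>R v \<in> S'" using x v less.prems(1) vv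
          by (auto simp: S'_def subspace_diff subspace_scale inner_diff_left)
        then have "x - (x \<bullet> v) *\<^sub>R v \<in> span (insert v B)" using B(4) span_mono[of B "insert v B"] by auto
        moreover have "(x \<bullet> v) *\<^sub>R v \<in> span (insert v B)" by (intro span_scale span_base) auto
        ultimately show "x \<in> span (insert v B)" using span_add by fastforce
      qed
    qed
    moreover have "pairwise orthogonal (insert v B)"
      using B(1,2) by (auto simp: pairwise_insert orthogonal_def S'_def inner_commute)
    ultimately show ?thesis using B v fv by (intro exI[of _ "insert v B"]) (auto simp: S'_def)
  qed
qed

lemma symmetric_matrix_diagonalizable:
  fixes B :: "real^'n^'n"
  assumes "transpose B = B"
  shows "\<exists>Q l. orthogonal_matrix Q \<and> B ** Q = Q ** diag l"
proof -
  have sym: "(B *v x) \<bullet> y = x \<bullet> (B *v y)" for x y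
    by (metis assms dot_lmul_matrix vector_transpose_matrix)
  obtain E where E: "pairwise orthogonal E" "\<forall>b\<in>E. norm b = 1 \<and> (\<exists>c. B *v b = c *\<^sub>R b)" "span E = UNIV"
    using self_adjoint_eigenbasis[OF matrix_vector_mul_linear[of B] sym, of UNIV] by auto
  have "independent E" using E by (intro pairwise_orthogonal_independent) auto
  then have "card E = CARD('n)" "finite E"
    using E(3) dim_eq_card_independent[of E] dim_span[of E] independent_imp_finite by auto
  then obtain e where e: "bij_betw e (UNIV :: 'n set) E" using finite_same_card_bij[of "UNIV :: 'n set" E] by auto
  have inj: "e i \<noteq> e j" if "i \<noteq> j" for i j using e that by (auto simp: bij_betw_def inj_on_def)
  have eE: "e i \<in> E" for i using e by (auto simp: bij_betw_def)
  have "\<forall>i. \<exists>c. B *v e i = c *\<^sub>R e i" using E(2) eE by blast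
  then obtain c where c: "\<And>i. B *v e i = c i *\<^sub>R e i" by (auto dest!: choice)
  define Q where "Q = (\<chi> i j. e j $ i)"
  have col: "column j Q = e j" for j by (simp add: column_def Q_def)
  have dots: "e i \<bullet> e j = (if i = j then 1 else 0)" for i j
    using E(1,2) eE inj by (auto simp: pairwise_def orthogonal_def dot_square_norm)
  have "orthogonal_matrix Q"
    unfolding orthogonal_matrix matrix_mult_transpose_dot_column by (simp add: col dots mat_def vec_eq_iff)
  moreover have "B ** Q = Q ** diag (\<chi> i. c i)"
  proof -
    have "(B ** Q) $ i $ j = (B *v e j) $ i" for i j
      by (simp add: matrix_matrix_mult_def matrix_vector_mult_def Q_def)
    then show ?thesis by (simp add: vec_eq_iff matrix_mult_diag c) (simp add: Q_def mult.commute)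
  qed
  ultimately show ?thesis by blast
qed

text \<open>Conjugation by \<open>S\<close> turns the product into the symmetric matrix
  \<open>S^T h S\<close>. With an orthogonal eigenbasis \<open>Q\<close> of the latter,
  \<open>K = S Q\<close> diagonalizes the product and both of its factors, regarded as quadratic
  forms, at once.\<close>

lemma product_symmetric_diagonalizable:
  fixes S h :: "real^'n^'n"
  assumes S: "invertible S" and h: "transpose h = h"
  shows "\<exists>(K::real^'n^'n) l. invertible K \<and> ((S ** transpose S) ** h) ** K = K ** diag l \<and>
    S ** transpose S = K ** transpose K \<and> transpose K ** h ** K = diag l"
proof -
  define B where "B = transpose S ** h ** S"
  have "transpose B = B" by (simp add: B_def matrix_transpose_mul h matrix_mul_assoc)
  then obtain Q l where Q: "orthogonal_matrix Q" "B ** Q = Q ** diag l"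
    using symmetric_matrix_diagonalizable by blast
  have QQ: "Q ** transpose Q = mat 1" "transpose Q ** Q = mat 1" using Q(1) by (auto simp: orthogonal_matrix_def)
  define K where "K = S ** Q"
  have "invertible Q" using QQ by (auto simp: invertible_def)
  then have 1: "invertible K" unfolding K_def using S by (intro invertible_mult)
  have "((S ** transpose S) ** h) ** K = S ** (B ** Q)" by (simp add: K_def B_def matrix_mul_assoc)
  then have 2: "((S ** transpose S) ** h) ** K = K ** diag l" by (simp add: Q K_def matrix_mul_assoc)
  have "K ** transpose K = S ** (Q ** transpose Q) ** transpose S" by (simp add: K_def matrix_transpose_mul matrix_mul_assoc)
  then have 3: "S ** transpose S = K ** transpose K" by (simp add: QQ)
  have "transpose K ** h ** K = transpose Q ** (B ** Q)" by (simp add: K_def B_def matrix_transpose_mul matrix_mul_assoc)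
  then have 4: "transpose K ** h ** K = diag l" unfolding Q by (simp add: matrix_mul_assoc QQ)
  show ?thesis using 1 2 3 4 by blast
qed

text \<open>The matrix of the form is \<open>K diag(e) K^T\<close>, so its sign is that of the
  eigenvalues \<open>e\<close> of the Newton tensor although the tensor itself is not
  symmetric.\<close>

lemma newton_tensor_quadratic_form:
  fixes K :: "real^'n^'n"
  assumes "invertible K" "A ** K = K ** diag l"
  shows "x \<bullet> ((newton_tensor j A ** (K ** transpose K)) *v x) =
     (\<Sum>i\<in>UNIV. esym (UNIV - {i}) (($) l) j * ((transpose K *v x) $ i)\<^sup>2)"
proof -
  define e where "e = (\<chi> i. esym (UNIV - {i}) (($) l) j)"
  have "newton_tensor j A ** (K ** transpose K) = K ** (diag e ** transpose K)"
    using newton_tensor_similar(1)[OF assms, of j] by (simp add: matrix_mul_assoc newton_tensor_diag e_def)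
  then have "x \<bullet> ((newton_tensor j A ** (K ** transpose K)) *v x) = x \<bullet> (K *v (diag e *v (transpose K *v x)))"
    by (simp only: matrix_vector_mul_assoc)
  also have "\<dots> = (transpose K *v x) \<bullet> (diag e *v (transpose K *v x))"
    by (metis dot_lmul_matrix transpose_matrix_vector)
  also have "\<dots> = (\<Sum>i\<in>UNIV. e $ i * ((transpose K *v x) $ i)\<^sup>2)"
  proof -
    have "(diag e *v y) $ i = e $ i * y $ i" for y i
      by (simp add: matrix_vector_mult_def diag_def if_distrib[of "\<lambda>x. x * _"] cong: if_cong)
    then show ?thesis unfolding inner_vec_def inner_real_def
      by (intro sum.cong refl) (simp only: power2_eq_square mult_ac)
  qed
  finally show ?thesis by (simp add: e_def)
qed

section \<open>Differential calculus in coordinates\<close>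

definition pd :: "'n \<Rightarrow> (real^'n::finite \<Rightarrow> real) \<Rightarrow> real^'n \<Rightarrow> real" where
  "pd i f y = frechet_derivative f (at y) (axis i 1)"

definition C1_on :: "(real^'n::finite) set \<Rightarrow> (real^'n \<Rightarrow> real) \<Rightarrow> bool" where
  "C1_on S f \<longleftrightarrow> (\<forall>y\<in>S. f differentiable (at y)) \<and> (\<forall>i. continuous_on S (pd i f))"

lemma pd_eqI: "(f has_derivative f') (at y) \<Longrightarrow> pd i f y = f' (axis i 1)"
  unfolding pd_def using frechet_derivative_at by metis

lemma has_derivative_pd:
  assumes "f differentiable (at y)"
  shows "(f has_derivative (\<lambda>v. \<Sum>i\<in>UNIV. pd i f y * v $ i)) (at y)"
proof -
  have d: "(f has_derivative frechet_derivative f (at y)) (at y)"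
    using assms frechet_derivative_works by blast
  then have lin: "linear (frechet_derivative f (at y))" by (rule has_derivative_linear)
  have "frechet_derivative f (at y) v = (\<Sum>i\<in>UNIV. pd i f y * v $ i)" for v
  proof -
    have "v = (\<Sum>i\<in>UNIV. v $ i *\<^sub>R axis i 1)"
      using basis_expansion[of v] by (simp add: scalar_mult_eq_scaleR)
    then have "frechet_derivative f (at y) v = frechet_derivative f (at y) (\<Sum>i\<in>UNIV. v $ i *\<^sub>R axis i 1)"
      by simp
    also have "\<dots> = (\<Sum>i\<in>UNIV. v $ i * pd i f y)"
      by (simp add: linear_sum[OF lin] linear_cmul[OF lin] pd_def)
    finally show ?thesis by (simp add: mult.commute)
  qed
  then have "frechet_derivative f (at y) = (\<lambda>v. \<Sum>i\<in>UNIV. pd i f y * v $ i)" by (rule ext)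
  then show ?thesis using d by simp
qed

lemma pd_transform:
  assumes "open S" "y \<in> S" "\<And>x. x \<in> S \<Longrightarrow> f x = g x" "f differentiable (at y)"
  shows "pd i f y = pd i g y"
  unfolding pd_def using frechet_derivative_transform_within_open[OF assms(4,1,2,3)] by simp

lemma C1_onD: "C1_on S f \<Longrightarrow> y \<in> S \<Longrightarrow> f differentiable (at y)"
  and C1_on_pd: "C1_on S f \<Longrightarrow> continuous_on S (pd i f)"
  by (auto simp: C1_on_def)

lemma C1_on_continuous: "C1_on S f \<Longrightarrow> continuous_on S f"
  by (meson C1_onD continuous_at_imp_continuous_on differentiable_imp_continuous_within)

lemma C1_on_subset: "C1_on S f \<Longrightarrow> T \<subseteq> S \<Longrightarrow> C1_on T f"
  by (auto simp: C1_on_def intro: continuous_on_subset)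

lemma C1_on_cong:
  assumes "open S" "\<And>x. x \<in> S \<Longrightarrow> f x = g x" "C1_on S f"
  shows "C1_on S g"
proof -
  have d: "g differentiable (at y)" if "y \<in> S" for y
    using assms that has_derivative_transform_within_open unfolding C1_on_def differentiable_def by meson
  moreover have "continuous_on S (pd i g)" for i
  proof (rule continuous_on_eq)
    show "continuous_on S (pd i f)" using assms(3) by (rule C1_on_pd)
    show "pd i f y = pd i g y" if "y \<in> S" for y
      by (rule pd_transform[OF assms(1) that]) (use assms C1_onD[OF assms(3) that] in auto)
  qed
  ultimately show ?thesis by (auto simp: C1_on_def)
qed

lemma pd_const [simp]: "pd i (\<lambda>y. c) y = 0"
  by (rule pd_eqI[OF has_derivative_const])

lemma pd_add: "f differentiable (at y) \<Longrightarrow> g differentiable (at y) \<Longrightarrow>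
    pd i (\<lambda>y. f y + g y) y = pd i f y + pd i g y"
  by (subst pd_eqI[OF has_derivative_add[OF has_derivative_pd has_derivative_pd]])
     (auto simp: axis_def if_distrib cong: if_cong)

lemma pd_uminus: "f differentiable (at y) \<Longrightarrow> pd i (\<lambda>y. - f y) y = - pd i f y"
  by (subst pd_eqI[OF has_derivative_minus[OF has_derivative_pd]]) (auto simp: axis_def if_distrib cong: if_cong)

lemma pd_diff: "f differentiable (at y) \<Longrightarrow> g differentiable (at y) \<Longrightarrow>
    pd i (\<lambda>y. f y - g y) y = pd i f y - pd i g y"
  using pd_add[of f y "\<lambda>y. - g y" i] pd_uminus[of g y i] by simp

lemma pd_mult:
  assumes "f differentiable (at y)" "g differentiable (at y)"
  shows "pd i (\<lambda>y. f y * g y) y = pd i f y * g y + f y * pd i g y"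
  by (subst pd_eqI[OF has_derivative_mult[OF has_derivative_pd has_derivative_pd]])
     (auto simp: assms axis_def if_distrib algebra_simps cong: if_cong)

lemma differentiable_sum_UNIV:
  "(\<And>k. f k differentiable (at y)) \<Longrightarrow> (\<lambda>y. \<Sum>k\<in>(A::'k::finite set). f k y) differentiable (at y)"
  by (rule differentiable_sum) auto

lemma pd_sum:
  fixes f :: "'k::finite \<Rightarrow> real^'n \<Rightarrow> real"
  assumes "\<And>k. f k differentiable (at y)"
  shows "pd i (\<lambda>y. \<Sum>k\<in>A. f k y) y = (\<Sum>k\<in>A. pd i (f k) y)"
proof (induction A rule: infinite_finite_induct)
  case (insert x A)
  then show ?case using assms by (simp add: pd_add differentiable_sum_UNIV)
qed auto

lemma pd_compose:
  assumes "f differentiable (at y)" "(g has_real_derivative g') (at (f y))"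
  shows "(\<lambda>y. g (f y)) differentiable (at y)" "pd i (\<lambda>y. g (f y)) y = g' * pd i f y"
proof -
  have "((\<lambda>y. g (f y)) has_derivative (\<lambda>v. g' * (\<Sum>i\<in>UNIV. pd i f y * v $ i))) (at y)"
    using has_derivative_compose[OF has_derivative_pd[OF assms(1)], of g "\<lambda>v. g' * v"] assms(2)
    by (simp add: has_field_derivative_def)
  note d = this
  show "(\<lambda>y. g (f y)) differentiable (at y)" using d by (rule differentiableI)
  show "pd i (\<lambda>y. g (f y)) y = g' * pd i f y"
    by (subst pd_eqI[OF d]) (simp add: axis_def if_distrib cong: if_cong)
qed

lemma continuous_on_pd_cong:
  assumes "\<And>y. y \<in> S \<Longrightarrow> pd i f y = g y" "continuous_on S g" shows "continuous_on S (pd i f)"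
  using assms continuous_on_cong by blast

lemma C1_on_const [intro, simp]: "C1_on S (\<lambda>y. c)"
  unfolding C1_on_def using continuous_on_pd_cong[OF pd_const continuous_on_const] by auto

lemma C1_on_add [intro]:
  assumes "C1_on S f" "C1_on S g" shows "C1_on S (\<lambda>y. f y + g y)"
proof -
  have "continuous_on S (pd i (\<lambda>y. f y + g y))" for i
    by (rule continuous_on_pd_cong[where g = "\<lambda>y. pd i f y + pd i g y"])
       (auto intro!: pd_add C1_onD[OF assms(1)] C1_onD[OF assms(2)] continuous_on_add C1_on_pd assms)
  then show ?thesis using assms by (auto simp: C1_on_def)
qed

lemma C1_on_uminus [intro]:
  assumes "C1_on S f" shows "C1_on S (\<lambda>y. - f y)"
proof -
  have "continuous_on S (pd i (\<lambda>y. - f y))" for i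
    by (rule continuous_on_pd_cong[where g = "\<lambda>y. - pd i f y"])
       (auto intro!: pd_uminus C1_onD[OF assms(1)] continuous_on_minus C1_on_pd assms)
  then show ?thesis using assms by (auto simp: C1_on_def)
qed

lemma C1_on_diff [intro]: "C1_on S f \<Longrightarrow> C1_on S g \<Longrightarrow> C1_on S (\<lambda>y. f y - g y)"
  using C1_on_add[of S f "\<lambda>y. - g y"] C1_on_uminus[of S g] by simp

lemma C1_on_mult [intro]:
  assumes "C1_on S f" "C1_on S g" shows "C1_on S (\<lambda>y. f y * g y)"
proof -
  have "continuous_on S (pd i (\<lambda>y. f y * g y))" for i
    by (rule continuous_on_pd_cong[where g = "\<lambda>y. pd i f y * g y + f y * pd i g y"])
       (auto intro!: pd_mult C1_onD[OF assms(1)] C1_onD[OF assms(2)] continuous_on_add continuous_on_mult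
          C1_on_pd[OF assms(1)] C1_on_pd[OF assms(2)] C1_on_continuous[OF assms(1)] C1_on_continuous[OF assms(2)])
  then show ?thesis using assms by (auto simp: C1_on_def)
qed

lemma C1_on_sum [intro]:
  fixes f :: "'k::finite \<Rightarrow> real^'n \<Rightarrow> real"
  shows "(\<And>k. C1_on S (f k)) \<Longrightarrow> C1_on S (\<lambda>y. \<Sum>k\<in>A. f k y)"
  by (induction A rule: infinite_finite_induct) auto

lemma C1_on_compose:
  assumes "C1_on S f" "\<And>y. y \<in> S \<Longrightarrow> (g has_real_derivative g' (f y)) (at (f y))" "continuous_on (f ` S) g'"
  shows "C1_on S (\<lambda>y. g (f y))"
proof -
  have "continuous_on S (pd i (\<lambda>y. g (f y)))" for i
    by (rule continuous_on_pd_cong[where g = "\<lambda>y. g' (f y) * pd i f y"])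
       (auto intro!: pd_compose(2) C1_onD[OF assms(1)] assms(2) continuous_on_mult C1_on_pd[OF assms(1)]
         continuous_on_compose2[OF assms(3) C1_on_continuous[OF assms(1)]])
  then show ?thesis using pd_compose(1)[OF C1_onD[OF assms(1)] assms(2)] by (auto simp: C1_on_def)
qed

lemma has_derivative_nth: "((\<lambda>y. y $ k) has_derivative (\<lambda>v. v $ k)) (at (y::real^'n))"
  by (rule bounded_linear.has_derivative[OF bounded_linear_vec_nth has_derivative_ident])

lemma pd_nth: "pd i (\<lambda>y. y $ k) y = (if i = k then 1 else 0)"
  by (subst pd_eqI[OF has_derivative_nth]) (simp add: axis_def)

lemma C1_on_nth [intro, simp]: "C1_on S (\<lambda>y. y $ k)"
  unfolding C1_on_def using continuous_on_pd_cong[OF pd_nth continuous_on_const] differentiableI[OF has_derivative_nth] by auto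

lemma has_real_derivative_line:
  assumes "f differentiable (at (p + s *\<^sub>R axis i 1))"
  shows "((\<lambda>s. f (p + s *\<^sub>R axis i 1)) has_real_derivative pd i f (p + s *\<^sub>R axis i 1)) (at s)"
proof -
  have "((\<lambda>s. p + s *\<^sub>R axis i (1::real)) has_derivative (\<lambda>h. h *\<^sub>R axis i 1)) (at s)"
    by (auto intro!: derivative_eq_intros)
  from has_derivative_compose[OF this has_derivative_pd[OF assms]]
  have "((\<lambda>s. f (p + s *\<^sub>R axis i 1)) has_derivative
    (\<lambda>h. \<Sum>k\<in>UNIV. pd k f (p + s *\<^sub>R axis i 1) * (h *\<^sub>R axis i 1) $ k)) (at s)" .
  moreover have "(\<lambda>h. \<Sum>k\<in>UNIV. pd k f (p + s *\<^sub>R axis i 1) * (h *\<^sub>R axis i 1) $ k) = (*) (pd i f (p + s *\<^sub>R axis i 1))"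
  proof
    fix h
    have "(\<Sum>k\<in>UNIV. pd k f (p + s *\<^sub>R axis i 1) * (h *\<^sub>R axis i 1) $ k) =
       (\<Sum>k\<in>UNIV. if k = i then pd k f (p + s *\<^sub>R axis i 1) * h else 0)"
      by (intro sum.cong refl) (simp add: axis_def)
    then show "(\<Sum>k\<in>UNIV. pd k f (p + s *\<^sub>R axis i 1) * (h *\<^sub>R axis i 1) $ k) = pd i f (p + s *\<^sub>R axis i 1) * h"
      by simp
  qed
  ultimately show ?thesis unfolding has_field_derivative_def by simp
qed

text \<open>The mixed second difference over a square of side \<open>t\<close> is symmetric in the
  two directions. Applying the mean value theorem in one direction and then in the other expresses
  it by a mixed derivative at a point of the square; the two orders are compared in
  \<open>pd_commute\<close>.\<close>

lemma second_difference_MVT: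
  fixes f :: "real^'n \<Rightarrow> real"
  assumes "open S" "t > 0" and sub: "\<And>a b. 0 \<le> a \<Longrightarrow> a \<le> t \<Longrightarrow> 0 \<le> b \<Longrightarrow> b \<le> t \<Longrightarrow> y + a *\<^sub>R axis i 1 + b *\<^sub>R axis j 1 \<in> S"
    and f: "\<And>y. y \<in> S \<Longrightarrow> f differentiable (at y)" and fi: "\<And>y. y \<in> S \<Longrightarrow> pd i f differentiable (at y)"
  shows "\<exists>a b. 0 \<le> a \<and> a \<le> t \<and> 0 \<le> b \<and> b \<le> t \<and>
    f (y + t *\<^sub>R axis i 1 + t *\<^sub>R axis j 1) - f (y + t *\<^sub>R axis i 1) - f (y + t *\<^sub>R axis j 1) + f y
      = t * (t * pd j (pd i f) (y + a *\<^sub>R axis i 1 + b *\<^sub>R axis j 1))"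
proof -
  define \<phi> where "\<phi> s = f (y + t *\<^sub>R axis j 1 + s *\<^sub>R axis i 1) - f (y + s *\<^sub>R axis i 1)" for s
  have d: "(\<phi> has_real_derivative (pd i f (y + t *\<^sub>R axis j 1 + s *\<^sub>R axis i 1) - pd i f (y + s *\<^sub>R axis i 1))) (at s)"
    if "0 \<le> s" "s \<le> t" for s
    unfolding \<phi>_def
    by (intro derivative_intros has_real_derivative_line f)
       (use sub[of s t] sub[of s 0] that assms(2) in \<open>auto simp: add_ac\<close>)
  obtain a where a: "0 < a" "a < t" "\<phi> t - \<phi> 0 = (t - 0) * (pd i f (y + t *\<^sub>R axis j 1 + a *\<^sub>R axis i 1) - pd i f (y + a *\<^sub>R axis i 1))"
    using MVT2[OF assms(2) d] by auto
  have d2: "((\<lambda>s. pd i f ((y + a *\<^sub>R axis i 1) + s *\<^sub>R axis j 1)) has_real_derivative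
     pd j (pd i f) ((y + a *\<^sub>R axis i 1) + s *\<^sub>R axis j 1)) (at s)" if "0 \<le> s" "s \<le> t" for s
    by (intro has_real_derivative_line fi) (use sub[of a s] that a in auto)
  obtain b where b: "0 < b" "b < t" "pd i f ((y + a *\<^sub>R axis i 1) + t *\<^sub>R axis j 1) - pd i f ((y + a *\<^sub>R axis i 1) + 0 *\<^sub>R axis j 1)
     = (t - 0) * pd j (pd i f) ((y + a *\<^sub>R axis i 1) + b *\<^sub>R axis j 1)"
    using MVT2[OF assms(2) d2] by auto
  have "f (y + t *\<^sub>R axis i 1 + t *\<^sub>R axis j 1) - f (y + t *\<^sub>R axis i 1) - f (y + t *\<^sub>R axis j 1) + f y = \<phi> t - \<phi> 0"
    by (simp add: \<phi>_def add_ac)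
  also have "\<dots> = t * (t * pd j (pd i f) (y + a *\<^sub>R axis i 1 + b *\<^sub>R axis j 1))"
    using a(3) b(3) by (simp add: add_ac)
  finally show ?thesis using a b by (intro exI[of _ a] exI[of _ b]) auto
qed

lemma pd_commute:
  fixes f :: "real^'n \<Rightarrow> real"
  assumes "open S" "y \<in> S" "C1_on S f" "\<And>i. C1_on S (pd i f)"
  shows "pd i (pd j f) y = pd j (pd i f) y"
proof (rule ccontr)
  assume ne: "\<not> ?thesis"
  define e where "e = \<bar>pd i (pd j f) y - pd j (pd i f) y\<bar> / 2"
  have e: "e > 0" using ne by (simp add: e_def)
  obtain r where r: "r > 0" "ball y r \<subseteq> S" using assms(1,2) openE by blast
  have cont: "isCont (pd k (pd l f)) y" for k l
    using C1_on_pd[OF assms(4)] assms(1,2) by (simp add: continuous_on_eq_continuous_at)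
  obtain d1 where d1: "d1 > 0" "\<And>x. dist x y < d1 \<Longrightarrow> dist (pd i (pd j f) x) (pd i (pd j f) y) < e"
    using cont[unfolded continuous_at_eps_delta] e by blast
  obtain d2 where d2: "d2 > 0" "\<And>x. dist x y < d2 \<Longrightarrow> dist (pd j (pd i f) x) (pd j (pd i f) y) < e"
    using cont[unfolded continuous_at_eps_delta] e by blast
  \<comment> \<open>Points of the square have distance at most \<open>2 t\<close> from
    \<open>y\<close>; the divisor \<open>3\<close> keeps this below all three radii.\<close>
  define t where "t = min r (min d1 d2) / 3"
  have t: "t > 0" "2 * t < r" "2 * t < d1" "2 * t < d2" using r d1 d2 by (auto simp: t_def)
  have near: "dist (y + a *\<^sub>R axis k 1 + b *\<^sub>R axis l 1) y \<le> 2 * t" if "0 \<le> a" "a \<le> t" "0 \<le> b" "b \<le> t" for a b k l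
  proof -
    have "dist (y + a *\<^sub>R axis k 1 + b *\<^sub>R axis l 1) y = norm (a *\<^sub>R axis k (1::real) + b *\<^sub>R axis l 1)"
      by (simp add: dist_norm add.assoc)
    also have "\<dots> \<le> norm (a *\<^sub>R axis k (1::real)) + norm (b *\<^sub>R axis l (1::real))" by (rule norm_triangle_ineq)
    finally show ?thesis using that by simp
  qed
  have inS: "y + a *\<^sub>R axis k 1 + b *\<^sub>R axis l 1 \<in> S" if "0 \<le> a" "a \<le> t" "0 \<le> b" "b \<le> t" for a b k l
  proof -
    have "dist y (y + a *\<^sub>R axis k 1 + b *\<^sub>R axis l 1) < r" using near[OF that, of k l] t by (simp add: dist_commute)
    then show ?thesis using r(2) by auto
  qed
  note M = second_difference_MVT[OF assms(1) t(1) inS C1_onD[OF assms(3)] C1_onD[OF assms(4)]]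
  obtain a b where ab: "0 \<le> a" "a \<le> t" "0 \<le> b" "b \<le> t"
    "f (y + t *\<^sub>R axis i 1 + t *\<^sub>R axis j 1) - f (y + t *\<^sub>R axis i 1) - f (y + t *\<^sub>R axis j 1) + f y
      = t * (t * pd j (pd i f) (y + a *\<^sub>R axis i 1 + b *\<^sub>R axis j 1))" using M[of i j] by blast
  obtain a' b' where ab': "0 \<le> a'" "a' \<le> t" "0 \<le> b'" "b' \<le> t"
    "f (y + t *\<^sub>R axis j 1 + t *\<^sub>R axis i 1) - f (y + t *\<^sub>R axis j 1) - f (y + t *\<^sub>R axis i 1) + f y
      = t * (t * pd i (pd j f) (y + a' *\<^sub>R axis j 1 + b' *\<^sub>R axis i 1))" using M[of j i] by blast
  have "y + t *\<^sub>R axis j (1::real) + t *\<^sub>R axis i 1 = y + t *\<^sub>R axis i 1 + t *\<^sub>R axis j 1" by (simp add: add_ac)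
  from ab(5) ab'(5)[unfolded this] have "t * (t * pd i (pd j f) (y + a' *\<^sub>R axis j 1 + b' *\<^sub>R axis i 1)) = t * (t * pd j (pd i f) (y + a *\<^sub>R axis i 1 + b *\<^sub>R axis j 1))"
    by linarith
  then have eq: "pd i (pd j f) (y + a' *\<^sub>R axis j 1 + b' *\<^sub>R axis i 1) = pd j (pd i f) (y + a *\<^sub>R axis i 1 + b *\<^sub>R axis j 1)"
    using t by simp
  have "dist (pd i (pd j f) (y + a' *\<^sub>R axis j 1 + b' *\<^sub>R axis i 1)) (pd i (pd j f) y) < e"
    using near[OF ab'(1-4), of j i] t by (intro d1) auto
  moreover have "dist (pd j (pd i f) (y + a *\<^sub>R axis i 1 + b *\<^sub>R axis j 1)) (pd j (pd i f) y) < e"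
    using near[OF ab(1-4), of i j] t by (intro d2) auto
  ultimately have "dist (pd i (pd j f) y) (pd j (pd i f) y) < 2 * e"
    using dist_triangle3[of "pd i (pd j f) y" "pd j (pd i f) y" "pd j (pd i f) (y + a *\<^sub>R axis i 1 + b *\<^sub>R axis j 1)"]
    unfolding eq by linarith
  then show False by (simp add: dist_real_def e_def)
qed

section \<open>Divergence of Newton tensors of a matrix field\<close>

lemma C1_on_matrix_mult:
  fixes A :: "real^'m::finite \<Rightarrow> real^'n^'p" and B :: "real^'m \<Rightarrow> real^'q^'n"
  assumes "\<And>i j. C1_on S (\<lambda>y. A y $ i $ j)" "\<And>i j. C1_on S (\<lambda>y. B y $ i $ j)"
  shows "C1_on S (\<lambda>y. (A y ** B y) $ i $ j)"
  unfolding matrix_matrix_mult_def vec_lambda_beta by (intro C1_on_sum C1_on_mult assms)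

lemma C1_on_newton_tensor:
  fixes A :: "real^'m::finite \<Rightarrow> real^'n^'n"
  assumes "\<And>i j. C1_on S (\<lambda>y. A y $ i $ j)"
  shows "C1_on S (\<lambda>y. newton_tensor k (A y) $ i $ j)"
proof (induction k arbitrary: i j)
  case (Suc k)
  have "C1_on S (\<lambda>y. trace (newton_tensor k (A y) ** A y))"
    unfolding trace_def by (intro C1_on_sum C1_on_matrix_mult assms Suc)
  then have "C1_on S (\<lambda>y. trace (newton_tensor k (A y) ** A y) * (1 / real (Suc k)) * mat 1 $ i $ j - (newton_tensor k (A y) ** A y) $ i $ j)"
    by (intro C1_on_diff C1_on_mult C1_on_const C1_on_matrix_mult assms Suc)
  then show ?case by simp
qed simp

lemma C1_on_msigma:
  fixes A :: "real^'m::finite \<Rightarrow> real^'n^'n"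
  assumes "\<And>i j. C1_on S (\<lambda>y. A y $ i $ j)"
  shows "C1_on S (\<lambda>y. msigma k (A y))"
proof (cases k)
  case (Suc k')
  have "C1_on S (\<lambda>y. trace (newton_tensor k' (A y) ** A y) * (1 / real (Suc k')))"
    unfolding trace_def by (intro C1_on_sum C1_on_mult C1_on_const C1_on_matrix_mult C1_on_newton_tensor assms)
  then show ?thesis by (simp add: Suc msigma_def)
qed simp

lemma differentiable_matrixI:
  fixes A :: "real^'m::finite \<Rightarrow> real^'n^'p"
  assumes "\<And>i j. (\<lambda>y. A y $ i $ j) differentiable (at y)"
  shows "A differentiable (at y)"
  unfolding differentiable_componentwise_within[of A]
  using assms by (auto simp: Basis_vec_def inner_axis)

lemma pd_msigma_Suc:
  fixes A :: "real^'m::finite \<Rightarrow> real^'n^'n"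
  assumes "\<And>i j. (\<lambda>y. A y $ i $ j) differentiable (at y)"
  shows "pd l (\<lambda>y. msigma (Suc k) (A y)) y = trace (newton_tensor k (A y) ** (\<chi> a b. pd l (\<lambda>y. A y $ a $ b) y))"
proof -
  obtain A' where A': "(A has_derivative A') (at y)"
    using differentiable_matrixI[OF assms] by (auto simp: differentiable_def)
  have "A' (axis l 1) = (\<chi> a b. pd l (\<lambda>y. A y $ a $ b) y)"
  proof -
    have "((\<lambda>y. A y $ a $ b) has_derivative (\<lambda>v. A' v $ a $ b)) (at y)" for a b
      by (intro bounded_linear.has_derivative[OF bounded_linear_vec_nth] A')
    from pd_eqI[OF this] show ?thesis by (simp add: vec_eq_iff)
  qed
  then show ?thesis
    using pd_eqI[OF has_derivative_sigma_newton_tensor(1)[OF A']] by simp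
qed

text \<open>Piola's identity: the terms in which \<open>A\<close> is differentiated add up to \<open>\<partial>\<^sub>l \<sigma>\<^sub>k\<^sub>+\<^sub>1\<close>.\<close>

lemma newton_tensor_divergence_free:
  fixes A :: "real^'n \<Rightarrow> real^'n^'n"
  assumes "y \<in> S" and A: "\<And>i j. C1_on S (\<lambda>y. A y $ i $ j)"
    and closed: "\<And>i m l. pd i (\<lambda>y. A y $ m $ l) y = pd l (\<lambda>y. A y $ m $ i) y"
  shows "(\<Sum>i\<in>UNIV. pd i (\<lambda>y. newton_tensor k (A y) $ i $ l) y) = 0"
proof (induction k arbitrary: l)
  case (Suc k)
  have dA: "(\<lambda>y. A y $ i $ j) differentiable (at y)" for i j using C1_onD[OF A assms(1)] .
  have dT: "(\<lambda>y. newton_tensor k (A y) $ i $ j) differentiable (at y)" for i j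
    using C1_onD[OF C1_on_newton_tensor[OF A] assms(1)] .
  have ds: "(\<lambda>y. msigma (Suc k) (A y)) differentiable (at y)"
    using C1_onD[OF C1_on_msigma[OF A] assms(1)] .
  have one: "pd i (\<lambda>y. newton_tensor (Suc k) (A y) $ i $ l) y = (if i = l then pd i (\<lambda>y. msigma (Suc k) (A y)) y else 0) -
     (\<Sum>m\<in>UNIV. pd i (\<lambda>y. newton_tensor k (A y) $ i $ m) y * A y $ m $ l + newton_tensor k (A y) $ i $ m * pd i (\<lambda>y. A y $ m $ l) y)" for i
  proof -
    have "pd i (\<lambda>y. newton_tensor (Suc k) (A y) $ i $ l) y =
       pd i (\<lambda>y. msigma (Suc k) (A y) * mat 1 $ i $ l - (\<Sum>m\<in>UNIV. newton_tensor k (A y) $ i $ m * A y $ m $ l)) y"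
      by (simp add: newton_tensor_Suc matrix_matrix_mult_def del: newton_tensor.simps)
    also have "\<dots> = pd i (\<lambda>y. msigma (Suc k) (A y)) y * mat 1 $ i $ l -
        (\<Sum>m\<in>UNIV. pd i (\<lambda>y. newton_tensor k (A y) $ i $ m * A y $ m $ l) y)"
    proof -
      have "pd i (\<lambda>y. \<Sum>m\<in>UNIV. newton_tensor k (A y) $ i $ m * A y $ m $ l) y =
          (\<Sum>m\<in>UNIV. pd i (\<lambda>y. newton_tensor k (A y) $ i $ m * A y $ m $ l) y)"
        by (rule pd_sum) (intro differentiable_mult dT dA)
      moreover have "pd i (\<lambda>y. msigma (Suc k) (A y) * mat 1 $ i $ l) y = pd i (\<lambda>y. msigma (Suc k) (A y)) y * mat 1 $ i $ l"
        by (subst pd_mult) (auto intro: ds)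
      ultimately show ?thesis
        by (subst pd_diff) (auto intro!: differentiable_mult differentiable_sum ds dT dA)
    qed
    finally show ?thesis by (simp add: pd_mult dT dA mat_def)
  qed
  have "(\<Sum>i\<in>UNIV. pd i (\<lambda>y. newton_tensor (Suc k) (A y) $ i $ l) y) = pd l (\<lambda>y. msigma (Suc k) (A y)) y -
     ((\<Sum>m\<in>UNIV. (\<Sum>i\<in>UNIV. pd i (\<lambda>y. newton_tensor k (A y) $ i $ m) y) * A y $ m $ l) +
      (\<Sum>i\<in>UNIV. \<Sum>m\<in>UNIV. newton_tensor k (A y) $ i $ m * pd i (\<lambda>y. A y $ m $ l) y))"
    unfolding one by (simp add: sum_subtractf sum.distrib sum_distrib_right) (rule sum.swap)
  also have "\<dots> = pd l (\<lambda>y. msigma (Suc k) (A y)) y - (\<Sum>i\<in>UNIV. \<Sum>m\<in>UNIV. newton_tensor k (A y) $ i $ m * pd l (\<lambda>y. A y $ m $ i) y)"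
    using Suc by (simp add: closed[of _ _ l])
  also have "\<dots> = 0"
    unfolding pd_msigma_Suc[OF dA] by (simp add: trace_def matrix_matrix_mult_def)
  finally show ?case .
qed simp

text \<open>By Piola's identity only the derivative of \<open>v\<close> survives. It is applied to
  the tilt, where that derivative is \<open>A\<close>, and to the position vector, where it is the
  identity.\<close>

lemma divergence_newton_tensor_mult:
  fixes A :: "real^'n \<Rightarrow> real^'n^'n" and v :: "real^'n \<Rightarrow> real^'n"
  assumes "y \<in> S" and A: "\<And>i j. C1_on S (\<lambda>y. A y $ i $ j)" and v: "\<And>l. C1_on S (\<lambda>y. v y $ l)"
    and closed: "\<And>i m l. pd i (\<lambda>y. A y $ m $ l) y = pd l (\<lambda>y. A y $ m $ i) y"
  shows "(\<Sum>i\<in>UNIV. pd i (\<lambda>y. (newton_tensor k (A y) *v v y) $ i) y) =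
    trace (newton_tensor k (A y) ** (\<chi> l i. pd i (\<lambda>y. v y $ l) y))"
proof -
  have dv: "(\<lambda>y. v y $ j) differentiable (at y)" for j using C1_onD[OF v assms(1)] .
  have dT: "(\<lambda>y. newton_tensor k (A y) $ i $ j) differentiable (at y)" for i j
    using C1_onD[OF C1_on_newton_tensor[OF A] assms(1)] .
  have "pd i (\<lambda>y. (newton_tensor k (A y) *v v y) $ i) y =
     (\<Sum>l\<in>UNIV. pd i (\<lambda>y. newton_tensor k (A y) $ i $ l) y * v y $ l + newton_tensor k (A y) $ i $ l * pd i (\<lambda>y. v y $ l) y)" for i
    unfolding matrix_vector_mult_def vec_lambda_beta
    by (subst pd_sum) (auto intro!: differentiable_mult dT dv simp: pd_mult dT dv)
  then have "(\<Sum>i\<in>UNIV. pd i (\<lambda>y. (newton_tensor k (A y) *v v y) $ i) y) =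
     (\<Sum>l\<in>UNIV. (\<Sum>i\<in>UNIV. pd i (\<lambda>y. newton_tensor k (A y) $ i $ l) y) * v y $ l) +
     (\<Sum>i\<in>UNIV. \<Sum>l\<in>UNIV. newton_tensor k (A y) $ i $ l * pd i (\<lambda>y. v y $ l) y)"
    by (simp add: sum.distrib sum_distrib_right) (rule sum.swap)
  then show ?thesis
    using newton_tensor_divergence_free[OF assms(1) A closed] by (simp add: trace_def matrix_matrix_mult_def)
qed

section \<open>A divergence theorem\<close>

lemma lborel_integral_translate:
  fixes f :: "'a::euclidean_space \<Rightarrow> real"
  assumes "f \<in> borel_measurable borel"
  shows "integral\<^sup>L lborel (\<lambda>x. f (x + c)) = integral\<^sup>L lborel f"
proof -
  have "integral\<^sup>L lborel f = integral\<^sup>L (distr lborel borel ((+) c)) f" by (simp add: lborel_distr_plus)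
  also have "\<dots> = integral\<^sup>L lborel (\<lambda>x. f (c + x))" using assms by (intro integral_distr) auto
  finally show ?thesis by (simp add: add.commute)
qed

lemma integrable_bounded_support:
  fixes f :: "'a::euclidean_space \<Rightarrow> real"
  assumes "f \<in> borel_measurable borel" "\<And>x. \<bar>f x\<bar> \<le> B" "bounded S" "\<And>x. x \<notin> S \<Longrightarrow> f x = 0"
  shows "integrable lborel f"
proof -
  obtain r where r: "S \<subseteq> cball 0 r" using assms(3) by (auto simp: bounded_iff subset_iff)
  have "integrable lborel (\<lambda>x. B * indicator (cball (0::'a) r) x)"
    using emeasure_bounded_finite[of "cball (0::'a) r"] by (intro integrable_mult_right integrable_real_indicator) auto
  then show ?thesis
  proof (rule Bochner_Integration.integrable_bound)
    show "f \<in> borel_measurable lborel" using assms(1) by simp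
    have "B \<ge> 0" using assms(2)[of 0] by linarith
    then show "AE x in lborel. norm (f x) \<le> norm (B * indicator (cball 0 r) x)"
      using assms(2,4) r by (intro AE_I2) (auto simp: indicator_def subset_iff)
  qed
qed

lemma bounded_on_cball:
  fixes f :: "'a::euclidean_space \<Rightarrow> real"
  assumes "continuous_on UNIV f"
  shows "\<exists>B\<ge>0. \<forall>y\<in>cball 0 r. \<bar>f y\<bar> \<le> B"
proof -
  have "bounded (f ` cball 0 r)"
    using compact_continuous_image[OF continuous_on_subset[OF assms]] by (simp add: compact_imp_bounded)
  then obtain B where "\<forall>x\<in>f ` cball 0 r. norm x \<le> B" using bounded_iff by blast
  then show ?thesis by (intro exI[of _ "max 0 B"]) force
qed

text \<open>By translation invariance all difference quotients of \<open>V\<close> have integral zero.\<close>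

lemma integral_pd_compact_support:
  fixes V :: "real^'n \<Rightarrow> real"
  assumes V: "C1_on UNIV V" and r: "\<And>y. norm y > r \<Longrightarrow> V y = 0" "r \<ge> 0"
  shows "integrable lborel (pd i V)" and "integral\<^sup>L lborel (pd i V) = 0"
proof -
  have contV: "continuous_on UNIV V" and contp: "continuous_on UNIV (pd i V)"
    using V by (auto intro: C1_on_continuous C1_on_pd)
  have mV: "V \<in> borel_measurable borel" and mp: "pd i V \<in> borel_measurable borel"
    using contV contp by (auto intro: borel_measurable_continuous_onI)
  have out: "pd i V y = 0" if "norm y > r" for y
  proof -
    have "pd i V y = pd i (\<lambda>_. 0) y"
    proof (rule pd_transform)
      show "open {y::real^'n. norm y > r}" by (intro open_Collect_less continuous_intros)
    qed (use that r C1_onD[OF V] in auto)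
    then show ?thesis by simp
  qed
  obtain B where Bpos: "B \<ge> 0" and B0: "\<forall>y\<in>cball 0 r. \<bar>pd i V y\<bar> \<le> B"
    using bounded_on_cball[OF contp] by blast
  have B: "\<bar>pd i V y\<bar> \<le> B" for y
    using B0 out[of y] Bpos by (cases "norm y > r") auto
  show int: "integrable lborel (pd i V)"
    by (rule integrable_bounded_support[OF mp B bounded_cball[of 0 r]]) (use out in auto)
  define h where "h m = inverse (real (Suc m))" for m :: nat
  have h: "h m > 0" "h m \<le> 1" for m by (auto simp: h_def inverse_le_1_iff)
  have h0: "h \<longlonglongrightarrow> 0" unfolding h_def by (rule LIMSEQ_inverse_real_of_nat)
  define q where "q m y = (V (y + h m *\<^sub>R axis i 1) - V y) / h m" for m y
  have intV: "integrable lborel V"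
  proof -
    obtain C where C: "C \<ge> 0" "\<forall>y\<in>cball 0 r. \<bar>V y\<bar> \<le> C"
      using bounded_on_cball[OF contV] by blast
    then have "\<bar>V y\<bar> \<le> C" for y using r(1)[of y] by (cases "norm y > r") auto
    then show ?thesis by (rule integrable_bounded_support[OF mV _ bounded_cball[of 0 r]]) (use r in auto)
  qed
  have intVt: "integrable lborel (\<lambda>y. V (y + c))" for c
  proof -
    have "integrable (distr lborel borel ((+) c)) V" using intV by (simp add: lborel_distr_plus)
    then show ?thesis using mV by (subst (asm) integrable_distr_eq) (auto simp: add.commute)
  qed
  have q0: "integral\<^sup>L lborel (q m) = 0" for m
    unfolding q_def using intV intVt by (simp add: lborel_integral_translate[OF mV])
  have "(\<lambda>m. integral\<^sup>L lborel (q m)) \<longlonglongrightarrow> integral\<^sup>L lborel (pd i V)"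
  proof (rule integral_dominated_convergence)
    show "pd i V \<in> borel_measurable lborel" using mp by simp
    show "q m \<in> borel_measurable lborel" for m
      unfolding q_def using mV by measurable
    show "integrable lborel (\<lambda>y. B * indicator (cball (0::real^'n) (r + 1)) y)"
      using emeasure_bounded_finite[of "cball (0::real^'n) (r + 1)"]
      by (intro integrable_mult_right integrable_real_indicator) auto
    show "AE y in lborel. (\<lambda>m. q m y) \<longlonglongrightarrow> pd i V y"
    proof (intro AE_I2)
      fix y
      have "((\<lambda>s. V (y + s *\<^sub>R axis i 1)) has_real_derivative pd i V y) (at 0)"
        using has_real_derivative_line[of V y 0 i] C1_onD[OF V] by simp
      then have "(\<lambda>s. (V (y + s *\<^sub>R axis i 1) - V y) / s) \<midarrow>0\<rightarrow> pd i V y"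
        by (simp add: DERIV_def)
      moreover have "filterlim h (at 0) sequentially"
        using h0 h(1) unfolding filterlim_at by (auto intro!: always_eventually simp: less_imp_neq[symmetric])
      ultimately show "(\<lambda>m. q m y) \<longlonglongrightarrow> pd i V y"
        unfolding q_def by (rule filterlim_compose)
    qed
    show "AE y in lborel. norm (q m y) \<le> B * indicator (cball 0 (r + 1)) y" for m
    proof (intro AE_I2)
      fix y
      have "((\<lambda>s. V (y + s *\<^sub>R axis i 1)) has_real_derivative pd i V (y + s *\<^sub>R axis i 1)) (at s)" for s
        by (rule has_real_derivative_line[OF C1_onD[OF V UNIV_I]])
      from MVT2[OF h(1)[of m] this]
      obtain z where z: "V (y + h m *\<^sub>R axis i 1) - V (y + 0 *\<^sub>R axis i 1) = (h m - 0) * pd i V (y + z *\<^sub>R axis i 1)"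
        by auto
      have bd: "\<bar>q m y\<bar> \<le> B" using z h(1)[of m] B[of "y + z *\<^sub>R axis i 1"] by (simp add: q_def)
      show "norm (q m y) \<le> B * indicator (cball 0 (r + 1)) y"
      proof (cases "norm y \<le> r + 1")
        case False
        \<comment> \<open>Since \<open>h m \<le> 1\<close>, outside the ball of radius
          \<open>r + 1\<close> both \<open>y\<close> and its translate lie outside the support of
          \<open>V\<close>.\<close>
        have "norm y \<le> norm (y + h m *\<^sub>R axis i 1) + norm (h m *\<^sub>R axis i (1::real))"
          using norm_triangle_ineq4[of "y + h m *\<^sub>R axis i 1" "h m *\<^sub>R axis i 1"] by simp
        then have "norm (y + h m *\<^sub>R axis i 1) > r" using False h[of m] by simp
        then show ?thesis using r(1) False by (simp add: q_def)
      qed (use bd in auto)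
    qed
  qed
  then have "(\<lambda>m::nat. 0::real) \<longlonglongrightarrow> integral\<^sup>L lborel (pd i V)" by (simp only: q0)
  from LIMSEQ_unique[OF this tendsto_const] show "integral\<^sup>L lborel (pd i V) = 0" .
qed

section \<open>Truncation near the zero set\<close>

lemma has_real_derivative_max_square:
  "((\<lambda>x. (max 0 x)\<^sup>2) has_real_derivative 2 * max 0 x) (at (x::real))"
proof -
  consider "x > 0" | "x < 0" | "x = 0" by linarith
  then show ?thesis
  proof cases
    case 1
    have "((\<lambda>x. x\<^sup>2) has_real_derivative 2 * max 0 x) (at x)"
      using 1 by (auto intro!: derivative_eq_intros)
    then show ?thesis by (rule has_field_derivative_transform_within_open[of _ _ _ "{0<..}"]) (use 1 in auto)
  next
    case 2
    have "((\<lambda>x. 0) has_real_derivative 2 * max 0 x) (at x)"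
      using 2 by (auto intro!: derivative_eq_intros)
    then show ?thesis by (rule has_field_derivative_transform_within_open[of _ _ _ "{..<0}"]) (use 2 in auto)
  next
    case 3
    have "((\<lambda>h. (max 0 h)\<^sup>2 / h) \<longlongrightarrow> 0) (at (0::real))"
    proof (rule Lim_null_comparison)
      show "\<forall>\<^sub>F h in at (0::real). norm ((max 0 h)\<^sup>2 / h) \<le> \<bar>h\<bar>"
        by (intro always_eventually allI) (auto simp: max_def power2_eq_square)
      show "((\<lambda>h::real. \<bar>h\<bar>) \<longlongrightarrow> 0) (at 0)" by (intro tendsto_rabs_zero tendsto_ident_at)
    qed
    then show ?thesis using 3 by (simp add: DERIV_def)
  qed
qed

text \<open>A continuously differentiable substitute for \<open>max 0 (t - e)\<close>. The square
  removes the kink at \<open>t = e\<close>; the division by \<open>t\<close> restores linear growth,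
  so that the function stays below \<open>t\<close> and its derivative between \<open>0\<close> and
  \<open>1\<close>, uniformly in \<open>e\<close>.\<close>

definition cutoff :: "real \<Rightarrow> real \<Rightarrow> real" where
  "cutoff e t = (max 0 (t - e))\<^sup>2 / t"

definition cutoff' :: "real \<Rightarrow> real \<Rightarrow> real" where
  "cutoff' e t = (2 * max 0 (t - e) * t - (max 0 (t - e))\<^sup>2) / t\<^sup>2"

lemma has_real_derivative_cutoff:
  assumes "t > 0" shows "(cutoff e has_real_derivative cutoff' e t) (at t)"
proof -
  have "((\<lambda>t. (max 0 (t - e))\<^sup>2) has_real_derivative 2 * max 0 (t - e) * 1) (at t)"
    by (rule DERIV_chain2[OF has_real_derivative_max_square]) (auto intro!: derivative_eq_intros)
  from DERIV_divide[OF this DERIV_ident] show ?thesis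
    using assms by (simp add: cutoff_def[abs_def] cutoff'_def power2_eq_square)
qed

lemma cutoff_bounds:
  assumes "t > 0" "e > 0"
  shows "0 \<le> cutoff e t" "cutoff e t \<le> t" "0 \<le> cutoff' e t" "cutoff' e t \<le> 1" "t \<le> e \<Longrightarrow> cutoff e t = 0"
proof -
  define m where "m = max 0 (t - e)"
  have m: "0 \<le> m" "m \<le> t" using assms by (auto simp: m_def)
  show "0 \<le> cutoff e t" using assms by (simp add: cutoff_def)
  have "m\<^sup>2 \<le> t * t" using m by (simp add: power2_eq_square mult_mono)
  then show "cutoff e t \<le> t" using assms by (simp add: cutoff_def m_def[symmetric] divide_simps)
  have "m * m \<le> 2 * m * t" using m mult_left_mono[of m t m] mult_nonneg_nonneg[of m t] by linarith
  then show "0 \<le> cutoff' e t" by (simp add: cutoff'_def m_def[symmetric] power2_eq_square)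
  have "0 \<le> (t - m)\<^sup>2" by simp
  then have "2 * m * t - m\<^sup>2 \<le> t\<^sup>2" by (simp add: power2_eq_square algebra_simps)
  then show "cutoff' e t \<le> 1" using assms by (simp add: cutoff'_def m_def[symmetric])
  show "t \<le> e \<Longrightarrow> cutoff e t = 0" by (simp add: cutoff_def)
qed

lemma cutoff_tendsto:
  assumes "t > 0" "h \<longlonglongrightarrow> 0"
  shows "(\<lambda>m. cutoff (h m) t) \<longlonglongrightarrow> t" "(\<lambda>m. cutoff' (h m) t) \<longlonglongrightarrow> 1"
proof -
  have m: "(\<lambda>m. max 0 (t - h m)) \<longlonglongrightarrow> max 0 (t - 0)"
    by (intro tendsto_intros assms)
  have "(\<lambda>m. cutoff (h m) t) \<longlonglongrightarrow> (max 0 (t - 0))\<^sup>2 / t"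
    unfolding cutoff_def using assms by (intro tendsto_intros m) auto
  then show "(\<lambda>m. cutoff (h m) t) \<longlonglongrightarrow> t" using assms by (simp add: power2_eq_square)
  have "(\<lambda>m. cutoff' (h m) t) \<longlonglongrightarrow> (2 * max 0 (t - 0) * t - (max 0 (t - 0))\<^sup>2) / t\<^sup>2"
    unfolding cutoff'_def using assms by (intro tendsto_intros m) auto
  then show "(\<lambda>m. cutoff' (h m) t) \<longlonglongrightarrow> 1" using assms by (simp add: power2_eq_square)
qed

lemma C1_on_Un:
  assumes "open S" "open T" "C1_on S f" "C1_on T f" shows "C1_on (S \<union> T) f"
  using assms by (auto simp: C1_on_def intro: continuous_on_open_Un)

text \<open>No boundary regularity is needed, because \<open>f Z\<close> can be cut off where \<open>f\<close> is small.\<close>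

lemma integral_divergence_zero:
  fixes f :: "real^'n \<Rightarrow> real" and Z :: "'n \<Rightarrow> real^'n \<Rightarrow> real"
  assumes O: "open D" "bounded D"
    and f: "continuous_on (closure D) f" "\<And>y. y \<in> frontier D \<Longrightarrow> f y = 0" "\<And>y. y \<in> D \<Longrightarrow> f y > 0"
    and C1: "C1_on D f" "\<And>i. C1_on D (Z i)"
    and B: "\<And>y. y \<in> D \<Longrightarrow> \<bar>\<Sum>i\<in>UNIV. pd i f y * Z i y\<bar> \<le> B"
      "\<And>y. y \<in> D \<Longrightarrow> \<bar>f y * (\<Sum>i\<in>UNIV. pd i (Z i) y)\<bar> \<le> B"
  defines "g \<equiv> \<lambda>y. indicator D y * ((\<Sum>i\<in>UNIV. pd i f y * Z i y) + f y * (\<Sum>i\<in>UNIV. pd i (Z i) y))"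
  shows "integrable lborel g" and "integral\<^sup>L lborel g = 0"
proof -
  define a where "a y = (\<Sum>i\<in>UNIV. pd i f y * Z i y)" for y
  define b where "b y = (\<Sum>i\<in>UNIV. pd i (Z i) y)" for y
  have contf: "continuous_on D f" using C1(1) by (rule C1_on_continuous)
  have ca: "continuous_on D a" unfolding a_def
    by (intro continuous_on_sum continuous_on_mult C1_on_pd[OF C1(1)] C1_on_continuous[OF C1(2)])
  have cb: "continuous_on D b" unfolding b_def by (intro continuous_on_sum C1_on_pd[OF C1(2)])
  have meas: "(\<lambda>y. indicator D y * k y) \<in> borel_measurable borel" if "continuous_on D k" for k :: "real^'n \<Rightarrow> real"
    using borel_measurable_continuous_on_indicator[OF _ that] O(1) by simp
  have g: "g = (\<lambda>y. indicator D y * (a y + f y * b y))" by (simp add: g_def a_def b_def)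
  have mg: "g \<in> borel_measurable borel" unfolding g by (intro meas continuous_on_add continuous_on_mult ca cb contf)
  have Bn: "0 \<le> B" if "y \<in> D" for y using B(1)[OF that] by linarith
  obtain R where R: "R \<ge> 0" "\<And>y. y \<in> D \<Longrightarrow> norm y \<le> R" using O(2) by (metis bounded_iff norm_ge_zero order_trans linear)
  \<comment> \<open>This superlevel set is closed, and as \<open>f\<close> vanishes on the frontier
    it lies inside \<open>D\<close>. Off it the truncated field is zero, so the field extends by
    zero to a continuously differentiable field with bounded support on the whole space.\<close>
  define K where "K e = {y \<in> closure D. e \<le> f y}" for e
  have Kc: "closed (K e)" for e
    unfolding K_def using continuous_closed_preimage[OF f(1) closed_closure, of "{e..}"] by (auto simp: vimage_def Int_def conj_commute)
  have KD: "K e \<subseteq> D" if "e > 0" for e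
  proof
    fix y assume y: "y \<in> K e"
    then have "y \<notin> frontier D" using f(2) that by (fastforce simp: K_def)
    then show "y \<in> D" using y O(1) by (auto simp: K_def frontier_def interior_open)
  qed
  have step: "integral\<^sup>L lborel (\<lambda>y. indicator D y * (cutoff' e (f y) * a y + cutoff e (f y) * b y)) = 0"
    if e: "e > 0" for e
  proof -
    define V where "V i y = (if y \<in> D then cutoff e (f y) * Z i y else 0)" for i y
    have Cc: "C1_on D (\<lambda>y. cutoff e (f y))"
    proof (rule C1_on_compose[OF C1(1)])
      show "(cutoff e has_real_derivative cutoff' e (f y)) (at (f y))" if "y \<in> D" for y
        using has_real_derivative_cutoff[OF f(3)[OF that]] .
      show "continuous_on (f ` D) (cutoff' e)"
        unfolding cutoff'_def using f(3) by (intro continuous_intros) fastforce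
    qed
    have VD: "C1_on D (V i)" for i
      by (rule C1_on_cong[OF O(1) _ C1_on_mult[OF Cc C1(2)[of i]]]) (simp add: V_def)
    have V0: "V i y = 0" if "y \<notin> K e" for i y
    proof (cases "y \<in> D")
      case True
      then have "f y \<le> e" using that closure_subset by (fastforce simp: K_def)
      then show ?thesis using cutoff_bounds(5)[OF f(3)[OF True] e] by (simp add: V_def)
    qed (simp add: V_def)
    have VK: "C1_on (- K e) (V i)" for i
      by (rule C1_on_cong[of _ "\<lambda>_. 0"]) (use Kc V0 in auto)
    have VU: "C1_on UNIV (V i)" for i
    proof -
      have "D \<union> - K e = UNIV" using KD[OF e] by auto
      then show ?thesis using C1_on_Un[OF O(1) _ VD VK] Kc[of e] by (metis open_Compl)
    qed
    have Vr: "V i y = 0" if "norm y > R" for i y using R(2)[of y] that by (auto simp: V_def)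
    have pdV: "(\<Sum>i\<in>UNIV. pd i (V i) y) = indicator D y * (cutoff' e (f y) * a y + cutoff e (f y) * b y)" for y
    proof (cases "y \<in> D")
      case True
      have "pd i (V i) y = cutoff' e (f y) * pd i f y * Z i y + cutoff e (f y) * pd i (Z i) y" for i
      proof -
        have "pd i (V i) y = pd i (\<lambda>y. cutoff e (f y) * Z i y) y"
          by (rule pd_transform[OF O(1) True _ C1_onD[OF VD True]]) (simp add: V_def)
        also have "\<dots> = pd i (\<lambda>y. cutoff e (f y)) y * Z i y + cutoff e (f y) * pd i (Z i) y"
          by (rule pd_mult[OF C1_onD[OF Cc True] C1_onD[OF C1(2) True]])
        finally show ?thesis
          using pd_compose(2)[OF C1_onD[OF C1(1) True] has_real_derivative_cutoff[OF f(3)[OF True]]] by simp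
      qed
      then show ?thesis using True by (simp add: a_def b_def sum.distrib sum_distrib_left mult_ac)
    next
      case False
      have "pd i (V i) y = pd i (\<lambda>_. 0) y" for i
        by (rule pd_transform[of "- K e"]) (use Kc KD[OF e] False V0 C1_onD[OF VU] in auto)
      then show ?thesis using False by simp
    qed
    have "integral\<^sup>L lborel (\<lambda>y. \<Sum>i\<in>UNIV. pd i (V i) y) = (\<Sum>i\<in>UNIV. integral\<^sup>L lborel (pd i (V i)))"
      by (rule Bochner_Integration.integral_sum) (rule integral_pd_compact_support(1)[OF VU Vr R(1)])
    also have "\<dots> = 0" using integral_pd_compact_support(2)[OF VU Vr R(1)] by simp
    finally show ?thesis by (simp add: pdV)
  qed
  define h where "h m = inverse (real (Suc m))" for m :: nat
  have h: "h m > 0" for m by (auto simp: h_def)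
  have h0: "h \<longlonglongrightarrow> 0" unfolding h_def by (rule LIMSEQ_inverse_real_of_nat)
  have gb: "\<bar>g y\<bar> \<le> 2 * \<bar>B\<bar>" for y
  proof (cases "y \<in> D")
    case True
    then show ?thesis using B[OF True] unfolding g a_def b_def by simp
  qed (simp add: g)
  show "integrable lborel g" by (rule integrable_bounded_support[OF mg gb O(2)]) (simp add: g)
  have "(\<lambda>m. integral\<^sup>L lborel (\<lambda>y. indicator D y * (cutoff' (h m) (f y) * a y + cutoff (h m) (f y) * b y))) \<longlonglongrightarrow> integral\<^sup>L lborel g"
  proof (rule integral_dominated_convergence)
    show "g \<in> borel_measurable lborel" using mg by simp
    show "(\<lambda>y. indicator D y * (cutoff' (h m) (f y) * a y + cutoff (h m) (f y) * b y)) \<in> borel_measurable lborel" for m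
    proof -
      have "continuous_on D (\<lambda>y. cutoff' (h m) (f y) * a y + cutoff (h m) (f y) * b y)"
        unfolding cutoff_def cutoff'_def using f(3) by (intro continuous_intros ca cb contf) fastforce+
      then show ?thesis using meas by simp
    qed
    show "integrable lborel (\<lambda>y. 2 * \<bar>B\<bar> * indicator D y)"
      using emeasure_bounded_finite[OF O(2)] O(1) by (intro integrable_mult_right integrable_real_indicator) auto
    show "AE y in lborel. (\<lambda>m. indicator D y * (cutoff' (h m) (f y) * a y + cutoff (h m) (f y) * b y)) \<longlonglongrightarrow> g y"
    proof (intro AE_I2)
      fix y
      show "(\<lambda>m. indicator D y * (cutoff' (h m) (f y) * a y + cutoff (h m) (f y) * b y)) \<longlonglongrightarrow> g y"
      proof (cases "y \<in> D")
        case True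
        have "(\<lambda>m. indicator D y * (cutoff' (h m) (f y) * a y + cutoff (h m) (f y) * b y)) \<longlonglongrightarrow>
            indicator D y * (1 * a y + f y * b y)"
          by (intro tendsto_intros cutoff_tendsto f(3)[OF True] h0)
        then show ?thesis by (simp add: g)
      qed (simp add: g)
    qed
    show "AE y in lborel. norm (indicator D y * (cutoff' (h m) (f y) * a y + cutoff (h m) (f y) * b y)) \<le> 2 * \<bar>B\<bar> * indicator D y" for m
    proof (intro AE_I2)
      fix y
      show "norm (indicator D y * (cutoff' (h m) (f y) * a y + cutoff (h m) (f y) * b y)) \<le> 2 * \<bar>B\<bar> * indicator D y"
      proof (cases "y \<in> D")
        case True
        note cb = cutoff_bounds[OF f(3)[OF True] h[of m]]
        have "\<bar>cutoff' (h m) (f y) * a y\<bar> \<le> 1 * B"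
          unfolding abs_mult using cb B(1)[OF True] by (intro mult_mono) (auto simp: a_def)
        \<comment> \<open>Because \<open>cutoff e t \<le> t\<close>, the bound on the product of
          \<open>f\<close> with the divergence of \<open>Z\<close> is all that the domination
          requires of that divergence.\<close>
        moreover have "\<bar>cutoff (h m) (f y) * b y\<bar> \<le> \<bar>f y * b y\<bar>"
          unfolding abs_mult using cb f(3)[OF True] by (intro mult_right_mono) auto
        ultimately show ?thesis using True B(2)[OF True] by (simp add: b_def)
      qed simp
    qed
  qed
  then have "(\<lambda>m::nat. 0::real) \<longlonglongrightarrow> integral\<^sup>L lborel g" by (simp only: step[OF h])
  from LIMSEQ_unique[OF this tendsto_const] show "integral\<^sup>L lborel g = 0" .
qed

lemma nonneg_integral_zero_imp_zero:
  fixes g :: "real^'n \<Rightarrow> real"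
  assumes "open D" "continuous_on D g" "\<And>y. y \<in> D \<Longrightarrow> g y \<ge> 0"
    and int: "integrable lborel (\<lambda>y. indicator D y * g y)" "integral\<^sup>L lborel (\<lambda>y. indicator D y * g y) = 0" and "y \<in> D"
  shows "g y = 0"
proof (rule ccontr)
  assume "g y \<noteq> 0"
  define T where "T = D \<inter> g -` {0<..}"
  have "open T" unfolding T_def by (rule continuous_open_preimage[OF assms(2,1)]) auto
  moreover have "y \<in> T" using \<open>g y \<noteq> 0\<close> assms(3)[OF assms(6)] assms(6) by (auto simp: T_def)
  ultimately have nn: "\<not> negligible T" by (intro open_not_negligible) auto
  have "AE y in lborel. 0 \<le> indicator D y * g y" using assms(3) by (intro AE_I2) (auto simp: indicator_def)
  then have "AE y in lborel. indicator D y * g y = 0"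
    using integral_nonneg_eq_0_iff_AE[OF int(1)] int(2) by simp
  then have "AE y in lborel. y \<notin> T" by eventually_elim (auto simp: T_def)
  then have "T \<in> null_sets lborel" using \<open>open T\<close> by (intro iffD2[OF AE_iff_null_sets]) auto
  then show False using nn by (auto simp: negligible_iff_null_sets intro: null_sets_completionI)
qed

section \<open>Spacelike graphs\<close>

definition grad :: "(real^'n::finite \<Rightarrow> real) \<Rightarrow> real^'n \<Rightarrow> real^'n" where
  "grad u y = (\<chi> i. pd i u y)"

definition hess :: "(real^'n::finite \<Rightarrow> real) \<Rightarrow> real^'n \<Rightarrow> real^'n^'n" where
  "hess u y = (\<chi> i j. pd j (pd i u) y)"

text \<open>For a graph with gradient \<open>p\<close> the future unit normal is \<open>(W, w)\<close> with \<open>w = 1 / \<surd>(1 - |p|\<^sup>2)\<close>,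
  \<open>W = w p\<close>, and the shape operator in graph coordinates is the Jacobian matrix of \<open>W\<close>.\<close>

definition lapse :: "(real^'n::finite \<Rightarrow> real) \<Rightarrow> real^'n \<Rightarrow> real" where
  "lapse u y = 1 / sqrt (1 - grad u y \<bullet> grad u y)"

definition tilt :: "(real^'n::finite \<Rightarrow> real) \<Rightarrow> real^'n \<Rightarrow> real^'n" where
  "tilt u y = lapse u y *\<^sub>R grad u y"

definition shape :: "(real^'n::finite \<Rightarrow> real) \<Rightarrow> real^'n \<Rightarrow> real^'n^'n" where
  "shape u y = (\<chi> i j. pd j (\<lambda>y. tilt u y $ i) y)"

definition outer :: "real^'n \<Rightarrow> real^'n^'n" where
  "outer v = (\<chi> i j. v $ i * v $ j)"

lemma outer_mult_outer: "outer v ** outer v = (v \<bullet> v) *\<^sub>R outer v"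
  by (simp add: outer_def matrix_matrix_mult_def vec_eq_iff inner_vec_def sum_distrib_left mult_ac)

lemma outer_mult_vector: "outer v *v x = (v \<bullet> x) *\<^sub>R v"
  by (simp add: outer_def matrix_vector_mult_def vec_eq_iff inner_vec_def sum_distrib_left mult_ac)

lemma outer_square_root:
  fixes v :: "real^'n"
  assumes "w\<^sup>2 = 1 + v \<bullet> v" "w > 0"
  shows "\<exists>S::real^'n^'n. invertible S \<and> S ** transpose S = mat 1 + outer v"
proof -
  \<comment> \<open>A square root is sought in the form \<open>I + c v v^T\<close>. The condition
    \<open>2 c + c^2 (w^2 - 1) = 1\<close> gives this \<open>c\<close>, and \<open>d\<close> belongs
    to the inverse \<open>I + d v v^T\<close> of that root.\<close>
  define c where "c = 1 / (1 + w)"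
  define d where "d = - 1 / (w * (1 + w))"
  have vv: "v \<bullet> v = w\<^sup>2 - 1" using assms by simp
  have prod: "(mat 1 + a *\<^sub>R outer v) ** (mat 1 + b *\<^sub>R outer v) = mat 1 + (a + b + a * b * (w\<^sup>2 - 1)) *\<^sub>R outer v" for a b
    by (simp add: matrix_add_ldistrib matrix_add_rdistrib' matrix_scalar_ac scalar_matrix_assoc[symmetric]
      outer_mult_outer vv algebra_simps)
  have "c + c + c * c * (w\<^sup>2 - 1) = 1" using assms(2)
    by (simp add: c_def divide_simps power2_eq_square) (simp add: algebra_simps)
  then have 1: "(mat 1 + c *\<^sub>R outer v) ** (mat 1 + c *\<^sub>R outer v) = mat 1 + outer v" by (simp add: prod)
  have "c + d + c * d * (w\<^sup>2 - 1) = 0" using assms(2)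
    by (simp add: c_def d_def divide_simps power2_eq_square) (simp add: algebra_simps)
  then have 2: "(mat 1 + c *\<^sub>R outer v) ** (mat 1 + d *\<^sub>R outer v) = mat 1" by (simp add: prod)
  then have "invertible (mat 1 + c *\<^sub>R outer v)"
    using matrix_left_right_inverse unfolding invertible_def by blast
  moreover have "transpose (mat 1 + c *\<^sub>R outer v) = mat 1 + c *\<^sub>R outer v"
    by (simp add: transpose_def outer_def mat_def vec_eq_iff mult.commute)
  ultimately show ?thesis using 1 by (intro exI[of _ "mat 1 + c *\<^sub>R outer v"]) simp
qed

locale spacelike_graph =
  fixes D :: "(real^'n::finite) set" and u :: "real^'n \<Rightarrow> real"
  assumes openD: "open D"
    and u1: "C1_on D u" and u2: "\<And>i. C1_on D (pd i u)" and u3: "\<And>i j. C1_on D (pd j (pd i u))"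
    and slope: "\<And>y. y \<in> D \<Longrightarrow> grad u y \<bullet> grad u y < 1"
begin

lemma lapse_facts:
  assumes "y \<in> D"
  shows "lapse u y > 0" "(lapse u y)\<^sup>2 * (1 - grad u y \<bullet> grad u y) = 1"
    "(lapse u y)\<^sup>2 = 1 + tilt u y \<bullet> tilt u y"
proof -
  have s: "1 - grad u y \<bullet> grad u y > 0" using slope[OF assms] by simp
  then show "lapse u y > 0" by (simp add: lapse_def)
  show 2: "(lapse u y)\<^sup>2 * (1 - grad u y \<bullet> grad u y) = 1" using s by (simp add: lapse_def power_divide)
  then show "(lapse u y)\<^sup>2 = 1 + tilt u y \<bullet> tilt u y" by (simp add: tilt_def power2_eq_square algebra_simps)
qed

lemma hess_symmetric: "y \<in> D \<Longrightarrow> hess u y $ i $ j = hess u y $ j $ i"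
  by (simp add: hess_def pd_commute[OF openD _ u1 u2])

lemma grad_square_C1: "C1_on D (\<lambda>y. grad u y \<bullet> grad u y)"
  unfolding grad_def inner_vec_def inner_real_def vec_lambda_beta by (intro C1_on_sum C1_on_mult u2)

lemma pd_grad_square: "y \<in> D \<Longrightarrow> pd j (\<lambda>y. grad u y \<bullet> grad u y) y = 2 * (\<Sum>i\<in>UNIV. grad u y $ i * hess u y $ i $ j)"
proof -
  assume y: "y \<in> D"
  have "pd j (\<lambda>y. \<Sum>i\<in>UNIV. pd i u y * pd i u y) y = (\<Sum>i\<in>UNIV. pd j (\<lambda>y. pd i u y * pd i u y) y)"
    by (rule pd_sum) (intro differentiable_mult C1_onD[OF u2 y])
  then show ?thesis
    by (simp add: grad_def hess_def inner_vec_def pd_mult C1_onD[OF u2 y] sum_distrib_left mult_ac)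
qed

lemma lapse_derivative:
  assumes "y \<in> D"
  shows "((\<lambda>t. 1 / sqrt (1 - t)) has_real_derivative (1 / sqrt (1 - grad u y \<bullet> grad u y)) ^ 3 / 2) (at (grad u y \<bullet> grad u y))"
proof -
  have s: "1 - grad u y \<bullet> grad u y > 0" using slope[OF assms] by simp
  then have "sqrt (1 - grad u y \<bullet> grad u y) ^ 2 = 1 - grad u y \<bullet> grad u y" by simp
  then show ?thesis using s
    by (auto intro!: derivative_eq_intros simp: field_simps power3_eq_cube power2_eq_square)
qed

lemma lapse_C1: "C1_on D (lapse u)"
proof -
  have "C1_on D (\<lambda>y. 1 / sqrt (1 - grad u y \<bullet> grad u y))"
  proof (rule C1_on_compose[OF grad_square_C1 lapse_derivative])
    have "sqrt (1 - t) \<noteq> 0" if "t \<in> (\<lambda>y. grad u y \<bullet> grad u y) ` D" for t using that slope by fastforce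
    then show "continuous_on ((\<lambda>y. grad u y \<bullet> grad u y) ` D) (\<lambda>t. (1 / sqrt (1 - t)) ^ 3 / 2)"
      by (intro continuous_intros) auto
  qed
  then show ?thesis by (simp add: lapse_def[abs_def])
qed

lemma pd_lapse_hess: "y \<in> D \<Longrightarrow> pd j (lapse u) y = lapse u y ^ 3 * (\<Sum>i\<in>UNIV. grad u y $ i * hess u y $ i $ j)"
  using pd_compose(2)[OF C1_onD[OF grad_square_C1] lapse_derivative, of y j] pd_grad_square[of y j]
  by (simp add: lapse_def[abs_def])

lemma tilt_C1: "C1_on D (\<lambda>y. tilt u y $ i)"
  unfolding tilt_def grad_def by (simp, intro C1_on_mult lapse_C1 u2)

lemma shape_nth: "y \<in> D \<Longrightarrow> shape u y $ i $ j = lapse u y * hess u y $ i $ j +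
    tilt u y $ i * (lapse u y)\<^sup>2 * (\<Sum>l\<in>UNIV. grad u y $ l * hess u y $ l $ j)"
proof -
  assume y: "y \<in> D"
  have "shape u y $ i $ j = pd j (\<lambda>y. lapse u y * pd i u y) y" by (simp add: shape_def tilt_def grad_def)
  also have "\<dots> = pd j (lapse u) y * pd i u y + lapse u y * pd j (pd i u) y"
    by (rule pd_mult[OF C1_onD[OF lapse_C1 y] C1_onD[OF u2 y]])
  finally show ?thesis unfolding pd_lapse_hess[OF y]
    by (simp add: tilt_def grad_def hess_def power3_eq_cube power2_eq_square mult_ac)
qed

lemma shape_C1: "C1_on D (\<lambda>y. shape u y $ i $ j)"
proof -
  have "C1_on D (\<lambda>y. lapse u y * pd j (pd i u) y +
    tilt u y $ i * (lapse u y * lapse u y) * (\<Sum>l\<in>UNIV. pd l u y * pd j (pd l u) y))"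
    by (intro C1_on_add C1_on_mult C1_on_sum lapse_C1 u2 u3 tilt_C1)
  then show ?thesis
    by (rule C1_on_cong[OF openD, rotated]) (simp add: shape_nth hess_def grad_def power2_eq_square)
qed

lemma tilt_pd_C1: "C1_on D (pd j (\<lambda>y. tilt u y $ i))"
  using shape_C1[of i j] by (simp add: shape_def)

text \<open>Row \<open>m\<close> of the shape matrix is the gradient of the component
  \<open>tilt u y $ m\<close>, so the closedness required by Piola's identity is the symmetry of
  second derivatives.\<close>

lemma shape_closed: "y \<in> D \<Longrightarrow> pd i (\<lambda>y. shape u y $ m $ l) y = pd l (\<lambda>y. shape u y $ m $ i) y"
  using pd_commute[OF openD _ tilt_C1 tilt_pd_C1] by (simp add: shape_def)

lemma shape_eq: "y \<in> D \<Longrightarrow> shape u y = (mat 1 + outer (tilt u y)) ** (lapse u y *\<^sub>R hess u y)"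
proof -
  assume y: "y \<in> D"
  have "((mat 1 + outer (tilt u y)) ** (lapse u y *\<^sub>R hess u y)) $ i $ j = shape u y $ i $ j" for i j
  proof -
    have "(outer (tilt u y) ** (lapse u y *\<^sub>R hess u y)) $ i $ j =
      tilt u y $ i * (lapse u y)\<^sup>2 * (\<Sum>l\<in>UNIV. grad u y $ l * hess u y $ l $ j)"
      by (simp add: matrix_matrix_mult_def outer_def sum_distrib_left)
         (simp add: tilt_def power2_eq_square mult_ac)
    then show ?thesis using shape_nth[OF y] by (simp add: matrix_add_rdistrib')
  qed
  then show ?thesis by (simp add: vec_eq_iff)
qed

lemma shape_diagonalizable:
  assumes "y \<in> D"
  obtains K :: "real^'n^'n" and l where "invertible K" "shape u y ** K = K ** diag l"
    "mat 1 + outer (tilt u y) = K ** transpose K" "transpose K ** (lapse u y *\<^sub>R hess u y) ** K = diag l"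
proof -
  obtain S :: "real^'n^'n" where S: "invertible S" "S ** transpose S = mat 1 + outer (tilt u y)"
    using outer_square_root[OF lapse_facts(3)[OF assms] lapse_facts(1)[OF assms]] by blast
  have "transpose (lapse u y *\<^sub>R hess u y) = lapse u y *\<^sub>R hess u y"
    by (simp add: transpose_def vec_eq_iff hess_symmetric[OF assms])
  from product_symmetric_diagonalizable[OF S(1) this] show ?thesis
    unfolding S(2) shape_eq[OF assms, symmetric] using that by auto
qed

text \<open>This is the derivative of \<open>w^2 = 1 + W \<bullet> W\<close>: it reads
  \<open>w Dw = A^T W\<close>, and \<open>W = w Du\<close>.\<close>

lemma pd_lapse:
  assumes y: "y \<in> D"
  shows "pd j (lapse u) y = (transpose (shape u y) *v grad u y) $ j"
proof -
  define w s where "w = lapse u y" and "s = (\<Sum>l\<in>UNIV. grad u y $ l * hess u y $ l $ j)"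
  have "(transpose (shape u y) *v grad u y) $ j = (\<Sum>i\<in>UNIV. shape u y $ i $ j * grad u y $ i)"
    by (simp add: matrix_vector_mult_def transpose_def del: transpose_matrix_vector)
  also have "\<dots> = (\<Sum>i\<in>UNIV. w * (grad u y $ i * hess u y $ i $ j) + (grad u y $ i * grad u y $ i) * (w ^ 3 * s))"
    by (intro sum.cong refl)
      (simp add: shape_nth[OF y] w_def s_def tilt_def power2_eq_square power3_eq_cube algebra_simps)
  also have "\<dots> = w * s + (grad u y \<bullet> grad u y) * (w ^ 3 * s)"
    by (simp only: sum.distrib sum_distrib_left[symmetric] sum_distrib_right[symmetric] s_def inner_vec_def inner_real_def)
  also have "\<dots> = w ^ 3 * s"
  proof -
    have "w\<^sup>2 * (grad u y \<bullet> grad u y) = w\<^sup>2 - 1" using lapse_facts(2)[OF y] by (simp add: w_def algebra_simps)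
    then have "(grad u y \<bullet> grad u y) * (w ^ 3 * s) = (w\<^sup>2 - 1) * (w * s)"
      by (metis (no_types, lifting) mult.assoc mult.commute mult.left_commute power2_eq_square power3_eq_cube)
    then show ?thesis by (simp add: power3_eq_cube power2_eq_square algebra_simps)
  qed
  finally show ?thesis using pd_lapse_hess[OF y] by (simp add: w_def s_def)
qed

end

section \<open>The overdetermined problem\<close>

definition bdd_on :: "'a set \<Rightarrow> ('a \<Rightarrow> real) \<Rightarrow> bool" where
  "bdd_on D f \<longleftrightarrow> (\<exists>B. \<forall>y\<in>D. \<bar>f y\<bar> \<le> B)"

lemma bdd_on_const [intro, simp]: "bdd_on D (\<lambda>y. c)"
  by (auto simp: bdd_on_def)

lemma bdd_on_add [intro]:
  assumes "bdd_on D f" "bdd_on D g" shows "bdd_on D (\<lambda>y. f y + g y)"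
proof -
  obtain A B where "\<forall>y\<in>D. \<bar>f y\<bar> \<le> A" "\<forall>y\<in>D. \<bar>g y\<bar> \<le> B" using assms by (auto simp: bdd_on_def)
  then have "\<forall>y\<in>D. \<bar>f y + g y\<bar> \<le> A + B" by (auto intro!: order_trans[OF abs_triangle_ineq] add_mono)
  then show ?thesis by (auto simp: bdd_on_def)
qed

lemma bdd_on_mult [intro]:
  assumes "bdd_on D f" "bdd_on D g" shows "bdd_on D (\<lambda>y. f y * g y)"
proof -
  obtain A B where "\<forall>y\<in>D. \<bar>f y\<bar> \<le> A" "\<forall>y\<in>D. \<bar>g y\<bar> \<le> B" using assms by (auto simp: bdd_on_def)
  then have "\<forall>y\<in>D. \<bar>f y * g y\<bar> \<le> A * B" by (auto simp: abs_mult intro!: mult_mono intro: order_trans[OF abs_ge_zero])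
  then show ?thesis by (auto simp: bdd_on_def)
qed

lemma bdd_on_diff [intro]: "bdd_on D f \<Longrightarrow> bdd_on D g \<Longrightarrow> bdd_on D (\<lambda>y. f y - g y)"
  using bdd_on_add[of D f "\<lambda>y. -1 * g y"] bdd_on_mult[of D "\<lambda>y. -1" g] by simp

lemma bdd_on_sum [intro]: "(\<And>k. bdd_on D (f k)) \<Longrightarrow> bdd_on D (\<lambda>y. \<Sum>k\<in>A. f k y)"
  by (induction A rule: infinite_finite_induct) auto

lemma bdd_on_cong: "(\<And>y. y \<in> D \<Longrightarrow> f y = g y) \<Longrightarrow> bdd_on D f \<Longrightarrow> bdd_on D g"
  by (auto simp: bdd_on_def)

lemma bdd_on_continuous:
  assumes "compact C" "D \<subseteq> C" "continuous_on C f" shows "bdd_on D f"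
proof -
  have "bounded (f ` C)" using compact_continuous_image[OF assms(3,1)] by (rule compact_imp_bounded)
  then show ?thesis using assms(2) by (force simp: bdd_on_def bounded_iff)
qed

lemma bdd_on_matrix_mult:
  fixes A :: "'a \<Rightarrow> real^'n^'p" and B :: "'a \<Rightarrow> real^'q^'n"
  assumes "\<And>i j. bdd_on S (\<lambda>y. A y $ i $ j)" "\<And>i j. bdd_on S (\<lambda>y. B y $ i $ j)"
  shows "bdd_on S (\<lambda>y. (A y ** B y) $ i $ j)"
  unfolding matrix_matrix_mult_def vec_lambda_beta by (intro bdd_on_sum bdd_on_mult assms)

lemma bdd_on_newton_tensor:
  fixes A :: "'a \<Rightarrow> real^'n^'n"
  assumes "\<And>i j. bdd_on S (\<lambda>y. A y $ i $ j)"
  shows "bdd_on S (\<lambda>y. newton_tensor k (A y) $ i $ j)"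
proof (induction k arbitrary: i j)
  case (Suc k)
  have "bdd_on S (\<lambda>y. trace (newton_tensor k (A y) ** A y))"
    unfolding trace_def by (intro bdd_on_sum bdd_on_matrix_mult assms Suc)
  then have "bdd_on S (\<lambda>y. trace (newton_tensor k (A y) ** A y) * (1 / real (Suc k)) * mat 1 $ i $ j - (newton_tensor k (A y) ** A y) $ i $ j)"
    by (intro bdd_on_diff bdd_on_mult bdd_on_const bdd_on_matrix_mult assms Suc)
  then show ?case by simp
qed simp

lemma bdd_on_msigma:
  fixes A :: "'a \<Rightarrow> real^'n^'n"
  assumes "\<And>i j. bdd_on S (\<lambda>y. A y $ i $ j)"
  shows "bdd_on S (\<lambda>y. msigma k (A y))"
proof (cases k)
  case (Suc k')
  have "bdd_on S (\<lambda>y. trace (newton_tensor k' (A y) ** A y) * (1 / real (Suc k')))"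
    unfolding trace_def by (intro bdd_on_sum bdd_on_mult bdd_on_const bdd_on_matrix_mult bdd_on_newton_tensor assms)
  then show ?thesis by (simp add: Suc msigma_def)
qed simp

lemma bdd_on_matrix_vector:
  fixes A :: "'a \<Rightarrow> real^'n^'p"
  assumes "\<And>i j. bdd_on S (\<lambda>y. A y $ i $ j)" "\<And>j. bdd_on S (\<lambda>y. v y $ j)"
  shows "bdd_on S (\<lambda>y. (A y *v v y) $ i)"
  unfolding matrix_vector_mult_def vec_lambda_beta by (intro bdd_on_sum bdd_on_mult assms)

lemma C1_on_matrix_vector:
  fixes A :: "real^'m::finite \<Rightarrow> real^'n^'p"
  assumes "\<And>i j. C1_on S (\<lambda>y. A y $ i $ j)" "\<And>j. C1_on S (\<lambda>y. v y $ j)"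
  shows "C1_on S (\<lambda>y. (A y *v v y) $ i)"
  unfolding matrix_vector_mult_def vec_lambda_beta by (intro C1_on_sum C1_on_mult assms)

lemma second_derivative_min:
  fixes \<phi> :: "real \<Rightarrow> real"
  assumes "e > 0" and d: "\<And>t. \<bar>t\<bar> < e \<Longrightarrow> (\<phi> has_real_derivative \<phi>' t) (at t)"
    and d2: "(\<phi>' has_real_derivative c) (at 0)" and min: "\<And>t. \<bar>t\<bar> < e \<Longrightarrow> \<phi> 0 \<le> \<phi> t"
  shows "\<phi>' 0 = 0" "c \<ge> 0"
proof -
  show z: "\<phi>' 0 = 0"
    by (rule DERIV_local_min[OF d[of 0] assms(1)]) (use assms(1) min in auto)
  show "c \<ge> 0"
  proof (rule ccontr)
    assume "\<not> ?thesis"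
    then obtain r where r: "r > 0" "\<And>h. 0 < h \<Longrightarrow> h < r \<Longrightarrow> \<phi>' (0 + h) < \<phi>' 0"
      using DERIV_neg_dec_right[OF d2] by auto
    define t where "t = min r e / 2"
    have t: "0 < t" "t < r" "t < e" using r assms(1) by (auto simp: t_def)
    obtain s where s: "0 < s" "s < t" "\<phi> t - \<phi> 0 = (t - 0) * \<phi>' s"
      using MVT2[OF t(1) d] t by auto
    have "\<phi>' s < 0" using r(2)[of s] s t z by simp
    then have "\<phi> t - \<phi> 0 < 0" using s t by (simp add: mult_less_0_iff)
    then show False using min[of t] t by simp
  qed
qed

lemma has_real_derivative_direction:
  assumes "f differentiable (at (p + t *\<^sub>R x))"
  shows "((\<lambda>t. f (p + t *\<^sub>R x)) has_real_derivative (\<Sum>i\<in>UNIV. pd i f (p + t *\<^sub>R x) * x $ i)) (at t)"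
proof -
  have "((\<lambda>t. p + t *\<^sub>R x) has_derivative (\<lambda>h. h *\<^sub>R x)) (at t)"
    by (auto intro!: derivative_eq_intros)
  from has_derivative_compose[OF this has_derivative_pd[OF assms]]
  show ?thesis unfolding has_field_derivative_def
    by (rule has_derivative_eq_rhs) (auto simp: fun_eq_iff sum_distrib_right intro!: sum.cong)
qed

lemma pd_zero_locally_constant:
  assumes "open S" "connected S" "\<And>y. y \<in> S \<Longrightarrow> f differentiable (at y)" "\<And>i y. y \<in> S \<Longrightarrow> pd i f y = 0"
    "x \<in> S" "y \<in> S"
  shows "f x = f y"
proof -
  have "(f has_derivative (\<lambda>h. 0)) (at y)" if "y \<in> S" for y
    using has_derivative_pd[OF assms(3)[OF that]] by (simp add: assms(4)[OF that])
  then show ?thesis by (rule has_derivative_zero_unique_connected[OF assms(1,2) _ assms(5,6)])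
qed

context spacelike_graph begin

text \<open>Covers two cases: \<open>s = 1\<close> with \<open>\<epsilon> > 0\<close> is contact
  with a paraboloid from below and yields strict convexity, \<open>s = - 1\<close> with
  \<open>\<epsilon> = 0\<close> is an interior maximum of \<open>u\<close>.\<close>

lemma hess_at_extremum:
  assumes y: "y \<in> D" and min: "\<And>x. x \<in> D \<Longrightarrow> s * u y - \<epsilon> * (y \<bullet> y) \<le> s * u x - \<epsilon> * (x \<bullet> x)"
  shows "s * (grad u y \<bullet> x) = 2 * \<epsilon> * (y \<bullet> x)" "s * (x \<bullet> (hess u y *v x)) \<ge> 2 * \<epsilon> * (x \<bullet> x)"
proof -
  obtain r where r: "r > 0" "ball y r \<subseteq> D" using openD y openE by blast
  define e where "e = r / (norm x + 1)"
  have e: "e > 0" using r by (simp add: e_def add_nonneg_pos)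
  have inD: "y + t *\<^sub>R x \<in> D" if "\<bar>t\<bar> < e" for t
  proof -
    have "\<bar>t\<bar> * norm x \<le> e * norm x" using that by (intro mult_right_mono) auto
    also have "\<dots> < r" using r by (simp add: e_def divide_simps add_nonneg_pos)
    finally have "y + t *\<^sub>R x \<in> ball y r" by (simp add: dist_norm)
    then show ?thesis using r by blast
  qed
  define \<phi> where "\<phi> t = s * u (y + t *\<^sub>R x) - \<epsilon> * ((y + t *\<^sub>R x) \<bullet> (y + t *\<^sub>R x))" for t
  define \<phi>' where "\<phi>' t = s * (\<Sum>i\<in>UNIV. pd i u (y + t *\<^sub>R x) * x $ i) - \<epsilon> * (2 * (y \<bullet> x) + 2 * t * (x \<bullet> x))" for t
  have sq: "(y + t *\<^sub>R x) \<bullet> (y + t *\<^sub>R x) = y \<bullet> y + 2 * t * (y \<bullet> x) + t\<^sup>2 * (x \<bullet> x)" for t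
    by (simp add: inner_add_left inner_add_right inner_commute[of x y] power2_eq_square algebra_simps)
  have d: "(\<phi> has_real_derivative \<phi>' t) (at t)" if "\<bar>t\<bar> < e" for t
    unfolding \<phi>_def \<phi>'_def sq
    by (rule derivative_eq_intros has_real_derivative_direction C1_onD[OF u1] inD that refl)+
       (simp add: power2_eq_square algebra_simps)
  have d2: "(\<phi>' has_real_derivative s * (\<Sum>i\<in>UNIV. (\<Sum>j\<in>UNIV. pd j (pd i u) (y + 0 *\<^sub>R x) * x $ j) * x $ i) - \<epsilon> * (2 * (x \<bullet> x))) (at 0)"
    unfolding \<phi>'_def using e
    by (intro DERIV_diff DERIV_cmult DERIV_sum DERIV_cmult_right has_real_derivative_direction C1_onD[OF u2] inD)
       (auto intro!: derivative_eq_intros)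
  have m: "\<phi> 0 \<le> \<phi> t" if "\<bar>t\<bar> < e" for t unfolding \<phi>_def using min[OF inD[OF that]] by simp
  note R = second_derivative_min[OF e d d2 m]
  show "s * (grad u y \<bullet> x) = 2 * \<epsilon> * (y \<bullet> x)"
    using R(1) by (simp add: \<phi>'_def grad_def inner_vec_def)
  have "x \<bullet> (hess u y *v x) = (\<Sum>i\<in>UNIV. (\<Sum>j\<in>UNIV. pd j (pd i u) (y + 0 *\<^sub>R x) * x $ j) * x $ i)"
    by (simp add: inner_vec_def matrix_vector_mult_def hess_def mult.commute)
  then show "s * (x \<bullet> (hess u y *v x)) \<ge> 2 * \<epsilon> * (x \<bullet> x)" using R(2) by simp
qed

end

text \<open>\<open>lapse u\<close> is read off from derivatives, which describe the graph only
  inside \<open>D\<close>; \<open>\<omega>\<close> is its continuous extension to the closure, where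
  the boundary condition can be stated.\<close>

locale overdetermined_graph = spacelike_graph +
  fixes \<omega> :: "real^'n \<Rightarrow> real" and w0 sk :: real and k :: nat
  assumes bdD: "bounded D" and connD: "connected D"
    and ucont: "continuous_on (closure D) u" and u0: "\<And>y. y \<in> frontier D \<Longrightarrow> u y = 0"
    and wcont: "continuous_on (closure D) \<omega>" and w_lapse: "\<And>y. y \<in> D \<Longrightarrow> \<omega> y = lapse u y"
    and w0: "\<And>y. y \<in> frontier D \<Longrightarrow> \<omega> y = w0"
    and hess_bdd: "\<And>i j. bdd_on D (\<lambda>y. hess u y $ i $ j)"
    and k: "1 \<le> k" "k \<le> CARD('n)"
    and sk: "\<And>y. y \<in> D \<Longrightarrow> msigma k (shape u y) = sk"
    and neg: "\<exists>y\<in>D. u y < 0"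
begin

section \<open>The elliptic point and positivity in the Garding cone\<close>

lemma compact_closureD: "compact (closure D)"
  using bdD by (simp add: compact_closure)

lemma closure_cases: "y \<in> closure D \<Longrightarrow> y \<in> D \<or> y \<in> frontier D"
  using openD by (simp add: frontier_def interior_open)

text \<open>The graph is touched from below by a translate of the paraboloid
  \<open>\<epsilon> |y|^2\<close>. At the contact point the Hessian is positive definite, and so the
  eigenvalues of the shape matrix, which is congruent to it up to the factor \<open>w\<close> after
  diagonalization, are positive.\<close>

lemma elliptic_point: "\<exists>y\<in>D. \<forall>j. j \<le> CARD('n) \<longrightarrow> msigma j (shape u y) > 0"
proof -
  obtain y1 where y1: "y1 \<in> D" "u y1 < 0" using neg by blast
  obtain b where b: "\<And>y. y \<in> closure D \<Longrightarrow> norm y \<le> b"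
    using compact_imp_bounded[OF compact_closureD] by (auto simp: bounded_iff)
  \<comment> \<open>On the closure \<open>\<epsilon> |y|^2\<close> is at most
    \<open>- u y1 / 2\<close>, so a minimum on the frontier, where \<open>u = 0\<close>, would lie
    above the value at \<open>y1\<close>. The summand \<open>1\<close> excludes a zero
    denominator.\<close>
  define \<epsilon> where "\<epsilon> = - u y1 / (2 * (b\<^sup>2 + 1))"
  have bp: "b\<^sup>2 + 1 > 0" by (simp add: add_nonneg_pos)
  have \<epsilon>: "\<epsilon> > 0" unfolding \<epsilon>_def using y1 bp by (intro divide_pos_pos) auto
  have "continuous_on (closure D) (\<lambda>y. u y - \<epsilon> * (y \<bullet> y))" by (intro continuous_intros ucont)
  then obtain y where y: "y \<in> closure D" "\<And>x. x \<in> closure D \<Longrightarrow> u y - \<epsilon> * (y \<bullet> y) \<le> u x - \<epsilon> * (x \<bullet> x)"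
    using continuous_attains_inf[OF compact_closureD] y1 closure_subset by (metis (no_types, lifting) empty_iff subsetD)
  have "y \<in> D"
  proof (rule ccontr)
    assume "y \<notin> D"
    then have "u y = 0" using closure_cases[OF y(1)] u0 by blast
    then have "- \<epsilon> * (y \<bullet> y) \<le> u y1 - \<epsilon> * (y1 \<bullet> y1)" using y(2)[of y1] y1 closure_subset by auto
    also have "\<dots> \<le> u y1" using \<epsilon> by simp
    finally have "- u y1 \<le> \<epsilon> * (y \<bullet> y)" by simp
    also have "\<dots> \<le> \<epsilon> * b\<^sup>2" using \<epsilon> b[OF y(1)] by (intro mult_left_mono) (auto simp: dot_square_norm intro: power_mono)
    also have "\<dots> \<le> \<epsilon> * (b\<^sup>2 + 1)" using \<epsilon> by simp
    also have "\<dots> = - u y1 / 2"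
    proof -
      have "x / (2 * c) * c = x / 2" if "c > 0" for x c :: real using that by simp
      from this[OF bp] show ?thesis unfolding \<epsilon>_def .
    qed
    finally show False using y1 by simp
  qed
  have H: "x \<bullet> (hess u y *v x) \<ge> 2 * \<epsilon> * (x \<bullet> x)" for x
    using hess_at_extremum(2)[OF \<open>y \<in> D\<close>, of 1 \<epsilon> x] y(2) closure_subset by auto
  obtain K :: "real^'n^'n" and l where K: "invertible K" "shape u y ** K = K ** diag l"
    "transpose K ** (lapse u y *\<^sub>R hess u y) ** K = diag l" using shape_diagonalizable[OF \<open>y \<in> D\<close>] by metis
  have lpos: "l $ i > 0" for i
  proof -
    define x where "x = K *v axis i 1"
    have xn: "x \<noteq> 0"
    proof
      assume "x = 0"
      then have "axis i (1::real) = 0" using K(1) unfolding x_def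
        by (metis invertible_def matrix_vector_mul_assoc matrix_vector_mul_lid matrix_vector_mult_0_right)
      then show False by (simp add: axis_eq_0_iff)
    qed
    have "l $ i = axis i 1 \<bullet> (diag l *v axis i 1)"
      by (simp add: inner_axis' matrix_vector_mult_basis column_def diag_def)
    also have "\<dots> = axis i 1 \<bullet> (transpose K *v ((lapse u y *\<^sub>R hess u y) *v x))"
      unfolding K(3)[symmetric] x_def by (simp only: matrix_vector_mul_assoc matrix_mul_assoc)
    also have "\<dots> = x \<bullet> ((lapse u y *\<^sub>R hess u y) *v x)"
      unfolding x_def by (metis dot_lmul_matrix inner_commute transpose_matrix_vector)
    also have "\<dots> = lapse u y * (x \<bullet> (hess u y *v x))"
      by (simp add: scaleR_matrix_vector_assoc[symmetric])
    also have "\<dots> > 0"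
    proof -
      have "x \<bullet> (hess u y *v x) > 0" using H[of x] \<epsilon> xn by (smt (verit) inner_gt_zero_iff mult_pos_pos)
      then show ?thesis using lapse_facts(1)[OF \<open>y \<in> D\<close>] by simp
    qed
    finally show ?thesis .
  qed
  have "msigma j (shape u y) > 0" if "j \<le> CARD('n)" for j
  proof -
    have "{S :: 'n set. card S = j} \<noteq> {}" using obtain_subset_with_card_n[OF that] by blast
    then have "esym UNIV (($) l) j > 0" unfolding esym_def using lpos by (intro sum_pos) (auto intro: prod_pos)
    then show ?thesis using msigma_diagonalized[OF K(1,2)] by simp
  qed
  then show ?thesis using \<open>y \<in> D\<close> by blast
qed

lemma sk_pos: "sk > 0"
  using elliptic_point sk k by metis

definition R :: real where "R = root k (sk / real (CARD('n) choose k))"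

lemma R_pos: "R > 0" and R_pow: "R ^ k = sk / real (CARD('n) choose k)"
proof -
  have "sk / real (CARD('n) choose k) > 0" using sk_pos k by simp
  then show "R > 0" "R ^ k = sk / real (CARD('n) choose k)" using k unfolding R_def by auto
qed

lemma emean_k:
  fixes K :: "real^'n^'n"
  assumes "y \<in> D" "invertible K" "shape u y ** K = K ** diag l"
  shows "emean UNIV (($) l) k = R ^ k"
  using sk[OF assms(1)] msigma_diagonalized[OF assms(2,3)] by (simp add: emean_def R_pow)

text \<open>The cone condition propagates from the elliptic point, since Maclaurin's inequality keeps
  \<open>\<sigma>\<^sub>j\<close> away from \<open>0\<close>.\<close>

lemma Garding_cone:
  assumes "y \<in> D" "1 \<le> j" "j \<le> k"
  shows "msigma j (shape u y) > 0"
proof -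
  define T where "T = {y \<in> D. \<forall>j\<in>{1..k}. msigma j (shape u y) > 0}"
  have cont: "continuous_on D (\<lambda>y. msigma j (shape u y))" for j
    by (rule C1_on_continuous[OF C1_on_msigma[OF shape_C1]])
  have T': "T = {y \<in> D. \<forall>j\<in>{1..k}. msigma j (shape u y) \<ge> real (CARD('n) choose j) * R ^ j}" (is "_ = ?T'")
  proof
    show "?T' \<subseteq> T"
    proof
      fix y assume y: "y \<in> ?T'"
      have "real (CARD('n) choose j) * R ^ j > 0" if "j \<in> {1..k}" for j using that k R_pos by simp
      then show "y \<in> T" using y unfolding T_def by (fastforce intro: less_le_trans)
    qed
    show "T \<subseteq> ?T'"
    proof
      fix y assume y: "y \<in> T"
      then have yD: "y \<in> D" by (simp add: T_def)
      obtain K :: "real^'n^'n" and l where K: "invertible K" "shape u y ** K = K ** diag l"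
        using shape_diagonalizable[OF yD] by metis
      have pos: "\<forall>j. 1 \<le> j \<and> j \<le> k \<longrightarrow> esym UNIV (($) l) j > 0"
        using y msigma_diagonalized[OF K] by (auto simp: T_def)
      have "msigma j (shape u y) \<ge> real (CARD('n) choose j) * R ^ j" if "j \<in> {1..k}" for j
      proof -
        have "R ^ j \<le> emean UNIV (($) l) j"
          using emean_Maclaurin[OF finite pos _ R_pos emean_k[OF yD K]] k that by simp
        then show ?thesis unfolding msigma_diagonalized[OF K] esym_emean[OF finite]
          by (intro mult_left_mono) auto
      qed
      then show "y \<in> ?T'" using yD by simp
    qed
  qed
  have "openin (top_of_set D) T"
  proof -
    have "T = (\<Inter>j\<in>{1..k}. D \<inter> (\<lambda>y. msigma j (shape u y)) -` {0<..})"
      unfolding T_def using k by auto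
    moreover have "open (D \<inter> (\<lambda>y. msigma j (shape u y)) -` {0<..})" for j
      by (rule continuous_open_preimage[OF cont openD]) auto
    ultimately have "open T" by (simp only:) (intro open_INT finite_atLeastAtMost ballI, simp)
    then show ?thesis unfolding T_def by (auto intro: openin_subset open_openin_trans[OF openD] simp: openin_open_eq openD)
  qed
  moreover have "closedin (top_of_set D) T"
  proof -
    have "T = (\<Inter>j\<in>{1..k}. D \<inter> (\<lambda>y. msigma j (shape u y)) -` {real (CARD('n) choose j) * R ^ j..})"
      unfolding T' using k by auto
    moreover have "closedin (top_of_set D) (D \<inter> (\<lambda>y. msigma j (shape u y)) -` {real (CARD('n) choose j) * R ^ j..})" for j
      by (rule continuous_closedin_preimage[OF cont]) auto
    ultimately show ?thesis using k(1) by (simp only:) (intro closedin_INT, auto)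
  qed
  moreover have "T \<noteq> {}" using elliptic_point k unfolding T_def by fastforce
  ultimately have "T = D" using connD unfolding connected_clopen by blast
  then have "y \<in> T" using assms by simp
  then show ?thesis using assms unfolding T_def by auto
qed

lemma Garding_diagonalizable:
  assumes "y \<in> D"
  obtains K :: "real^'n^'n" and l where "invertible K" "shape u y ** K = K ** diag l"
    "mat 1 + outer (tilt u y) = K ** transpose K" "\<forall>j. 1 \<le> j \<and> j \<le> k \<longrightarrow> esym UNIV (($) l) j > 0"
    "emean UNIV (($) l) k = R ^ k" "\<And>j. msigma j (shape u y) = esym UNIV (($) l) j"
proof -
  obtain K :: "real^'n^'n" and l where K: "invertible K" "shape u y ** K = K ** diag l"
    "mat 1 + outer (tilt u y) = K ** transpose K"
    using shape_diagonalizable[OF assms] by metis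
  note ms = msigma_diagonalized[OF K(1,2)]
  show ?thesis
    using that[OF K _ emean_k[OF assms K(1,2)] ms] Garding_cone[OF assms] ms by metis
qed

text \<open>Minus the divergence of \<open>flux\<close>, by \<open>divergence_flux\<close>.\<close>

definition gap :: "real^'n \<Rightarrow> real" where
  "gap y = msigma 1 (shape u y) * sk - (real k + 1) * msigma (Suc k) (shape u y) - R * real k * sk"

lemma gap_nonneg: "y \<in> D \<Longrightarrow> gap y \<ge> 0"
proof -
  assume y: "y \<in> D"
  obtain K :: "real^'n^'n" and l where K: "invertible K" "shape u y ** K = K ** diag l"
    "\<forall>j. 1 \<le> j \<and> j \<le> k \<longrightarrow> esym UNIV (($) l) j > 0" "emean UNIV (($) l) k = R ^ k"
    "\<And>j. msigma j (shape u y) = esym UNIV (($) l) j"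
    using Garding_diagonalizable[OF y] by metis
  then show ?thesis
    using esym_Garding_gap(1)[OF finite k(1) _ K(3) R_pos K(4)] k(2) sk[OF y] by (simp add: gap_def)
qed

lemma gap_zero_umbilic: "y \<in> D \<Longrightarrow> gap y = 0 \<Longrightarrow> shape u y = R *\<^sub>R mat 1"
proof -
  assume y: "y \<in> D" and g: "gap y = 0"
  obtain K :: "real^'n^'n" and l where K: "invertible K" "shape u y ** K = K ** diag l"
    "\<forall>j. 1 \<le> j \<and> j \<le> k \<longrightarrow> esym UNIV (($) l) j > 0" "emean UNIV (($) l) k = R ^ k"
    "\<And>j. msigma j (shape u y) = esym UNIV (($) l) j"
    using Garding_diagonalizable[OF y] by metis
  have "l $ i = R" for i
    using esym_Garding_gap(2)[OF finite k(1) _ K(3) R_pos K(4)] k(2) sk[OF y] g K(5) by (simp add: gap_def)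
  then have "diag l = R *\<^sub>R mat 1" by (simp add: diag_def mat_def vec_eq_iff)
  then have *: "shape u y ** K = R *\<^sub>R K" using K(2) by (simp add: matrix_scalar_ac)
  obtain L where "K ** L = mat 1" using K(1) by (auto simp: invertible_def)
  then show ?thesis using arg_cong[OF *, of "\<lambda>X. X ** L"]
    by (simp add: matrix_mul_assoc[symmetric] scalar_matrix_assoc[symmetric])
qed

text \<open>Maclaurin's inequality at index \<open>k - 1\<close>, normalised so that it compares the
  two coefficients in the integral identity of \<open>q_zero\<close>.\<close>

lemma msigma_pred_ge:
  assumes "y \<in> D"
  shows "(real CARD('n) - real (k - 1)) * msigma (k - 1) (shape u y) \<ge> real k * sk / R"
proof -
  obtain K :: "real^'n^'n" and l where K: "invertible K" "shape u y ** K = K ** diag l"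
    "\<forall>j. 1 \<le> j \<and> j \<le> k \<longrightarrow> esym UNIV (($) l) j > 0" "emean UNIV (($) l) k = R ^ k"
    "\<And>j. msigma j (shape u y) = esym UNIV (($) l) j"
    using Garding_diagonalizable[OF assms] by metis
  define c where "c = real (CARD('n) choose (k - 1))"
  have "R ^ (k - 1) \<le> emean UNIV (($) l) (k - 1)"
    using emean_Maclaurin[OF finite K(3) _ R_pos K(4)] k by simp
  then have "(real CARD('n) - real (k - 1)) * (c * R ^ (k - 1)) \<le>
      (real CARD('n) - real (k - 1)) * (c * emean UNIV (($) l) (k - 1))"
    using k by (intro mult_left_mono) (auto simp: c_def)
  moreover have "c * emean UNIV (($) l) (k - 1) = msigma (k - 1) (shape u y)"
    unfolding K(5) by (simp add: esym_emean c_def)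
  moreover have "(real CARD('n) - real (k - 1)) * c = real k * real (CARD('n) choose k)"
    using choose_Suc_mult[of "k - 1" "CARD('n)"] k by (simp add: c_def)
  moreover have "real k * real (CARD('n) choose k) * R ^ (k - 1) = real k * sk / R"
  proof -
    have "R ^ (k - 1) * R = sk / real (CARD('n) choose k)" using R_pow k by (metis power_minus_mult less_le_trans zero_less_one)
    moreover have "real (CARD('n) choose k) > 0" using k by simp
    ultimately show ?thesis using R_pos by (simp add: field_simps)
  qed
  ultimately show ?thesis by (metis mult.assoc)
qed

text \<open>In the diagonalizing basis the coefficients of the form are the symmetric functions of
  order \<open>k - 1\<close> of the eigenvalues with one removed; these are positive in the
  cone.\<close>

lemma newton_tensor_form_nonneg:
  assumes "y \<in> D"
  defines "Q \<equiv> \<lambda>x. x \<bullet> ((newton_tensor (k - 1) (shape u y) ** (mat 1 + outer (tilt u y))) *v x)"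
  shows "Q x \<ge> 0" "Q x = 0 \<Longrightarrow> x = 0"
proof -
  obtain K :: "real^'n^'n" and l where K: "invertible K" "shape u y ** K = K ** diag l"
    "mat 1 + outer (tilt u y) = K ** transpose K" "\<forall>j. 1 \<le> j \<and> j \<le> k \<longrightarrow> esym UNIV (($) l) j > 0"
    using Garding_diagonalizable[OF assms(1)] by metis
  have e: "esym (UNIV - {i}) (($) l) (k - 1) > 0" for i
    using Garding_cone_remove[OF finite UNIV_I, of "k - 1" "($) l" i] K(4) k by simp
  have Q: "Q x = (\<Sum>i\<in>UNIV. esym (UNIV - {i}) (($) l) (k - 1) * ((transpose K *v x) $ i)\<^sup>2)"
    unfolding Q_def K(3) by (rule newton_tensor_quadratic_form[OF K(1,2)])
  show "Q x \<ge> 0" unfolding Q using e by (intro sum_nonneg mult_nonneg_nonneg) (auto intro: less_imp_le)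
  assume "Q x = 0"
  then have "\<forall>i. esym (UNIV - {i}) (($) l) (k - 1) * ((transpose K *v x) $ i)\<^sup>2 = 0"
    unfolding Q using e by (subst (asm) sum_nonneg_eq_0_iff) (auto simp del: transpose_matrix_vector intro!: mult_nonneg_nonneg intro: less_imp_le)
  then have "transpose K *v x = 0" using e by (simp add: vec_eq_iff less_imp_neq[symmetric] del: transpose_matrix_vector)
  moreover have "invertible (transpose K)" using K(1) by (simp add: transpose_invertible)
  ultimately show "x = 0"
    by (metis invertible_def matrix_vector_mul_assoc matrix_vector_mul_lid matrix_vector_mult_0_right)
qed

lemma trace_shape_pos: "y \<in> D \<Longrightarrow> trace (shape u y) > 0"
  using Garding_cone[of y 1] k by (simp add: msigma_def)

text \<open>If \<open>u\<close> were nonnegative somewhere inside, its maximum over the closure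
  would be attained inside. There the gradient vanishes and the Hessian has nonpositive diagonal,
  against the positive trace of the shape matrix.\<close>

lemma u_neg: "y \<in> D \<Longrightarrow> u y < 0"
proof (rule ccontr)
  assume y: "y \<in> D" and "\<not> u y < 0"
  obtain z where z: "z \<in> closure D" "\<And>x. x \<in> closure D \<Longrightarrow> u x \<le> u z"
    using continuous_attains_sup[OF compact_closureD _ ucont] y closure_subset by (metis empty_iff subsetD)
  have "\<exists>m\<in>D. \<forall>x\<in>closure D. u x \<le> u m"
  proof (cases "z \<in> D")
    case False
    then have "u z = 0" using closure_cases[OF z(1)] u0 by blast
    then have "\<forall>x\<in>closure D. u x \<le> u y" using z \<open>\<not> u y < 0\<close> by fastforce
    then show ?thesis using y by blast
  qed (use z in blast)
  then obtain m where m: "m \<in> D" "\<And>x. x \<in> D \<Longrightarrow> u x \<le> u m" using closure_subset by blast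
  have ext: "- 1 * u m - 0 * (m \<bullet> m) \<le> - 1 * u x - 0 * (x \<bullet> x)" if "x \<in> D" for x
    using m(2)[OF that] by simp
  have g: "grad u m = 0"
    using hess_at_extremum(1)[OF m(1) ext, of "grad u m"] by simp
  have "hess u m $ i $ i \<le> 0" for i
    using hess_at_extremum(2)[OF m(1) ext, of "axis i 1"] by (simp add: inner_axis' matrix_vector_mult_basis column_def)
  then have "shape u m $ i $ i \<le> 0" for i
    using shape_nth[OF m(1), of i i] g lapse_facts(1)[OF m(1)] by (simp add: mult_le_0_iff)
  then have "trace (shape u m) \<le> 0" unfolding trace_def by (intro sum_nonpos)
  then show False using trace_shape_pos[OF m(1)] by simp
qed

end

section \<open>The P-function and the two integral identities\<close>

context overdetermined_graph begin

lemma closure_bdd: "continuous_on (closure D) f \<Longrightarrow> bdd_on D f"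
  using bdd_on_continuous[OF compact_closureD closure_subset] by blast

lemma lapse_bdd: "bdd_on D (lapse u)"
  by (rule bdd_on_cong[OF w_lapse closure_bdd[OF wcont]])

lemma u_bdd: "bdd_on D u"
  by (rule closure_bdd[OF ucont])

lemma grad_bdd: "bdd_on D (\<lambda>y. grad u y $ i)"
proof -
  have "\<bar>grad u y $ i\<bar> \<le> 1" if "y \<in> D" for y
  proof -
    have "(norm (grad u y))\<^sup>2 \<le> 1\<^sup>2" using slope[OF that] by (simp add: dot_square_norm)
    then have "norm (grad u y) \<le> 1" by (rule power2_le_imp_le) simp
    then show ?thesis using component_le_norm_cart[of "grad u y" i] by linarith
  qed
  then show ?thesis by (auto simp: bdd_on_def)
qed

lemma tilt_bdd: "bdd_on D (\<lambda>y. tilt u y $ i)"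
  unfolding tilt_def by (simp, intro bdd_on_mult lapse_bdd grad_bdd)

lemma shape_bdd: "bdd_on D (\<lambda>y. shape u y $ i $ j)"
proof -
  have "bdd_on D (\<lambda>y. lapse u y * hess u y $ i $ j +
      tilt u y $ i * (lapse u y * lapse u y) * (\<Sum>l\<in>UNIV. grad u y $ l * hess u y $ l $ j))"
    by (intro bdd_on_add bdd_on_mult bdd_on_sum lapse_bdd tilt_bdd grad_bdd hess_bdd)
  then show ?thesis by (rule bdd_on_cong[rotated]) (simp add: shape_nth power2_eq_square)
qed

lemma nth_bdd: "bdd_on D (\<lambda>y. y $ i)"
  by (rule closure_bdd) (intro continuous_intros)

lemmas bdd_intros = bdd_on_add bdd_on_diff bdd_on_mult bdd_on_sum bdd_on_const bdd_on_matrix_vector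
  bdd_on_newton_tensor bdd_on_msigma lapse_bdd u_bdd grad_bdd tilt_bdd shape_bdd nth_bdd

lemmas C1_intros = C1_on_add C1_on_diff C1_on_mult C1_on_sum C1_on_const C1_on_matrix_vector
  C1_on_newton_tensor C1_on_msigma lapse_C1 u1 tilt_C1 shape_C1 C1_on_nth

lemma divergence_newton_tensor_tilt:
  assumes "y \<in> D"
  shows "(\<Sum>i\<in>UNIV. pd i (\<lambda>y. (newton_tensor j (shape u y) *v tilt u y) $ i) y) = (real j + 1) * msigma (Suc j) (shape u y)"
proof -
  have "(\<chi> l i. pd i (\<lambda>y. tilt u y $ l) y) = shape u y" by (simp add: shape_def)
  then show ?thesis
    using divergence_newton_tensor_mult[OF assms shape_C1 tilt_C1 shape_closed[OF assms], of j]
    by (simp add: trace_newton_tensor_mult)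
qed

lemma divergence_newton_tensor_position:
  assumes "y \<in> D"
  shows "(\<Sum>i\<in>UNIV. pd i (\<lambda>y. (newton_tensor j (shape u y) *v y) $ i) y) = (real CARD('n) - real j) * msigma j (shape u y)"
proof -
  have "(\<chi> l i. pd i (\<lambda>y. y $ l) y) = (mat 1 :: real^'n^'n)" by (simp add: pd_nth mat_def vec_eq_iff eq_commute)
  then show ?thesis
    using divergence_newton_tensor_mult[OF assms shape_C1 C1_on_nth shape_closed[OF assms], of j]
    by (simp add: trace_newton_tensor)
qed

text \<open>\<open>q = \<theta> - P\<close> for the P-function \<open>P = - w + R u\<close>, whose gradient is paired with the flux
  \<open>Z = T\<^sub>k\<^sub>-\<^sub>1 (R W - A W)\<close>; the flux is written without the factor \<open>A\<close> next to \<open>W\<close>, because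
  \<open>T\<^sub>k\<^sub>-\<^sub>1 A = \<sigma>\<^sub>k - T\<^sub>k\<close>.\<close>

definition q :: "real^'n \<Rightarrow> real" where
  "q y = \<omega> y - w0 - R * u y"

definition flux :: "real^'n \<Rightarrow> real^'n" where
  "flux y = R *\<^sub>R (newton_tensor (k - 1) (shape u y) *v tilt u y) - sk *\<^sub>R tilt u y + newton_tensor k (shape u y) *v tilt u y"

definition slope_defect :: "real^'n \<Rightarrow> real^'n" where
  "slope_defect y = R *\<^sub>R grad u y - transpose (shape u y) *v grad u y"

lemma newton_tensor_pred:
  "y \<in> D \<Longrightarrow> newton_tensor k (shape u y) = sk *\<^sub>R mat 1 - newton_tensor (k - 1) (shape u y) ** shape u y"
  using newton_tensor_Suc[of "k - 1" "shape u y"] k sk[of y] by simp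

lemma q_C1: "C1_on D q"
  by (rule C1_on_cong[OF openD, of "\<lambda>y. lapse u y - w0 - R * u y"])
     (auto simp: q_def w_lapse intro!: C1_intros)

lemma pd_q: "y \<in> D \<Longrightarrow> pd i q y = - slope_defect y $ i"
proof -
  assume y: "y \<in> D"
  have "pd i q y = pd i (\<lambda>y. lapse u y - w0 - R * u y) y"
    by (rule pd_transform[OF openD y _ C1_onD[OF q_C1 y]]) (simp add: q_def w_lapse)
  also have "\<dots> = pd i (lapse u) y - R * pd i u y"
    using C1_onD[OF lapse_C1 y] C1_onD[OF u1 y] by (simp add: pd_diff pd_mult)
  finally show ?thesis unfolding pd_lapse[OF y] by (simp add: slope_defect_def grad_def del: transpose_matrix_vector)
qed

lemma flux_C1: "C1_on D (\<lambda>y. flux y $ i)"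
  unfolding flux_def by (simp, intro C1_intros)

lemma flux_bdd: "bdd_on D (\<lambda>y. flux y $ i)"
  unfolding flux_def by (simp, intro bdd_intros)

lemma divergence_flux:
  assumes y: "y \<in> D" shows "(\<Sum>i\<in>UNIV. pd i (\<lambda>y. flux y $ i) y) = - gap y"
proof -
  let ?T = "\<lambda>j y. (newton_tensor j (shape u y) *v tilt u y)"
  have C: "(\<lambda>y. ?T j y $ i) differentiable (at y)" "(\<lambda>y. tilt u y $ i) differentiable (at y)" for i j
    by (rule C1_onD[OF _ y], intro C1_intros)+
  have "pd i (\<lambda>y. flux y $ i) y = R * pd i (\<lambda>y. ?T (k - 1) y $ i) y - sk * pd i (\<lambda>y. tilt u y $ i) y + pd i (\<lambda>y. ?T k y $ i) y" for i
  proof -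
    have "pd i (\<lambda>y. flux y $ i) y = pd i (\<lambda>y. R * ?T (k - 1) y $ i - sk * tilt u y $ i + ?T k y $ i) y"
      by (simp add: flux_def)
    also have "\<dots> = R * pd i (\<lambda>y. ?T (k - 1) y $ i) y - sk * pd i (\<lambda>y. tilt u y $ i) y + pd i (\<lambda>y. ?T k y $ i) y"
      by (subst pd_add pd_diff pd_mult, (intro differentiable_diff differentiable_mult differentiable_const C)+)+ simp
    finally show ?thesis .
  qed
  then have "(\<Sum>i\<in>UNIV. pd i (\<lambda>y. flux y $ i) y) = R * (\<Sum>i\<in>UNIV. pd i (\<lambda>y. ?T (k - 1) y $ i) y) -
      sk * (\<Sum>i\<in>UNIV. pd i (\<lambda>y. tilt u y $ i) y) + (\<Sum>i\<in>UNIV. pd i (\<lambda>y. ?T k y $ i) y)"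
    by (simp add: sum.distrib sum_subtractf sum_distrib_left)
  moreover have "(\<Sum>i\<in>UNIV. pd i (\<lambda>y. tilt u y $ i) y) = msigma 1 (shape u y)"
    by (simp add: msigma_def trace_def shape_def)
  moreover have "real (k - 1) + 1 = real k" using k by simp
  ultimately show ?thesis
    unfolding divergence_newton_tensor_tilt[OF y] gap_def using sk[OF y] k by simp
qed

text \<open>From \<open>w W = G Du\<close> and \<open>A G = G A^T\<close> one gets
  \<open>w (R - A) W = G (R - A^T) Du\<close>. Hence the flux is \<open>T_{k-1} G / w\<close>
  applied to the slope defect, and the product is a value of the positive form of
  \<open>newton_tensor_form_nonneg\<close>.\<close>

lemma slope_defect_flux:
  assumes y: "y \<in> D"
  shows "slope_defect y \<bullet> flux y = (1 / lapse u y) *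
    (slope_defect y \<bullet> ((newton_tensor (k - 1) (shape u y) ** (mat 1 + outer (tilt u y))) *v slope_defect y))"
    and "slope_defect y = 0 \<Longrightarrow> flux y = 0"
proof -
  define T A w p where "T = newton_tensor (k - 1) (shape u y)" and "A = shape u y" and "w = lapse u y" and "p = grad u y"
  define G where "G = mat 1 + outer (tilt u y)"
  have w: "w > 0" using lapse_facts(1)[OF y] by (simp add: w_def)
  have Gp: "G *v p = w *\<^sub>R tilt u y"
  proof -
    have "w\<^sup>2 * (p \<bullet> p) = w\<^sup>2 - 1" using lapse_facts(2)[OF y] by (simp add: w_def p_def algebra_simps)
    then have "p + (w * (w * (p \<bullet> p))) *\<^sub>R p = (w\<^sup>2) *\<^sub>R p"
      by (metis (no_types, lifting) add.commute diff_add_cancel mult.assoc power2_eq_square scaleR_add_left scaleR_one)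
    then show ?thesis
      by (simp add: G_def matrix_vector_mult_add_rdistrib outer_mult_vector tilt_def w_def p_def power2_eq_square mult_ac)
  qed
  have AG: "A ** G = G ** transpose A"
  proof -
    have "A ** G = G ** (w *\<^sub>R hess u y) ** G" unfolding A_def G_def w_def shape_eq[OF y] ..
    moreover have "transpose A = (w *\<^sub>R hess u y) ** G"
    proof -
      have "transpose (w *\<^sub>R hess u y) = w *\<^sub>R hess u y"
        by (simp add: transpose_def vec_eq_iff hess_symmetric[OF y])
      moreover have "transpose G = G" by (simp add: G_def transpose_def outer_def mat_def vec_eq_iff mult.commute)
      ultimately show ?thesis unfolding A_def G_def[symmetric] w_def[symmetric] shape_eq[OF y]
        by (simp add: matrix_transpose_mul)
    qed
    ultimately show ?thesis by (simp add: matrix_mul_assoc)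
  qed
  have flux: "flux y = T *v (R *\<^sub>R tilt u y - A *v tilt u y)"
    unfolding flux_def newton_tensor_pred[OF y] T_def A_def
    by (simp add: matrix_vector_mult_diff_rdistrib matrix_vector_mult_diff_distrib matrix_vector_mul_assoc
       scaleR_matrix_vector_assoc[symmetric] matrix_vector_mult_scaleR)
  have "w *\<^sub>R (R *\<^sub>R tilt u y - A *v tilt u y) = R *\<^sub>R (G *v p) - A *v (G *v p)"
    unfolding Gp by (simp add: scaleR_diff_right matrix_vector_mult_scaleR mult.commute)
  also have "\<dots> = G *v slope_defect y"
    using AG by (simp add: slope_defect_def p_def[symmetric] A_def[symmetric] matrix_vector_mult_diff_distrib
      matrix_vector_mul_assoc matrix_vector_mult_scaleR del: transpose_matrix_vector)
  finally have "w *\<^sub>R flux y = T *v (G *v slope_defect y)"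
    unfolding flux by (metis matrix_vector_mult_scaleR)
  then have fl: "flux y = (1 / w) *\<^sub>R ((T ** G) *v slope_defect y)"
    using w by (metis (no_types, lifting) divide_self_if matrix_vector_mul_assoc less_irrefl mult.commute scaleR_one scaleR_scaleR times_divide_eq_right mult_1_right)
  show "slope_defect y \<bullet> flux y = (1 / lapse u y) *
    (slope_defect y \<bullet> ((newton_tensor (k - 1) (shape u y) ** (mat 1 + outer (tilt u y))) *v slope_defect y))"
    unfolding fl by (simp add: T_def G_def w_def)
  show "slope_defect y = 0 \<Longrightarrow> flux y = 0" unfolding fl by simp
qed

lemma slope_defect_flux_nonneg:
  assumes "y \<in> D" shows "slope_defect y \<bullet> flux y \<ge> 0" "slope_defect y \<bullet> flux y = 0 \<Longrightarrow> slope_defect y = 0"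
  using newton_tensor_form_nonneg[OF assms, of "slope_defect y"] lapse_facts(1)[OF assms]
  by (auto simp: slope_defect_flux(1)[OF assms])

lemma q_continuous: "continuous_on (closure D) q"
  unfolding q_def by (intro continuous_intros wcont ucont)

lemma q_frontier: "y \<in> frontier D \<Longrightarrow> q y = 0"
  by (simp add: q_def w0 u0)

lemma q_bdd: "bdd_on D q"
  by (rule closure_bdd[OF q_continuous])

lemma bdd_abs_subset: "bdd_on D f \<Longrightarrow> S \<subseteq> D \<Longrightarrow> \<exists>B. \<forall>y\<in>S. \<bar>f y\<bar> \<le> B"
  by (auto simp: bdd_on_def)

text \<open>The maximum principle for \<open>P\<close> in integrated form: on \<open>{q > 0}\<close> both terms of the divergence of
  \<open>q Z\<close> are nonpositive.\<close>

lemma q_nonpos: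
  assumes "y \<in> D" shows "q y \<le> 0"
proof (rule ccontr)
  assume "\<not> ?thesis"
  define S where "S = {y \<in> D. q y > 0}"
  have SD: "S \<subseteq> D" by (auto simp: S_def)
  have contq: "continuous_on D q" by (rule C1_on_continuous[OF q_C1])
  have openS: "open S"
  proof -
    have "S = D \<inter> q -` {0<..}" by (auto simp: S_def)
    then show ?thesis using continuous_open_preimage[OF contq openD, of "{0<..}"] by simp
  qed
  have clS: "closure S \<subseteq> closure D" using SD by (rule closure_mono)
  have pdqf: "(\<Sum>i\<in>UNIV. pd i q y * flux y $ i) = - (slope_defect y \<bullet> flux y)" if "y \<in> D" for y
    by (simp add: pd_q[OF that] inner_vec_def sum_negf)
  have zero: "slope_defect y = 0" if "y \<in> S" for y
  proof -
    have b1: "bdd_on D (\<lambda>y. \<Sum>i\<in>UNIV. pd i q y * flux y $ i)"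
    proof (intro bdd_on_sum bdd_on_mult flux_bdd)
      have "bdd_on D (\<lambda>y. (\<Sum>l\<in>UNIV. shape u y $ l $ i * grad u y $ l) - R * grad u y $ i)" for i
        by (intro bdd_intros)
      then show "bdd_on D (pd i q)" for i
        by (rule bdd_on_cong[rotated])
          (simp add: pd_q slope_defect_def matrix_vector_mult_def transpose_def del: transpose_matrix_vector)
    qed
    have b2: "bdd_on D (\<lambda>y. q y * (\<Sum>i\<in>UNIV. pd i (\<lambda>y. flux y $ i) y))"
    proof -
      have "bdd_on D gap" unfolding gap_def by (intro bdd_intros)
      then have "bdd_on D (\<lambda>y. q y * (0 - gap y))" by (intro bdd_intros q_bdd)
      then show ?thesis by (rule bdd_on_cong[rotated]) (simp add: divergence_flux)
    qed
    obtain B1 B2 where B: "\<forall>y\<in>S. \<bar>\<Sum>i\<in>UNIV. pd i q y * flux y $ i\<bar> \<le> B1"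
      "\<forall>y\<in>S. \<bar>q y * (\<Sum>i\<in>UNIV. pd i (\<lambda>y. flux y $ i) y)\<bar> \<le> B2"
      using bdd_abs_subset[OF b1 SD] bdd_abs_subset[OF b2 SD] by blast
    define g where "g y = (\<Sum>i\<in>UNIV. pd i q y * flux y $ i) + q y * (\<Sum>i\<in>UNIV. pd i (\<lambda>y. flux y $ i) y)" for y
    have bS: "bounded S" using bdD SD by (rule bounded_subset)
    have cS: "continuous_on (closure S) q" using q_continuous clS by (rule continuous_on_subset)
    have fS: "q y = 0" if "y \<in> frontier S" for y
    proof -
      have y: "y \<in> closure S" "y \<notin> S" using that openS by (auto simp: frontier_def interior_open)
      show ?thesis
      proof (cases "y \<in> D")
        case True
        have "S \<subseteq> {y \<in> closure D. q y \<ge> 0}" using closure_subset by (auto simp: S_def)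
        moreover have "closed {y \<in> closure D. q y \<ge> 0}"
          using continuous_closed_preimage[OF q_continuous closed_closure, of "{0..}"]
          by (simp add: vimage_def Int_def)
        ultimately have "q y \<ge> 0" using closure_minimal y(1) by blast
        then show ?thesis using y(2) True by (auto simp: S_def)
      next
        case False
        then show ?thesis using closure_cases[of y] y(1) clS q_frontier by blast
      qed
    qed
    have pS: "q y > 0" if "y \<in> S" for y using that by (simp add: S_def)
    have "\<bar>\<Sum>i\<in>UNIV. pd i q y * flux y $ i\<bar> \<le> max B1 B2"
      "\<bar>q y * (\<Sum>i\<in>UNIV. pd i (\<lambda>y. flux y $ i) y)\<bar> \<le> max B1 B2" if "y \<in> S" for y
      using B that by (auto simp: le_max_iff_disj)
    note int = integral_divergence_zero[OF openS bS cS fS pS C1_on_subset[OF q_C1 SD] C1_on_subset[OF flux_C1 SD] this,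
      folded g_def]
    have sg: "- slope_defect y \<bullet> flux y \<le> 0" "q y * - gap y \<le> 0" "g y = - slope_defect y \<bullet> flux y + q y * - gap y"
      if "y \<in> S" for y
      using that SD slope_defect_flux_nonneg(1)[of y] gap_nonneg[of y]
      by (auto simp: g_def pdqf divergence_flux S_def)
    have "- g y = 0"
    proof (rule nonneg_integral_zero_imp_zero[OF openS _ _ _ _ that])
      have "continuous_on D g" unfolding g_def
        by (intro continuous_on_add continuous_on_sum continuous_on_mult contq C1_on_pd[OF q_C1] C1_on_pd[OF flux_C1] C1_on_continuous[OF flux_C1])
      then show "continuous_on S (\<lambda>y. - g y)" using SD by (intro continuous_on_minus) (rule continuous_on_subset)
      show "0 \<le> - g y" if "y \<in> S" for y using sg[OF that] by linarith
    qed (use int in auto)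
    then have "slope_defect y \<bullet> flux y = 0" using sg[OF that] by simp
    then show ?thesis using slope_defect_flux_nonneg(2) that SD by blast
  qed
  have "closure D \<noteq> {}" using assms closure_subset by blast
  then obtain m where m: "m \<in> closure D" "\<And>x. x \<in> closure D \<Longrightarrow> q x \<le> q m"
    using continuous_attains_sup[OF compact_closureD _ q_continuous] by blast
  have qm: "q m > 0" using m(2)[of y] assms closure_subset \<open>\<not> q y \<le> 0\<close> by force
  \<comment> \<open>On \<open>{q > 0}\<close> the gradient of \<open>q\<close> is now known to
    vanish. The set where \<open>q\<close> attains its positive maximum is therefore open as well as
    closed, hence the whole space, although \<open>D\<close> is bounded.\<close>
  define E where "E = {y \<in> closure D. q y = q m}"
  have ES: "E \<subseteq> S"
  proof
    fix y assume "y \<in> E"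
    then show "y \<in> S" using closure_cases[of y] q_frontier[of y] qm by (auto simp: E_def S_def)
  qed
  have "closed E"
    using continuous_closed_preimage[OF q_continuous closed_closure, of "{q m}"] by (simp add: E_def vimage_def Int_def)
  moreover have "open E"
    unfolding open_contains_ball
  proof
    fix y assume y: "y \<in> E"
    obtain r where r: "r > 0" "ball y r \<subseteq> S" using openS y ES openE by blast
    have "q x = q y" if "x \<in> ball y r" for x
    proof (rule pd_zero_locally_constant[of "ball y r"])
      show "q differentiable (at z)" if "z \<in> ball y r" for z using that r SD C1_onD[OF q_C1] by blast
      show "pd i q z = 0" if "z \<in> ball y r" for i z
      proof -
        have "z \<in> S" using that r by blast
        then show ?thesis using pd_q[of z i] zero SD by auto
      qed
    qed (use that r in auto)
    moreover have "ball y r \<subseteq> closure D" using r(2) SD closure_subset by blast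
    ultimately have "ball y r \<subseteq> E" using y unfolding E_def by auto
    then show "\<exists>e>0. ball y e \<subseteq> E" using r by blast
  qed
  moreover have "E \<noteq> {}" using m by (auto simp: E_def)
  ultimately have "E = UNIV" using clopen by blast
  then have "D = UNIV" using ES SD by blast
  then show False using bdD not_bounded_UNIV by blast
qed

text \<open>\<open>J1\<close> and \<open>J2\<close> are the divergences of the two pieces of the
  field built from the position vector. For the second piece \<open>A T_{k-1}\<close> is rewritten
  as \<open>\<sigma>_k - T_k\<close>, whose divergence after multiplication with the position vector
  is again explicit.\<close>

lemma q_zero:
  assumes "y \<in> D" shows "q y = 0"
proof -
  let ?T = "\<lambda>j y. newton_tensor j (shape u y)"
  have f1pos: "w0 - lapse u y > 0" if "y \<in> D" for y
  proof -
    have "R * u y < 0" using R_pos u_neg[OF that] by (simp add: mult_pos_neg)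
    then show ?thesis using q_nonpos[OF that] w_lapse[OF that] by (simp add: q_def)
  qed
  define J1 where "J1 y = (\<Sum>i\<in>UNIV. pd i (\<lambda>y. w0 - \<omega> y) y * (?T (k - 1) y *v y) $ i) +
     (w0 - \<omega> y) * (\<Sum>i\<in>UNIV. pd i (\<lambda>y. (?T (k - 1) y *v y) $ i) y)" for y
  define J2 where "J2 y = (\<Sum>i\<in>UNIV. pd i (\<lambda>y. - u y) y * (?T k y *v y - sk *\<^sub>R y) $ i) +
     (- u y) * (\<Sum>i\<in>UNIV. pd i (\<lambda>y. (?T k y *v y - sk *\<^sub>R y) $ i) y)" for y
  have wC1: "C1_on D \<omega>" by (rule C1_on_cong[OF openD _ lapse_C1]) (simp add: w_lapse)
  have fC1: "C1_on D (\<lambda>y. w0 - \<omega> y)" "C1_on D (\<lambda>y. - u y)" by (intro C1_on_diff C1_on_uminus C1_on_const wC1 u1)+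
  have ZC1: "C1_on D (\<lambda>y. (?T (k - 1) y *v y) $ i)" "C1_on D (\<lambda>y. (?T k y *v y - sk *\<^sub>R y) $ i)" for i
    by (simp_all, (intro C1_intros)+)
  have pdw: "pd i (\<lambda>y. w0 - \<omega> y) y = - (transpose (shape u y) *v grad u y) $ i" if "y \<in> D" for i y
  proof -
    have "pd i (\<lambda>y. w0 - \<omega> y) y = - pd i \<omega> y" using C1_onD[OF wC1 that] by (simp add: pd_diff)
    also have "pd i \<omega> y = pd i (lapse u) y"
      by (rule pd_transform[OF openD that w_lapse C1_onD[OF wC1 that]])
    finally show ?thesis by (simp add: pd_lapse[OF that] del: transpose_matrix_vector)
  qed
  have pdu: "pd i (\<lambda>y. - u y) y = - grad u y $ i" if "y \<in> D" for i y
    using pd_uminus[OF C1_onD[OF u1 that]] by (simp add: grad_def)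
  have div2: "(\<Sum>i\<in>UNIV. pd i (\<lambda>y. (?T k y *v y - sk *\<^sub>R y) $ i) y) = - real k * sk" if y: "y \<in> D" for y
  proof -
    have "pd i (\<lambda>y. (?T k y *v y - sk *\<^sub>R y) $ i) y = pd i (\<lambda>y. (?T k y *v y) $ i) y - sk" for i
    proof -
      have d: "(\<lambda>y. (?T k y *v y) $ i) differentiable (at y)" "(\<lambda>y. y $ i) differentiable (at y)"
        by (rule C1_onD[OF _ y], intro C1_intros)+
      then show ?thesis by (simp add: pd_diff pd_mult pd_nth)
    qed
    then have "(\<Sum>i\<in>UNIV. pd i (\<lambda>y. (?T k y *v y - sk *\<^sub>R y) $ i) y) =
       (\<Sum>i\<in>UNIV. pd i (\<lambda>y. (?T k y *v y) $ i) y) - real CARD('n) * sk"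
      by (simp add: sum_subtractf)
    then show ?thesis unfolding divergence_newton_tensor_position[OF y] using sk[OF y] by (simp add: algebra_simps)
  qed
  \<comment> \<open>The gradient terms of \<open>J1\<close> and \<open>J2\<close> cancel:
    \<open>Dw = A^T Du\<close>, and the transposed \<open>A\<close> can be moved onto
    \<open>T_{k-1} y\<close>, with which it commutes through \<open>T_{k-1}\<close>.\<close>
  have pT: "(transpose (shape u y) *v grad u y) \<bullet> (?T (k - 1) y *v y) = - (grad u y \<bullet> (?T k y *v y - sk *\<^sub>R y))" if "y \<in> D" for y
  proof -
    have "(transpose (shape u y) *v grad u y) \<bullet> (?T (k - 1) y *v y) = grad u y \<bullet> (shape u y *v (?T (k - 1) y *v y))"
      by (metis dot_lmul_matrix transpose_matrix_vector)
    also have "shape u y *v (?T (k - 1) y *v y) = sk *\<^sub>R y - ?T k y *v y"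
      unfolding newton_tensor_pred[OF that] newton_tensor_commute
      by (simp add: matrix_vector_mult_diff_rdistrib matrix_vector_mul_assoc scaleR_matrix_vector_assoc[symmetric])
    finally show ?thesis by (simp add: inner_diff_right)
  qed
  define J where "J y = (w0 - lapse u y) * ((real CARD('n) - real (k - 1)) * msigma (k - 1) (shape u y)) + real k * sk * u y" for y
  have J12: "J1 y + J2 y = J y" if y: "y \<in> D" for y
  proof -
    have "J1 y = - ((transpose (shape u y) *v grad u y) \<bullet> (?T (k - 1) y *v y)) + (w0 - lapse u y) * ((real CARD('n) - real (k - 1)) * msigma (k - 1) (shape u y))"
      unfolding J1_def divergence_newton_tensor_position[OF y] w_lapse[OF y]
      by (simp add: pdw[OF y] inner_vec_def sum_negf del: transpose_matrix_vector)
    moreover have "J2 y = - (grad u y \<bullet> (?T k y *v y - sk *\<^sub>R y)) + real k * sk * u y"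
      unfolding J2_def div2[OF y] by (simp add: pdu[OF y] inner_vec_def sum_negf)
    ultimately show ?thesis unfolding pT[OF y] J_def by simp
  qed
  have fr: "frontier D \<subseteq> closure D" by (auto simp: frontier_def)
  have bT: "bdd_on D (\<lambda>y. (?T j y *v y) $ i)" for i j by (intro bdd_intros)
  have bpw: "bdd_on D (pd i (\<lambda>y. w0 - \<omega> y))" for i
  proof -
    have "bdd_on D (\<lambda>y. 0 - (\<Sum>l\<in>UNIV. shape u y $ l $ i * grad u y $ l))" by (intro bdd_intros)
    then show ?thesis by (rule bdd_on_cong[rotated])
      (simp add: pdw matrix_vector_mult_def transpose_def del: transpose_matrix_vector)
  qed
  have I1: "integrable lborel (\<lambda>y. indicator D y * J1 y)" "integral\<^sup>L lborel (\<lambda>y. indicator D y * J1 y) = 0"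
  proof -
    have b1: "bdd_on D (\<lambda>y. \<Sum>i\<in>UNIV. pd i (\<lambda>y. w0 - \<omega> y) y * (?T (k - 1) y *v y) $ i)"
      by (intro bdd_on_sum bdd_on_mult bpw bT)
    have "bdd_on D (\<lambda>y. (w0 - \<omega> y) * ((real CARD('n) - real (k - 1)) * msigma (k - 1) (shape u y)))"
      by (intro bdd_intros closure_bdd[OF wcont])
    then have b2: "bdd_on D (\<lambda>y. (w0 - \<omega> y) * (\<Sum>i\<in>UNIV. pd i (\<lambda>y. (?T (k - 1) y *v y) $ i) y))"
      by (rule bdd_on_cong[rotated]) (simp add: divergence_newton_tensor_position)
    obtain B1 B2 where B: "\<forall>y\<in>D. \<bar>\<Sum>i\<in>UNIV. pd i (\<lambda>y. w0 - \<omega> y) y * (?T (k - 1) y *v y) $ i\<bar> \<le> B1"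
      "\<forall>y\<in>D. \<bar>(w0 - \<omega> y) * (\<Sum>i\<in>UNIV. pd i (\<lambda>y. (?T (k - 1) y *v y) $ i) y)\<bar> \<le> B2"
      using b1 b2 unfolding bdd_on_def by blast
    have "\<bar>\<Sum>i\<in>UNIV. pd i (\<lambda>y. w0 - \<omega> y) y * (?T (k - 1) y *v y) $ i\<bar> \<le> max B1 B2"
      "\<bar>(w0 - \<omega> y) * (\<Sum>i\<in>UNIV. pd i (\<lambda>y. (?T (k - 1) y *v y) $ i) y)\<bar> \<le> max B1 B2" if "y \<in> D" for y
      using B that unfolding le_max_iff_disj by blast+
    note Bm = this
    have "continuous_on (closure D) (\<lambda>y. w0 - \<omega> y)" by (intro continuous_intros wcont)
    moreover have "w0 - \<omega> y = 0" if "y \<in> frontier D" for y using w0[OF that] by simp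
    moreover have "w0 - \<omega> y > 0" if "y \<in> D" for y using f1pos[OF that] w_lapse[OF that] by simp
    ultimately show "integrable lborel (\<lambda>y. indicator D y * J1 y)" "integral\<^sup>L lborel (\<lambda>y. indicator D y * J1 y) = 0"
      using integral_divergence_zero[OF openD bdD _ _ _ fC1(1) ZC1(1) Bm, folded J1_def] by blast+
  qed
  have I2: "integrable lborel (\<lambda>y. indicator D y * J2 y)" "integral\<^sup>L lborel (\<lambda>y. indicator D y * J2 y) = 0"
  proof -
    have bZ: "bdd_on D (\<lambda>y. (?T k y *v y - sk *\<^sub>R y) $ i)" for i by (simp, intro bdd_intros bT)
    have "bdd_on D (\<lambda>y. \<Sum>i\<in>UNIV. (0 - grad u y $ i) * (?T k y *v y - sk *\<^sub>R y) $ i)"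
      by (intro bdd_on_sum bdd_on_mult bdd_on_diff bdd_on_const grad_bdd bZ)
    then have b1: "bdd_on D (\<lambda>y. \<Sum>i\<in>UNIV. pd i (\<lambda>y. - u y) y * (?T k y *v y - sk *\<^sub>R y) $ i)"
      by (rule bdd_on_cong[rotated]) (simp add: pdu)
    have "bdd_on D (\<lambda>y. (-1 * u y) * (- real k * sk))" by (intro bdd_intros)
    then have b2: "bdd_on D (\<lambda>y. (- u y) * (\<Sum>i\<in>UNIV. pd i (\<lambda>y. (?T k y *v y - sk *\<^sub>R y) $ i) y))"
      by (rule bdd_on_cong[rotated]) (simp only: div2 mult_minus1)
    obtain B1 B2 where B: "\<forall>y\<in>D. \<bar>\<Sum>i\<in>UNIV. pd i (\<lambda>y. - u y) y * (?T k y *v y - sk *\<^sub>R y) $ i\<bar> \<le> B1"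
      "\<forall>y\<in>D. \<bar>(- u y) * (\<Sum>i\<in>UNIV. pd i (\<lambda>y. (?T k y *v y - sk *\<^sub>R y) $ i) y)\<bar> \<le> B2"
      using b1 b2 unfolding bdd_on_def by blast
    have "\<bar>\<Sum>i\<in>UNIV. pd i (\<lambda>y. - u y) y * (?T k y *v y - sk *\<^sub>R y) $ i\<bar> \<le> max B1 B2"
      "\<bar>(- u y) * (\<Sum>i\<in>UNIV. pd i (\<lambda>y. (?T k y *v y - sk *\<^sub>R y) $ i) y)\<bar> \<le> max B1 B2" if "y \<in> D" for y
      using B that unfolding le_max_iff_disj by blast+
    note Bm = this
    have "continuous_on (closure D) (\<lambda>y. - u y)" by (intro continuous_intros ucont)
    moreover have "- u y = 0" if "y \<in> frontier D" for y using u0[OF that] by simp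
    moreover have "- u y > 0" if "y \<in> D" for y using u_neg[OF that] by simp
    ultimately show "integrable lborel (\<lambda>y. indicator D y * J2 y)" "integral\<^sup>L lborel (\<lambda>y. indicator D y * J2 y) = 0"
      using integral_divergence_zero[OF openD bdD _ _ _ fC1(2) ZC1(2) Bm, folded J2_def] by blast+
  qed
  have eq: "(\<lambda>y. indicator D y * J y) = (\<lambda>y. indicator D y * J1 y + indicator D y * J2 y)"
    using J12 by (auto simp: fun_eq_iff indicator_def)
  have IJ: "integrable lborel (\<lambda>y. indicator D y * J y)" "integral\<^sup>L lborel (\<lambda>y. indicator D y * J y) = 0"
    unfolding eq using I1 I2 by simp_all
  \<comment> \<open>Replacing the weight \<open>(n - k + 1) \<sigma>_{k-1}\<close> by its lower
    bound \<open>k \<sigma>_k / R\<close> turns the integrand into exactly \<open>- q\<close> times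
    that constant.\<close>
  have Jsplit: "J y \<ge> (- q y) * (real k * sk / R)" if y: "y \<in> D" for y
  proof -
    have "(w0 - lapse u y) * (real k * sk / R) \<le> (w0 - lapse u y) * ((real CARD('n) - real (k - 1)) * msigma (k - 1) (shape u y))"
      using f1pos[OF y] msigma_pred_ge[OF y] by (intro mult_left_mono) auto
    moreover have "(w0 - lapse u y) * (real k * sk / R) = (- q y) * (real k * sk / R) - real k * sk * u y"
      using R_pos w_lapse[OF y] by (simp add: q_def field_simps)
    ultimately show ?thesis by (simp add: J_def)
  qed
  have c: "real k * sk / R > 0" using k sk_pos R_pos by simp
  have "J y = 0"
  proof (rule nonneg_integral_zero_imp_zero[OF openD _ _ IJ assms])
    show "continuous_on D J"
      unfolding J_def by (rule C1_on_continuous) (intro C1_intros)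
    show "J y \<ge> 0" if "y \<in> D" for y
    proof -
      have "(- q y) * (real k * sk / R) \<ge> 0" using q_nonpos[OF that] c by (intro mult_nonneg_nonneg) auto
      then show ?thesis using Jsplit[OF that] by linarith
    qed
  qed
  then have "(- q y) * (real k * sk / R) \<le> 0" using Jsplit[OF assms] by simp
  then have "- q y \<le> 0" using c by (simp only: mult_le_0_iff) auto
  then show ?thesis using q_nonpos[OF assms] by simp
qed

text \<open>With \<open>q = 0\<close> the slope defect is zero everywhere, so the flux vanishes
  identically, and with it its divergence \<open>- gap\<close>.\<close>

lemma shape_umbilic:
  assumes "y \<in> D" shows "shape u y = R *\<^sub>R mat 1"
proof -
  have pd0: "pd i q y = 0" if y: "y \<in> D" for i y
    using pd_transform[OF openD y, of q "\<lambda>_. 0" i] q_zero C1_onD[OF q_C1 y] by simp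
  have fl: "flux y = 0" if y: "y \<in> D" for y
    using slope_defect_flux(2)[OF y] pd0[OF y] pd_q[OF y] by (simp add: vec_eq_iff)
  have "pd i (\<lambda>y. flux y $ i) y = 0" for i
    using pd_transform[OF openD assms, of "\<lambda>y. flux y $ i" "\<lambda>_. 0" i] fl C1_onD[OF flux_C1 assms] by simp
  then have "gap y = 0" using divergence_flux[OF assms] by simp
  then show ?thesis using gap_zero_umbilic[OF assms] by blast
qed

lemma graph_in_hyperboloid:
  "\<exists>b \<beta> r. r > 0 \<and> (\<forall>y\<in>closure D. (y - b) \<bullet> (y - b) - (u y - \<beta>)\<^sup>2 = - r\<^sup>2)"
proof -
  obtain z where z: "z \<in> D" using neg by blast
  \<comment> \<open>The centre is chosen such that \<open>W = R (y - b)\<close> at \<open>z\<close>,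
    hence everywhere, and \<open>\<beta>\<close> such that \<open>q = 0\<close> becomes
    \<open>w = R (u - \<beta>)\<close>. Then \<open>w^2 = 1 + W \<bullet> W\<close> is the equation
    of a hyperboloid with \<open>r = 1 / R\<close>.\<close>
  define b where "b = z - (1 / R) *\<^sub>R tilt u z"
  define \<beta> where "\<beta> = - w0 / R"
  have tilt: "tilt u y = R *\<^sub>R (y - b)" if y: "y \<in> D" for y
  proof -
    have "tilt u y $ i - R * y $ i = tilt u z $ i - R * z $ i" for i
    proof (rule pd_zero_locally_constant[OF openD connD _ _ y z, of "\<lambda>y. tilt u y $ i - R * y $ i"])
      show "(\<lambda>y. tilt u y $ i - R * y $ i) differentiable at x" if "x \<in> D" for x
        by (rule C1_onD[OF _ that]) (intro C1_intros)
      show "pd j (\<lambda>y. tilt u y $ i - R * y $ i) x = 0" if "x \<in> D" for j x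
      proof -
        have "pd j (\<lambda>y. tilt u y $ i) x = shape u x $ i $ j" by (simp add: shape_def)
        moreover have "(\<lambda>y. tilt u y $ i) differentiable (at x)" "(\<lambda>y. y $ i) differentiable (at x)"
          by (rule C1_onD[OF _ that], intro C1_intros)+
        ultimately show ?thesis by (simp add: shape_umbilic[OF that] pd_diff pd_mult pd_nth mat_def)
      qed
    qed
    then show ?thesis using R_pos by (simp add: b_def vec_eq_iff field_simps)
  qed
  have D: "(y - b) \<bullet> (y - b) - (u y - \<beta>)\<^sup>2 = - (1 / R)\<^sup>2" if y: "y \<in> D" for y
  proof -
    have w: "lapse u y = R * (u y - \<beta>)" using q_zero[OF y] w_lapse[OF y] R_pos by (simp add: q_def \<beta>_def algebra_simps)
    have "(R * (u y - \<beta>))\<^sup>2 = 1 + (R *\<^sub>R (y - b)) \<bullet> (R *\<^sub>R (y - b))"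
      using lapse_facts(3)[OF y] unfolding w tilt[OF y] .
    then have "R\<^sup>2 * ((y - b) \<bullet> (y - b) - (u y - \<beta>)\<^sup>2) = - 1"
      by (simp add: power_mult_distrib power2_eq_square algebra_simps)
    then have "(y - b) \<bullet> (y - b) - (u y - \<beta>)\<^sup>2 = - 1 / R\<^sup>2" using R_pos by (simp add: field_simps)
    then show ?thesis by (simp add: power_divide)
  qed
  have "(y - b) \<bullet> (y - b) - (u y - \<beta>)\<^sup>2 = - (1 / R)\<^sup>2" if "y \<in> closure D" for y
    by (rule continuous_constant_on_closure[OF _ D that]) (intro continuous_intros ucont)
  then show ?thesis using R_pos by (intro exI[of _ b] exI[of _ \<beta>] exI[of _ "1 / R"]) auto
qed

end

section \<open>The problem without a sign condition\<close>

lemma pd_minus_eq: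
  assumes "C1_on D u" "y \<in> D" shows "pd i (\<lambda>y. - u y) y = - pd i u y"
  using pd_uminus C1_onD[OF assms] by blast

lemma (in spacelike_graph) uminus_facts:
  shows "spacelike_graph D (\<lambda>y. - u y)"
    and "y \<in> D \<Longrightarrow> lapse (\<lambda>y. - u y) y = lapse u y"
    and "y \<in> D \<Longrightarrow> hess (\<lambda>y. - u y) y = - hess u y"
    and "y \<in> D \<Longrightarrow> shape (\<lambda>y. - u y) y = - shape u y"
proof -
  have g: "grad (\<lambda>y. - u y) y = - grad u y" if "y \<in> D" for y
    using pd_minus_eq[OF u1 that] by (simp add: grad_def vec_eq_iff)
  have 1: "C1_on D (\<lambda>y. - u y)" using u1 by (rule C1_on_uminus)
  have 2: "C1_on D (pd i (\<lambda>y. - u y))" for i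
    by (rule C1_on_cong[OF openD _ C1_on_uminus[OF u2]]) (simp add: pd_minus_eq[OF u1])
  have h: "pd j (pd i (\<lambda>y. - u y)) y = - pd j (pd i u) y" if "y \<in> D" for i j y
  proof -
    have "pd j (pd i (\<lambda>y. - u y)) y = pd j (\<lambda>y. - pd i u y) y"
      by (rule pd_transform[OF openD that _ C1_onD[OF 2 that]]) (simp add: pd_minus_eq[OF u1])
    then show ?thesis using pd_minus_eq[OF u2 that] by simp
  qed
  have 3: "C1_on D (pd j (pd i (\<lambda>y. - u y)))" for i j
    by (rule C1_on_cong[OF openD _ C1_on_uminus[OF u3]]) (simp add: h)
  show sg: "spacelike_graph D (\<lambda>y. - u y)"
    by unfold_locales (use openD 1 2 3 slope g in auto)
  show l: "y \<in> D \<Longrightarrow> lapse (\<lambda>y. - u y) y = lapse u y" for y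
    by (simp add: lapse_def g)
  have t: "tilt (\<lambda>y. - u y) y = - tilt u y" if "y \<in> D" for y
    using that by (simp add: tilt_def g l)
  show hh: "y \<in> D \<Longrightarrow> hess (\<lambda>y. - u y) y = - hess u y" for y
    by (simp add: hess_def h vec_eq_iff)
  show "y \<in> D \<Longrightarrow> shape (\<lambda>y. - u y) y = - shape u y"
  proof -
    assume y: "y \<in> D"
    have "pd j (\<lambda>y. tilt (\<lambda>y. - u y) y $ i) y = - pd j (\<lambda>y. tilt u y $ i) y" for i j
    proof -
      have "pd j (\<lambda>y. tilt (\<lambda>y. - u y) y $ i) y = pd j (\<lambda>y. - tilt u y $ i) y"
        by (rule pd_transform[OF openD y _ C1_onD[OF spacelike_graph.tilt_C1[OF sg] y]]) (simp add: t)
      then show ?thesis using pd_minus_eq[OF tilt_C1 y] by simp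
    qed
    then show ?thesis by (simp add: shape_def vec_eq_iff)
  qed
qed

lemma (in spacelike_graph) msigma_scaled_shape:
  assumes "y \<in> D" shows "msigma k (c *\<^sub>R shape u y) = c ^ k * msigma k (shape u y)"
proof -
  obtain K :: "real^'n^'n" and l where K: "invertible K" "shape u y ** K = K ** diag l"
    using shape_diagonalizable[OF assms] by metis
  have "(c *\<^sub>R shape u y) ** K = K ** diag (c *\<^sub>R l)"
  proof -
    have "diag (c *\<^sub>R l) = c *\<^sub>R diag l" by (simp add: diag_def vec_eq_iff)
    then show ?thesis using K(2) by (simp add: matrix_scalar_ac scalar_matrix_assoc[symmetric])
  qed
  moreover have "($) (c *\<^sub>R l) = (\<lambda>i. c * l $ i)" by (simp add: fun_eq_iff)
  ultimately show ?thesis using msigma_diagonalized[OF K(1), of "c *\<^sub>R shape u y" "c *\<^sub>R l" k] esym_scale[of UNIV c "($) l" k]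
    by (simp add: msigma_diagonalized[OF K])
qed

lemma overdetermined_spacelike_graph:
  fixes D :: "(real^'n) set"
  assumes sg: "spacelike_graph D u" and bdD: "bounded D" and connD: "connected D"
    and ucont: "continuous_on (closure D) u" and u0: "\<And>y. y \<in> frontier D \<Longrightarrow> u y = 0"
    and wcont: "continuous_on (closure D) \<omega>" and wl: "\<And>y. y \<in> D \<Longrightarrow> \<omega> y = lapse u y"
    and w0: "\<And>y. y \<in> frontier D \<Longrightarrow> \<omega> y = w0"
    and hb: "\<And>i j. bdd_on D (\<lambda>y. hess u y $ i $ j)"
    and k: "1 \<le> k" "k \<le> CARD('n)"
    and sk: "\<And>y. y \<in> D \<Longrightarrow> msigma k (shape u y) = sk"
  shows "(\<forall>y\<in>closure D. u y = 0) \<or>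
    (\<exists>b \<beta> r. r > 0 \<and> (\<forall>y\<in>closure D. (y - b) \<bullet> (y - b) - (u y - \<beta>)\<^sup>2 = - r\<^sup>2))"
proof -
  interpret spacelike_graph D u by (rule sg)
  consider "\<exists>y\<in>D. u y < 0" | "\<exists>y\<in>D. u y > 0" | "\<forall>y\<in>D. u y = 0" by force
  then show ?thesis
  proof cases
    case 1
    then interpret overdetermined_graph D u \<omega> w0 sk k
      by unfold_locales (use assms in auto)
    show ?thesis using graph_in_hyperboloid by blast
  next
    case 2
    interpret m: spacelike_graph D "\<lambda>y. - u y" by (rule uminus_facts(1))
    \<comment> \<open>Reflection changes the sign of the shape matrix, hence its \<open>k\<close>-th
      symmetric function by \<open>(-1)^k\<close>, and leaves \<open>w\<close> unchanged.\<close>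
    interpret m: overdetermined_graph D "\<lambda>y. - u y" \<omega> w0 "(-1) ^ k * sk" k
    proof unfold_locales
      show "continuous_on (closure D) (\<lambda>y. - u y)" by (intro continuous_intros ucont)
      show "bdd_on D (\<lambda>y. hess (\<lambda>y. - u y) y $ i $ j)" for i j
        by (rule bdd_on_cong[OF _ bdd_on_mult[OF bdd_on_const[of D "-1"] hb[of i j]]]) (simp add: uminus_facts(3))
      show "msigma k (shape (\<lambda>y. - u y) y) = (-1) ^ k * sk" if "y \<in> D" for y
        using msigma_scaled_shape[OF that, of k "-1"] sk[OF that] uminus_facts(4)[OF that] by simp
    qed (use assms 2 uminus_facts in auto)
    obtain b \<beta> r where "r > 0" "\<forall>y\<in>closure D. (y - b) \<bullet> (y - b) - (- u y - \<beta>)\<^sup>2 = - r\<^sup>2"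
      using m.graph_in_hyperboloid by blast
    moreover have "(- u y - \<beta>)\<^sup>2 = (u y - (- \<beta>))\<^sup>2" for y by (simp add: power2_eq_square algebra_simps)
    ultimately show ?thesis by metis
  next
    case 3
    have "y \<in> D \<or> y \<in> frontier D" if "y \<in> closure D" for y
      using openD that by (simp add: frontier_def interior_open)
    then show ?thesis using 3 u0 by blast
  qed
qed

section \<open>Smooth maps\<close>

lemma Ck_on_subset: "Ck_on k S f \<Longrightarrow> T \<subseteq> S \<Longrightarrow> Ck_on k T f"
  by (induction k arbitrary: f) (auto intro: continuous_on_subset)

lemma Ck_on_cong:
  assumes "open S" "\<And>x. x \<in> S \<Longrightarrow> f x = g x" "Ck_on k S f"
  shows "Ck_on k S g"
  using assms(2,3)
proof (induction k arbitrary: f g)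
  case 0
  then show ?case by (simp add: continuous_on_eq)
next
  case (Suc k)
  have d: "frechet_derivative f (at x) = frechet_derivative g (at x)" "g differentiable (at x)" if "x \<in> S" for x
  proof -
    have f: "f differentiable (at x)" using Suc.prems that by simp
    show "frechet_derivative f (at x) = frechet_derivative g (at x)"
      by (rule frechet_derivative_transform_within_open[OF f assms(1) that Suc.prems(1)])
    show "g differentiable (at x)"
    proof -
      obtain f' where "(f has_derivative f') (at x)" using f by (auto simp: differentiable_def)
      from has_derivative_transform_within_open[OF this assms(1) that Suc.prems(1)]
      show ?thesis by (rule differentiableI)
    qed
  qed
  have "Ck_on k S (\<lambda>x. frechet_derivative g (at x) v)" for v
    by (rule Suc.IH[of "\<lambda>x. frechet_derivative f (at x) v"]) (use d Suc.prems in auto)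
  then show ?case using d by simp
qed

text \<open>The height function is given near each point only by some smooth extension, which varies
  with the point; smoothness on the open domain is glued from these.\<close>

lemma Ck_on_local:
  assumes "\<And>x. x \<in> S \<Longrightarrow> \<exists>T. open T \<and> x \<in> T \<and> Ck_on k T f"
  shows "Ck_on k S f"
  using assms
proof (induction k arbitrary: f)
  case 0
  have "isCont f x" if x: "x \<in> S" for x
  proof -
    obtain T where "open T" "x \<in> T" "continuous_on T f" using 0[OF x] by auto
    then show ?thesis by (simp add: continuous_on_eq_continuous_at)
  qed
  then show ?case by (simp add: continuous_at_imp_continuous_on)
next
  case (Suc k)
  have "f differentiable (at x)" if "x \<in> S" for x using Suc.prems[OF that] by auto
  moreover have "Ck_on k S (\<lambda>x. frechet_derivative f (at x) v)" for v
    by (rule Suc.IH) (use Suc.prems in fastforce)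
  ultimately show ?case by simp
qed

lemma Ck_on_const: "Ck_on k S (\<lambda>x. c)"
proof (induction k arbitrary: c)
  case (Suc k)
  have "frechet_derivative (\<lambda>x. c) (at x) v = 0" for x v
    using frechet_derivative_at[OF has_derivative_const[of c "at x"]] by (metis)
  then show ?case using Suc by simp
qed simp

lemma Ck_on_affine_map:
  assumes "bounded_linear L" shows "Ck_on k S (\<lambda>x. a + L x)"
proof (cases k)
  case 0
  then show ?thesis using assms by (simp add: continuous_intros linear_continuous_on)
next
  case (Suc k')
  have d: "((\<lambda>x. a + L x) has_derivative L) (at x)" for x
    using has_derivative_add[OF has_derivative_const bounded_linear_imp_has_derivative[OF assms]] by simp
  have "frechet_derivative (\<lambda>x. a + L x) (at x) v = L v" for x v
    using frechet_derivative_at[OF d] by metis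
  then show ?thesis using d unfolding Suc by (auto simp: Ck_on_const intro: differentiableI)
qed

lemma Ck_on_add:
  assumes "open S" "Ck_on k S f" "Ck_on k S g" shows "Ck_on k S (\<lambda>x. f x + g x)"
  using assms(2,3)
proof (induction k arbitrary: f g)
  case 0
  then show ?case by (simp add: continuous_on_add)
next
  case (Suc k)
  have d: "((\<lambda>x. f x + g x) has_derivative (\<lambda>v. frechet_derivative f (at x) v + frechet_derivative g (at x) v)) (at x)"
    if "x \<in> S" for x
    using Suc.prems that by (intro has_derivative_add) (auto simp: frechet_derivative_works[symmetric])
  have "Ck_on k S (\<lambda>x. frechet_derivative (\<lambda>x. f x + g x) (at x) v)" for v
  proof (rule Ck_on_cong[OF assms(1)])
    show "frechet_derivative f (at x) v + frechet_derivative g (at x) v = frechet_derivative (\<lambda>x. f x + g x) (at x) v"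
      if "x \<in> S" for x using frechet_derivative_at[OF d[OF that]] by metis
    show "Ck_on k S (\<lambda>x. frechet_derivative f (at x) v + frechet_derivative g (at x) v)"
      using Suc by auto
  qed
  then show ?case using d by (auto intro: differentiableI)
qed

lemma Ck_on_bounded_linear:
  assumes "open S" "Ck_on k S f" "bounded_linear L" shows "Ck_on k S (\<lambda>x. L (f x))"
  using assms(2)
proof (induction k arbitrary: f)
  case 0
  then show ?case using bounded_linear.continuous_on[OF assms(3)] by simp
next
  case (Suc k)
  have d: "((\<lambda>x. L (f x)) has_derivative (\<lambda>v. L (frechet_derivative f (at x) v))) (at x)" if "x \<in> S" for x
    using Suc.prems that by (intro bounded_linear.has_derivative[OF assms(3)]) (auto simp: frechet_derivative_works[symmetric])
  have "Ck_on k S (\<lambda>x. frechet_derivative (\<lambda>x. L (f x)) (at x) v)" for v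
  proof (rule Ck_on_cong[OF assms(1)])
    show "L (frechet_derivative f (at x) v) = frechet_derivative (\<lambda>x. L (f x)) (at x) v"
      if "x \<in> S" for x using frechet_derivative_at[OF d[OF that]] by metis
    show "Ck_on k S (\<lambda>x. L (frechet_derivative f (at x) v))" using Suc by auto
  qed
  then show ?case using d by (auto intro: differentiableI)
qed

text \<open>For an affine inner map the directional derivative is again a composition with the same
  map, in the direction \<open>L v\<close>, so the induction closes.\<close>

lemma Ck_on_compose_affine:
  fixes L :: "'a::real_normed_vector \<Rightarrow> 'b::real_normed_vector"
  assumes "open S" "Ck_on k S f" "bounded_linear L"
  shows "Ck_on k ((\<lambda>x. a + L x) -` S) (\<lambda>x. f (a + L x))"
  using assms(2)
proof (induction k arbitrary: f)
  case 0
  have "continuous_on ((\<lambda>x. a + L x) -` S) (\<lambda>x. a + L x)"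
    using assms(3) by (simp add: continuous_intros linear_continuous_on)
  then show ?case using continuous_on_compose2[of S f] 0 by auto
next
  case (Suc k)
  have openV: "open ((\<lambda>x. a + L x) -` S)"
    using assms(1,3) by (intro open_vimage) (auto simp: continuous_intros linear_continuous_on)
  have dA: "((\<lambda>x. a + L x) has_derivative L) (at x)" for x
    using has_derivative_add[OF has_derivative_const bounded_linear_imp_has_derivative[OF assms(3)]] by simp
  have d: "((\<lambda>x. f (a + L x)) has_derivative (\<lambda>v. frechet_derivative f (at (a + L x)) (L v))) (at x)"
    if "x \<in> (\<lambda>x. a + L x) -` S" for x
    using Suc.prems that by (intro has_derivative_compose[OF dA]) (auto simp: frechet_derivative_works[symmetric])
  have "Ck_on k ((\<lambda>x. a + L x) -` S) (\<lambda>x. frechet_derivative (\<lambda>x. f (a + L x)) (at x) v)" for v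
  proof (rule Ck_on_cong[OF openV])
    show "frechet_derivative f (at (a + L x)) (L v) = frechet_derivative (\<lambda>x. f (a + L x)) (at x) v"
      if "x \<in> (\<lambda>x. a + L x) -` S" for x using frechet_derivative_at[OF d[OF that]] by metis
    show "Ck_on k ((\<lambda>x. a + L x) -` S) (\<lambda>x. frechet_derivative f (at (a + L x)) (L v))"
      using Suc by auto
  qed
  then show ?case using d by (auto intro: differentiableI)
qed

lemma smooth_on_pd: "smooth_on S f \<Longrightarrow> smooth_on S (pd i f)"
  unfolding smooth_on_def pd_def[abs_def] by (metis Ck_on.simps(2))

lemma smooth_on_C1: "smooth_on S f \<Longrightarrow> C1_on S f"
proof -
  assume "smooth_on S f"
  then have "Ck_on (Suc 0) S f" by (simp only: smooth_on_def)
  then show ?thesis by (simp add: C1_on_def pd_def[abs_def])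
qed

lemma smooth_on_continuous: "smooth_on S f \<Longrightarrow> continuous_on S f"
  unfolding smooth_on_def by (metis Ck_on.simps(1))

lemma smooth_map_continuous_on:
  assumes "smooth_map A f" shows "continuous_on A f"
  unfolding continuous_on_eq_continuous_within
proof
  fix p assume p: "p \<in> A"
  obtain U g where U: "open U" "p \<in> U" "smooth_on U g" "\<forall>x\<in>A \<inter> U. g x = f x"
    using assms p unfolding smooth_map_def by blast
  have "continuous_on (A \<inter> U) f"
    by (rule continuous_on_eq[OF continuous_on_subset[OF smooth_on_continuous[OF U(3)]]]) (use U in auto)
  then have "continuous (at p within (A \<inter> U)) f" using p U by (simp add: continuous_on_eq_continuous_within)
  moreover have "at p within (A \<inter> U) = at p within A"
    by (rule at_within_nhd[OF U(2,1)]) auto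
  ultimately show "continuous (at p within A) f" by (simp add: continuous_within)
qed

text \<open>The sum over a finite subcover serves as the bound.\<close>

lemma bdd_on_locally:
  assumes "compact C" "D \<subseteq> C" "\<And>x. x \<in> C \<Longrightarrow> \<exists>T B. open T \<and> x \<in> T \<and> (\<forall>y\<in>T \<inter> D. \<bar>f y\<bar> \<le> B)"
  shows "bdd_on D f"
proof -
  obtain T B where T: "\<And>x. x \<in> C \<Longrightarrow> open (T x) \<and> x \<in> T x \<and> (\<forall>y\<in>T x \<inter> D. \<bar>f y\<bar> \<le> B x)"
    using assms(3) by metis
  then obtain F where F: "F \<subseteq> C" "finite F" "C \<subseteq> (\<Union>x\<in>F. T x)"
    using compactE_image[OF assms(1), of C T] by (metis UN_I subsetI)
  have "\<bar>f y\<bar> \<le> (\<Sum>x\<in>F. \<bar>B x\<bar>)" if yD: "y \<in> D" for y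
  proof -
    obtain x where x: "x \<in> F" "y \<in> T x" using F(3) assms(2) yD by blast
    then have "\<bar>f y\<bar> \<le> \<bar>B x\<bar>" using T[of x] F(1) yD by (meson IntI abs_ge_self order_trans subsetD)
    also have "\<dots> \<le> (\<Sum>x\<in>F. \<bar>B x\<bar>)" using x F(2) by (intro member_le_sum) auto
    finally show ?thesis .
  qed
  then show ?thesis by (auto simp: bdd_on_def)
qed

section \<open>Euclidean coordinates on the spacelike hyperplane\<close>

locale lorentz_frame =
  fixes N0 :: "'n::finite minkowski"
  assumes tlu: "timelike_unit N0"
begin

text \<open>A Lorentz boost, restricted to \<open>\<real>\<^sup>n\<close>: an isometry onto the orthogonal complement of \<open>N0\<close>, with
  inverse \<open>coord\<close>.\<close>

definition frame :: "real^'n \<Rightarrow> 'n minkowski" where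
  "frame y = (y + ((fst N0 \<bullet> y) / (1 + \<bar>snd N0\<bar>)) *\<^sub>R fst N0, sgn (snd N0) * (fst N0 \<bullet> y))"

definition coord :: "'n minkowski \<Rightarrow> real^'n" where
  "coord x = fst x - (sgn (snd N0) * snd x / (1 + \<bar>snd N0\<bar>)) *\<^sub>R fst N0"

lemma N0_norm: "fst N0 \<bullet> fst N0 = (snd N0)\<^sup>2 - 1" "snd N0 \<noteq> 0"
proof -
  show 1: "fst N0 \<bullet> fst N0 = (snd N0)\<^sup>2 - 1"
    using tlu by (simp add: timelike_unit_def lor_def power2_eq_square)
  show "snd N0 \<noteq> 0" using 1 inner_ge_zero[of "fst N0"] by auto
qed

lemma lor_commute: "lor x y = lor y (x :: 'n minkowski)"
  by (simp add: lor_def inner_commute mult.commute)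

lemma lor_add_left: "lor (x + y) z = lor x z + lor y (z :: 'n minkowski)"
  and lor_add_right: "lor z (x + y) = lor z x + lor z (y :: 'n minkowski)"
  and lor_diff_left: "lor (x - y) z = lor x z - lor y (z :: 'n minkowski)"
  and lor_scaleR_left: "lor (r *\<^sub>R x) z = r * lor x (z :: 'n minkowski)"
  and lor_scaleR_right: "lor z (r *\<^sub>R x) = r * lor z (x :: 'n minkowski)"
  by (simp_all add: lor_def algebra_simps)

lemma lor_N0: "lor N0 N0 = -1"
  using tlu by (simp add: timelike_unit_def)

lemma bounded_linear_frame: "bounded_linear frame"
  unfolding linear_conv_bounded_linear[symmetric]
  by (rule linearI) (simp_all add: frame_def inner_add_right algebra_simps add_divide_distrib)

lemma bounded_linear_coord: "bounded_linear coord"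
  unfolding linear_conv_bounded_linear[symmetric]
  by (rule linearI) (simp_all add: coord_def algebra_simps add_divide_distrib)

lemma continuous_on_lor: "continuous_on S f \<Longrightarrow> continuous_on S g \<Longrightarrow> continuous_on S (\<lambda>x. lor (f x) (g x :: 'n minkowski))"
  unfolding lor_def by (intro continuous_intros)

lemma frame_facts:
  shows lor_frame_frame: "lor (frame y) (frame z) = y \<bullet> z"
    and lor_frame_N0: "lor (frame y) N0 = 0"
    and coord_frame: "coord (frame y) = y"
    and frame_coord: "lor x N0 = 0 \<Longrightarrow> frame (coord x) = x"
proof -
  define a b s c where "a = fst N0" and "b = snd N0" and "s = sgn (snd N0)" and "c = 1 / (1 + \<bar>snd N0\<bar>)"
  have aa: "a \<bullet> a = b\<^sup>2 - 1" and b0: "b \<noteq> 0" using N0_norm by (auto simp: a_def b_def)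
  have ss: "s * s = 1" and sb: "s * b = \<bar>b\<bar>" and bs: "b = s * \<bar>b\<bar>" using b0 by (auto simp: s_def b_def sgn_if)
  have c0: "c * (1 + \<bar>b\<bar>) = 1" by (simp add: c_def b_def)
  \<comment> \<open>The factorisation \<open>b^2 - 1 = (1 + |b|) (|b| - 1)\<close> explains the
    denominator in \<open>frame\<close>; both orthogonality relations reduce to this
    identity.\<close>
  have cb: "c * (a \<bullet> a) = \<bar>b\<bar> - 1"
  proof -
    have "a \<bullet> a = (1 + \<bar>b\<bar>) * (\<bar>b\<bar> - 1)" unfolding aa by (simp add: power2_eq_square algebra_simps)
    then show ?thesis using c0 by (metis mult.assoc mult_1)
  qed
  have fr: "frame y = (y + (c * (a \<bullet> y)) *\<^sub>R a, s * (a \<bullet> y))" for y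
    by (simp add: frame_def a_def c_def s_def)
  have co: "coord x = fst x - (c * s * snd x) *\<^sub>R a" for x
    by (simp add: coord_def a_def c_def s_def)
  have N0: "fst N0 = a" "snd N0 = b" by (simp_all add: a_def b_def)
  have "lor (frame y) (frame z) = y \<bullet> z + (a \<bullet> y) * (a \<bullet> z) * (2 * c + c * (c * (a \<bullet> a)) - s * s)"
    by (simp add: lor_def fr inner_add_left inner_add_right inner_commute[of y a] algebra_simps)
  also have "2 * c + c * (c * (a \<bullet> a)) - s * s = 0"
    unfolding cb ss using c0 by (simp add: algebra_simps)
  finally show "lor (frame y) (frame z) = y \<bullet> z" by simp
  have "lor (frame y) N0 = (a \<bullet> y) * (1 + c * (a \<bullet> a) - s * b)"
    by (simp add: lor_def fr N0 inner_add_left inner_commute[of y a] algebra_simps)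
  then show "lor (frame y) N0 = 0" by (simp add: cb sb)
  show "coord (frame y) = y" using ss by (simp add: co fr algebra_simps flip: mult.assoc)
  assume "lor x N0 = 0"
  then have ax: "a \<bullet> fst x = b * snd x" by (simp add: lor_def N0 inner_commute mult.commute)
  have "a \<bullet> coord x = b * snd x - s * snd x * (c * (a \<bullet> a))"
    by (simp add: co inner_diff_right ax algebra_simps)
  also have "\<dots> = s * snd x" unfolding cb using bs by (simp add: algebra_simps)
  finally have *: "a \<bullet> coord x = s * snd x" .
  show "frame (coord x) = x"
    unfolding fr * using ss by (simp add: co prod_eq_iff flip: mult.assoc)
qed

text \<open>The minus sign in the second coefficient reflects that \<open>N0\<close> has square
  \<open>- 1\<close>.\<close>

lemma frame_decomposition:
  "x = frame (\<chi> i. lor x (frame (axis i 1))) + (- lor x N0) *\<^sub>R N0"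
proof -
  define x' where "x' = x + lor x N0 *\<^sub>R N0"
  have "lor x' N0 = 0" by (simp add: x'_def lor_add_left lor_scaleR_left lor_N0)
  then have x': "frame (coord x') = x'" by (rule frame_coord)
  have "lor x (frame v) = coord x' \<bullet> v" for v
  proof -
    have "lor x (frame v) = lor x' (frame v)"
      using lor_frame_N0[of v] by (simp add: x'_def lor_add_left lor_scaleR_left lor_commute[of N0])
    also have "\<dots> = coord x' \<bullet> v" using lor_frame_frame[of "coord x'" v] by (simp add: x')
    finally show ?thesis .
  qed
  then have "(\<chi> i. lor x (frame (axis i 1))) = coord x'" by (simp add: vec_eq_iff inner_axis)
  then show ?thesis using x' by (simp add: x'_def)
qed

end

section \<open>Hypersurfaces in Minkowski space\<close>

lemma matrix_inv_eqI:
  fixes A B :: "real^'n^'n"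
  assumes "A ** B = mat 1" shows "matrix_inv A = B"
proof -
  have BA: "B ** A = mat 1" using assms matrix_left_right_inverse by blast
  have "\<exists>A'. A ** A' = mat 1 \<and> A' ** A = mat 1" using assms BA by blast
  then have "A ** matrix_inv A = mat 1 \<and> matrix_inv A ** A = mat 1"
    unfolding matrix_inv_def by (rule someI_ex)
  then have "matrix_inv A = matrix_inv A ** (A ** B)" "matrix_inv A ** A = mat 1" using assms by auto
  then show ?thesis by (simp add: matrix_mul_assoc)
qed

text \<open>The chart domains of \<open>local_param\<close> are cut by a half-space through the
  origin. The translation by \<open>z0\<close> moves the coordinate domain into the open half-space
  of \<open>e\<close>, so that the global graph map is a chart that meets no boundary.\<close>

locale minkowski_graph = lorentz_frame N0 for N0 :: "'n::finite minkowski" +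
  fixes c :: real and D :: "'n minkowski set" and h :: "'n minkowski \<Rightarrow> real" and M :: "'n minkowski set"
    and e z0 :: "real^'n"
  assumes dom: "smooth_domain N0 c D" and sm: "smooth_map (closure D) h"
    and M: "M = {x + h x *\<^sub>R N0 | x. x \<in> closure D}"
    and e: "e \<noteq> 0" and pos: "\<And>x. x \<in> D \<Longrightarrow> 0 < e \<bullet> (z0 + coord (x - c *\<^sub>R N0))"
begin

definition par :: "real^'n \<Rightarrow> 'n minkowski" where
  "par y = (c *\<^sub>R N0 - frame z0) + frame y"

definition inv_par :: "'n minkowski \<Rightarrow> real^'n" where
  "inv_par x = z0 + coord (x - c *\<^sub>R N0)"

text \<open>The orthogonal projection to the hyperplane; the plus sign is due to
  \<open>lor N0 N0 = - 1\<close>. It recovers the base point of a graph point.\<close>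

definition proj :: "'n minkowski \<Rightarrow> 'n minkowski" where
  "proj x = x + (lor x N0 + c) *\<^sub>R N0"

definition Dom :: "(real^'n) set" where "Dom = {y. par y \<in> D}"

definition U :: "real^'n \<Rightarrow> real" where "U y = h (par y)"

definition X :: "real^'n \<Rightarrow> 'n minkowski" where "X y = par y + U y *\<^sub>R N0"

lemma frame_diff: "frame (y - z) = frame y - frame z"
  using linear_diff[OF bounded_linear.linear[OF bounded_linear_frame]] .

lemma par_in: "par y \<in> hyperplane N0 c"
  by (simp add: par_def hyperplane_def lor_add_left lor_diff_left lor_scaleR_left lor_N0 lor_frame_N0)

lemma inv_par_par [simp]: "inv_par (par y) = y"
  by (simp add: par_def inv_par_def coord_frame flip: frame_diff)

lemma par_inv_par: "x \<in> hyperplane N0 c \<Longrightarrow> par (inv_par x) = x"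
proof -
  assume "x \<in> hyperplane N0 c"
  then have "lor (x - c *\<^sub>R N0) N0 = 0" by (simp add: hyperplane_def lor_diff_left lor_scaleR_left lor_N0)
  then have "frame (coord (x - c *\<^sub>R N0)) = x - c *\<^sub>R N0" by (rule frame_coord)
  moreover have "frame (inv_par x) = frame z0 + frame (coord (x - c *\<^sub>R N0))"
    unfolding inv_par_def by (rule linear_add[OF bounded_linear.linear[OF bounded_linear_frame]])
  ultimately show ?thesis by (simp add: par_def)
qed

lemma continuous_par: "continuous_on S par"
  unfolding par_def by (intro continuous_intros linear_continuous_on bounded_linear_frame)

lemma continuous_inv_par: "continuous_on S inv_par"
  unfolding inv_par_def
  by (intro continuous_intros continuous_on_compose2[OF linear_continuous_on[OF bounded_linear_coord, of UNIV]]) auto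

lemma continuous_proj: "continuous_on S proj"
  unfolding proj_def by (intro continuous_intros continuous_on_lor)

lemma proj_graph: "x \<in> hyperplane N0 c \<Longrightarrow> proj (x + t *\<^sub>R N0) = x"
  by (simp add: proj_def hyperplane_def lor_add_left lor_scaleR_left lor_N0 algebra_simps)

lemma D_hyper: "D \<subseteq> hyperplane N0 c"
  using dom by (simp add: smooth_domain_def)

lemma closure_D_hyper: "closure D \<subseteq> hyperplane N0 c"
proof (rule closure_minimal[OF D_hyper])
  have "hyperplane N0 c = (\<lambda>x. lor x N0 + c) -` {0}" by (auto simp: hyperplane_def)
  moreover have "closed ((\<lambda>x. lor x N0 + c) -` {0})"
    by (intro closed_vimage continuous_intros continuous_on_lor)
  ultimately show "closed (hyperplane N0 c)" by simp
qed

lemma Dom_image: "Dom = inv_par ` D"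
  using D_hyper par_inv_par by (force simp: Dom_def)

lemma open_Dom: "open Dom"
proof -
  obtain T where T: "open T" "D = hyperplane N0 c \<inter> T"
    using dom unfolding smooth_domain_def openin_open by blast
  have "Dom = par -` T" using par_in T(2) unfolding Dom_def by blast
  then show ?thesis using T(1) continuous_par by (simp add: open_vimage)
qed

lemma bounded_Dom: "bounded Dom"
proof -
  have "compact (closure D)" using dom by (simp add: smooth_domain_def compact_closure)
  then have "bounded (inv_par ` closure D)"
    using compact_continuous_image[OF continuous_inv_par] compact_imp_bounded by blast
  then show ?thesis unfolding Dom_image by (rule bounded_subset) (use closure_subset in blast)
qed

lemma connected_Dom: "connected Dom"
  unfolding Dom_image using dom by (intro connected_continuous_image continuous_inv_par) (simp add: smooth_domain_def)

lemma closure_Dom: "closure Dom = {y. par y \<in> closure D}"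
proof
  have "par ` closure Dom \<subseteq> closure D"
  proof (rule image_closure_subset[OF continuous_par closed_closure])
    show "par ` Dom \<subseteq> closure D" using closure_subset[of D] unfolding Dom_def by blast
  qed
  then show "closure Dom \<subseteq> {y. par y \<in> closure D}" by blast
  have "inv_par ` closure D \<subseteq> closure Dom"
    by (rule image_closure_subset[OF continuous_inv_par closed_closure]) (use closure_subset[of Dom] Dom_image in blast)
  then show "{y. par y \<in> closure D} \<subseteq> closure Dom" by (metis (mono_tags, lifting) image_subset_iff inv_par_par mem_Collect_eq subsetI)
qed

lemma frontier_Dom: "y \<in> frontier Dom \<longleftrightarrow> par y \<in> closure D - D"
  unfolding frontier_def interior_open[OF open_Dom] closure_Dom by (simp add: Dom_def)

lemma M_eq: "M = X ` closure Dom"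
proof
  show "X ` closure Dom \<subseteq> M" unfolding M X_def U_def closure_Dom by blast
  show "M \<subseteq> X ` closure Dom"
  proof
    fix p assume "p \<in> M"
    then obtain x where x: "x \<in> closure D" "p = x + h x *\<^sub>R N0" using M by blast
    then have "par (inv_par x) = x" using par_inv_par closure_D_hyper by blast
    then have "p = X (inv_par x)" "inv_par x \<in> closure Dom" using x by (auto simp: X_def U_def closure_Dom)
    then show "p \<in> X ` closure Dom" by blast
  qed
qed

lemma proj_X: "proj (X y) = par y"
  unfolding X_def by (rule proj_graph[OF par_in])

lemma inv_X: "inv_par (proj (X y)) = y"
  by (simp add: proj_X)

lemma X_hyper_iff: "X y \<in> hyperplane N0 c \<longleftrightarrow> U y = 0"
proof -
  have "lor (X y) N0 + c = - U y"
    using par_in[of y] by (simp add: X_def hyperplane_def lor_add_left lor_scaleR_left lor_N0)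
  then show ?thesis by (simp add: hyperplane_def)
qed

lemma extension:
  assumes "y \<in> closure Dom"
  obtains T g where "open T" "y \<in> T" "smooth_on T g" "\<And>x. x \<in> T \<inter> closure Dom \<Longrightarrow> U x = g x"
proof -
  obtain V f where V: "open V" "par y \<in> V" "smooth_on V f" "\<forall>x\<in>closure D \<inter> V. f x = h x"
    using sm assms unfolding smooth_map_def closure_Dom by blast
  show ?thesis
  proof (rule that[of "par -` V" "\<lambda>y. f (par y)"])
    show "open (par -` V)" using V(1) continuous_par by (simp add: open_vimage)
    show "smooth_on (par -` V) (\<lambda>y. f (par y))"
      unfolding smooth_on_def par_def
      by (intro allI Ck_on_compose_affine[OF V(1) _ bounded_linear_frame]) (use V(3) in \<open>simp add: smooth_on_def\<close>)
  qed (use V in \<open>auto simp: U_def closure_Dom\<close>)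
qed

lemma smooth_U: "smooth_on Dom U"
  unfolding smooth_on_def
proof (intro allI Ck_on_local)
  fix k y assume "y \<in> Dom"
  then have "y \<in> closure Dom" using closure_subset by blast
  then obtain T g where T: "open T" "y \<in> T" "smooth_on T g" "\<And>x. x \<in> T \<inter> closure Dom \<Longrightarrow> U x = g x"
    by (rule extension) blast
  have "Ck_on k (T \<inter> Dom) g" using T(3) by (auto simp: smooth_on_def intro: Ck_on_subset)
  then have "Ck_on k (T \<inter> Dom) U"
    by (rule Ck_on_cong[rotated 2]) (use T(1) T(4)[symmetric] open_Dom closure_subset[of Dom] in auto)
  then show "\<exists>T. open T \<and> y \<in> T \<and> Ck_on k T U" using T(1,2) open_Dom \<open>y \<in> Dom\<close> by blast
qed

lemma continuous_U: "continuous_on (closure Dom) U"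
  unfolding U_def
  by (rule continuous_on_compose2[OF smooth_map_continuous_on[OF sm] continuous_par]) (auto simp: closure_Dom)

lemma continuous_X: "continuous_on (closure Dom) X"
  unfolding X_def by (intro continuous_intros continuous_par continuous_U)

lemma smooth_X: "smooth_on Dom X"
  unfolding smooth_on_def X_def par_def
  using smooth_U bounded_linear_scaleR_left[of N0]
  by (auto intro!: Ck_on_add[OF open_Dom] Ck_on_affine_map bounded_linear_frame
      Ck_on_bounded_linear[OF open_Dom, of _ U "\<lambda>r. r *\<^sub>R N0"] simp: smooth_on_def)

lemma C1_U: "C1_on Dom U" "C1_on Dom (pd i U)" "C1_on Dom (pd j (pd i U))"
  using smooth_U by (auto intro: smooth_on_C1 smooth_on_pd)

lemma X_derivative:
  assumes "y \<in> Dom"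
  shows "(X has_derivative (\<lambda>v. frame v + (\<Sum>i\<in>UNIV. pd i U y * v $ i) *\<^sub>R N0)) (at y)"
proof -
  have "((\<lambda>y. (c *\<^sub>R N0 - frame z0) + frame y + U y *\<^sub>R N0) has_derivative
      (\<lambda>v. 0 + frame v + (\<Sum>i\<in>UNIV. pd i U y * v $ i) *\<^sub>R N0)) (at y)"
    by (intro has_derivative_add has_derivative_const bounded_linear_imp_has_derivative bounded_linear_frame
        has_derivative_scaleR_left has_derivative_pd C1_onD[OF C1_U(1) assms])
  then show ?thesis by (simp add: X_def[abs_def] par_def)
qed

lemma partial_deriv_X: "y \<in> Dom \<Longrightarrow> partial_deriv X i y = frame (axis i 1) + pd i U y *\<^sub>R N0"
  using frechet_derivative_at[OF X_derivative, of y, symmetric]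
  by (simp add: partial_deriv_def) (simp add: axis_def if_distrib cong: if_cong)

lemma partial_deriv2_X:
  assumes "y \<in> Dom"
  shows "partial_deriv (partial_deriv X j) i y = pd i (pd j U) y *\<^sub>R N0"
proof -
  have "((\<lambda>y. frame (axis j 1) + pd j U y *\<^sub>R N0) has_derivative
     (\<lambda>v. 0 + (\<Sum>i\<in>UNIV. pd i (pd j U) y * v $ i) *\<^sub>R N0)) (at y)"
    by (intro has_derivative_add has_derivative_const has_derivative_scaleR_left has_derivative_pd C1_onD[OF C1_U(2) assms])
  then have "(partial_deriv X j has_derivative (\<lambda>v. 0 + (\<Sum>i\<in>UNIV. pd i (pd j U) y * v $ i) *\<^sub>R N0)) (at y)"
    by (rule has_derivative_transform_within_open[OF _ open_Dom assms]) (simp add: partial_deriv_X)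
  from frechet_derivative_at[OF this, symmetric] show ?thesis
    by (simp add: partial_deriv_def[of "partial_deriv X j"]) (simp add: axis_def if_distrib cong: if_cong)
qed

lemma Dom_half_space: "Dom \<inter> half_space e = Dom"
proof -
  have "0 < e \<bullet> y" if "y \<in> Dom" for y
    using pos[of "par y"] that inv_par_par[of y] by (simp add: Dom_def inv_par_def)
  then show ?thesis by (auto simp: half_space_def less_imp_le)
qed

text \<open>The inverse of the chart is \<open>inv_par\<close> after \<open>proj\<close>, a
  continuous map on all of Minkowski space. This gives the homeomorphism and also exhibits the image
  as an open preimage within \<open>M\<close>.\<close>

lemma local_param_X: "local_param M e Dom X"
  unfolding local_param_def Dom_half_space
proof (intro conjI ballI)
  fix y assume y: "y \<in> Dom"
  define p where "p v = (\<Sum>i\<in>UNIV. pd i U y * v $ i)" for v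
  have fd: "frechet_derivative X (at y) = (\<lambda>v. frame v + p v *\<^sub>R N0)"
    using frechet_derivative_at[OF X_derivative[OF y]] by (simp add: p_def)
  show "inj (frechet_derivative X (at y))"
  proof (rule injI)
    fix v w assume eq: "frechet_derivative X (at y) v = frechet_derivative X (at y) w"
    have "lor (frame v + p v *\<^sub>R N0) (frame z) = v \<bullet> z" for v z
      by (simp add: lor_add_left lor_scaleR_left lor_frame_frame lor_commute[of N0] lor_frame_N0)
    then have "v \<bullet> z = w \<bullet> z" for z using eq unfolding fd by metis
    then show "v = w" using vector_eq_rdot by blast
  qed
next
  show "openin (top_of_set M) (X ` Dom)"
  proof -
    have "X ` Dom = M \<inter> (\<lambda>x. inv_par (proj x)) -` Dom"
      unfolding M_eq using closure_subset by (force simp: inv_X)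
    moreover have "open ((\<lambda>x. inv_par (proj x)) -` Dom)"
      by (intro open_vimage open_Dom continuous_on_compose2[OF continuous_inv_par[of UNIV] continuous_proj]) auto
    ultimately show ?thesis by (auto simp: openin_open)
  qed
  show "\<exists>Y. homeomorphism Dom (X ` Dom) X Y"
  proof
    show "homeomorphism Dom (X ` Dom) X (\<lambda>x. inv_par (proj x))"
    proof (rule homeomorphismI)
      show "continuous_on Dom X" using continuous_on_subset[OF continuous_X closure_subset] .
      show "continuous_on (X ` Dom) (\<lambda>x. inv_par (proj x))"
        by (rule continuous_on_compose2[OF continuous_inv_par[of UNIV] continuous_proj]) auto
    qed (auto simp: inv_X)
  qed
qed (use e open_Dom smooth_X in auto)

text \<open>A graph point over the frontier of the domain cannot lie in the interior of a chart: otherwise,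
  by invariance of domain, the closed domain would contain a neighbourhood of its projection, but the
  defining function takes positive values there.\<close>

lemma frontier_boundary:
  assumes sh: "smooth_hypersurface M" and y: "y \<in> frontier Dom"
  shows "X y \<in> hypersurface_boundary M"
proof -
  have yc: "y \<in> closure Dom" using y by (simp add: frontier_def)
  then have "X y \<in> M" by (simp add: M_eq)
  then obtain a W Z where Z: "local_param M a W Z" "X y \<in> Z ` (W \<inter> half_space a)"
    using sh unfolding smooth_hypersurface_def by blast
  then obtain z where z: "z \<in> W" "0 \<le> a \<bullet> z" "X y = Z z" by (auto simp: half_space_def)
  have "a \<bullet> z = 0"
  proof (rule ccontr)
    assume nz: "a \<bullet> z \<noteq> 0"
    define V where "V = W \<inter> {w. 0 < a \<bullet> w}"
    have VW: "V \<subseteq> W \<inter> half_space a" by (auto simp: V_def half_space_def)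
    have openV: "open V" unfolding V_def using Z(1)
      by (intro open_Int open_Collect_less continuous_intros) (simp add: local_param_def)
    have zV: "z \<in> V" using z nz by (simp add: V_def)
    obtain Y where hom: "homeomorphism (W \<inter> half_space a) (Z ` (W \<inter> half_space a)) Z Y"
      using Z(1) by (auto simp: local_param_def)
    have "openin (top_of_set M) (Z ` (W \<inter> half_space a))" using Z(1) unfolding local_param_def by blast
    then have ZM: "Z ` (W \<inter> half_space a) \<subseteq> M" by (rule openin_imp_subset)
    define \<psi> where "\<psi> w = inv_par (proj (Z w))" for w
    have XZ: "X (\<psi> w) = Z w" "\<psi> w \<in> closure Dom" if "w \<in> V" for w
    proof -
      have "Z w \<in> M" using that VW ZM by blast
      then obtain x where x: "x \<in> closure Dom" "Z w = X x" by (auto simp: M_eq)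
      then have "\<psi> w = x" by (simp add: \<psi>_def inv_X)
      then show "X (\<psi> w) = Z w" "\<psi> w \<in> closure Dom" using x by auto
    qed
    have "continuous_on V \<psi>"
    proof -
      have "continuous_on V Z" using homeomorphism_cont1[OF hom] VW by (rule continuous_on_subset)
      then have "continuous_on V (\<lambda>w. proj (Z w))" by (rule continuous_on_compose2[OF continuous_proj[of UNIV]]) auto
      then show ?thesis unfolding \<psi>_def by (rule continuous_on_compose2[OF continuous_inv_par[of UNIV]]) auto
    qed
    moreover have "inj_on \<psi> V"
      using XZ(1) VW homeomorphism_apply1[OF hom] by (intro inj_onI) (metis subsetD)
    ultimately have "open (\<psi> ` V)" using invariance_of_domain openV by blast
    moreover have "y \<in> \<psi> ` V" using zV z(3) inv_X[of y] by (force simp: \<psi>_def)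
    moreover have "\<psi> ` V \<subseteq> closure Dom" using XZ(2) by blast
    ultimately have yint: "y \<in> interior (closure Dom)" using interior_maximal by blast
    obtain T \<rho> v where T: "open T" "par y \<in> T" "smooth_on T (\<rho> :: 'n minkowski \<Rightarrow> real)"
      "lor v N0 = 0" "frechet_derivative \<rho> (at (par y)) v \<noteq> 0" "D \<inter> T = {x \<in> hyperplane N0 c \<inter> T. \<rho> x < 0}"
      using dom y unfolding smooth_domain_def frontier_Dom by blast
    \<comment> \<open>The sign orients \<open>d\<close> such that \<open>\<rho>\<close> grows along
      it. As \<open>par y\<close> is not in \<open>D\<close>, \<open>\<rho>\<close> is nonnegative
      there, so it is positive at nearby points of the closure and then at points of
      \<open>D\<close> itself.\<close>
    define \<sigma> where "\<sigma> = sgn (frechet_derivative \<rho> (at (par y)) v)"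
    define d where "d = \<sigma> *\<^sub>R coord v"
    have fd: "frame d = \<sigma> *\<^sub>R v"
      using frame_coord[OF T(4)] linear_cmul[OF bounded_linear.linear[OF bounded_linear_frame]] by (simp add: d_def)
    have \<rho>0: "\<rho> (par y) \<ge> 0" using T(2,6) y par_in[of y] unfolding frontier_Dom by force
    have diff: "\<rho> differentiable (at (par y))" using T(2,3) unfolding smooth_on_def by (metis Ck_on.simps(2))
    have dd: "((\<lambda>t. \<rho> (par (y + t *\<^sub>R d))) has_real_derivative \<bar>frechet_derivative \<rho> (at (par y)) v\<bar>) (at 0)"
    proof -
      have par_line: "par (y + t *\<^sub>R d) = par y + t *\<^sub>R frame d" for t
        using linear_add[OF bounded_linear.linear[OF bounded_linear_frame]] linear_cmul[OF bounded_linear.linear[OF bounded_linear_frame]]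
        by (simp add: par_def)
      have l: "((\<lambda>t. par y + t *\<^sub>R frame d) has_derivative (\<lambda>t. t *\<^sub>R frame d)) (at 0)"
        by (auto intro!: derivative_eq_intros)
      have r: "(\<rho> has_derivative frechet_derivative \<rho> (at (par y))) (at (par y + 0 *\<^sub>R frame d))"
        using diff by (simp add: frechet_derivative_works)
      have lin: "linear (frechet_derivative \<rho> (at (par y)))" using diff by (rule linear_frechet_derivative)
      from has_derivative_compose[OF l r] show ?thesis
        unfolding par_line has_field_derivative_def fd
        by (rule has_derivative_eq_rhs) (auto simp: fun_eq_iff linear_cmul[OF lin] \<sigma>_def abs_sgn mult_ac)
    qed
    have "\<bar>frechet_derivative \<rho> (at (par y)) v\<bar> > 0" using T(5) by simp
    from DERIV_pos_inc_right[OF dd this] obtain r where r: "r > 0"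
      "\<And>t. 0 < t \<Longrightarrow> t < r \<Longrightarrow> \<rho> (par y) < \<rho> (par (y + t *\<^sub>R d))" by auto
    define Q where "Q = par -` T \<inter> interior (closure Dom)"
    have openQ: "open Q" unfolding Q_def using T(1) continuous_par by (intro open_Int open_vimage) auto
    have yQ: "y \<in> Q" using yint T(2) by (simp add: Q_def)
    obtain s where s: "s > 0" "ball y s \<subseteq> Q" using openQ yQ openE by blast
    define t where "t = min (r / 2) (s / (2 * (norm d + 1)))"
    have t: "0 < t" "t < r" using r(1) s(1) by (auto simp: t_def add_nonneg_pos)
    have "t * norm d < s"
    proof -
      have "t * norm d \<le> s / (2 * (norm d + 1)) * norm d" by (intro mult_right_mono) (auto simp: t_def)
      also have "\<dots> < s" using s(1) by (simp add: divide_simps add_nonneg_pos)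
      finally show ?thesis .
    qed
    then have "y + t *\<^sub>R d \<in> ball y s" using t by (simp add: dist_norm)
    then have "y + t *\<^sub>R d \<in> Q" using s(2) by blast
    then have "par (y + t *\<^sub>R d) \<in> T" "y + t *\<^sub>R d \<in> closure Dom"
      using interior_subset[of "closure Dom"] unfolding Q_def by blast+
    then have q: "par (y + t *\<^sub>R d) \<in> T" "par (y + t *\<^sub>R d) \<in> closure D"
      by (simp_all add: closure_Dom)
    have "open (T \<inter> \<rho> -` {0<..})"
      by (rule continuous_open_preimage[OF smooth_on_continuous[OF T(3)] T(1)]) auto
    moreover have "par (y + t *\<^sub>R d) \<in> T \<inter> \<rho> -` {0<..}" using q(1) r(2)[OF t] \<rho>0 by simp
    ultimately obtain x where "x \<in> D" "x \<in> T \<inter> \<rho> -` {0<..}"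
      using q(2) by (metis closure_iff_nhds_not_empty disjoint_iff order_refl)
    then have "\<rho> x < 0" using T(6) by blast
    then show False using \<open>x \<in> T \<inter> \<rho> -` {0<..}\<close> by simp
  qed
  then show ?thesis unfolding hypersurface_boundary_def using Z(1) z by blast
qed

text \<open>Near a point of the closure the Hessian agrees inside the domain with that of a smooth
  extension, which is locally bounded; compactness makes the bound uniform.\<close>

lemma hess_bdd: "bdd_on Dom (\<lambda>y. hess U y $ i $ j)"
proof (rule bdd_on_locally[OF _ closure_subset])
  show "compact (closure Dom)" using bounded_Dom by (simp add: compact_closure)
  fix y assume "y \<in> closure Dom"
  then obtain T g where T: "open T" "y \<in> T" "smooth_on T g" "\<And>x. x \<in> T \<inter> closure Dom \<Longrightarrow> U x = g x"
    by (rule extension) blast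
  have sg: "smooth_on T (pd i g)" "smooth_on T (pd j (pd i g))" using T(3) by (auto intro: smooth_on_pd)
  have "isCont (pd j (pd i g)) y" using smooth_on_continuous[OF sg(2)] T(1,2) by (simp add: continuous_on_eq_continuous_at)
  then obtain d where d: "d > 0" "\<And>x. dist x y < d \<Longrightarrow> dist (pd j (pd i g) x) (pd j (pd i g) y) < 1"
    unfolding continuous_at_eps_delta using zero_less_one by blast
  have op: "open (T \<inter> Dom)" using T(1) open_Dom by blast
  have Ug: "U x = g x" if "x \<in> T \<inter> Dom" for x using that T(4) closure_subset by blast
  have p1: "pd i U x = pd i g x" if "x \<in> T \<inter> Dom" for x
    by (rule pd_transform[OF op that Ug C1_onD[OF C1_U(1)]]) (use that in auto)
  have p2: "pd j (pd i U) x = pd j (pd i g) x" if "x \<in> T \<inter> Dom" for x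
    by (rule pd_transform[OF op that p1 C1_onD[OF C1_U(2)]]) (use that in auto)
  have "\<bar>hess U x $ i $ j\<bar> \<le> \<bar>pd j (pd i g) y\<bar> + 1" if "x \<in> (T \<inter> ball y d) \<inter> Dom" for x
  proof -
    have "\<bar>pd j (pd i g) x - pd j (pd i g) y\<bar> < 1" using d(2)[of x] that by (simp add: dist_commute dist_real_def)
    moreover have "hess U x $ i $ j = pd j (pd i g) x" using p2[of x] that by (simp add: hess_def)
    ultimately show ?thesis by linarith
  qed
  moreover have "open (T \<inter> ball y d)" "y \<in> T \<inter> ball y d" using T(1,2) d(1) by auto
  ultimately show "\<exists>S B. open S \<and> y \<in> S \<and> (\<forall>x\<in>S \<inter> Dom. \<bar>hess U x $ i $ j\<bar> \<le> B)" by blast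
qed

lemma graph_conclusion:
  assumes N: "unit_normal_field M N" and sh: "smooth_hypersurface M" and k: "1 \<le> k" "k \<le> CARD('n)"
    and H: "constant_mean_curvature k M N" and A: "constant_intersection_angles N0 c M N"
  shows "(\<exists>a r. r > 0 \<and> M \<subseteq> hyperboloid a r) \<or> M \<subseteq> hyperplane N0 c"
proof -
  define \<tau> where "\<tau> y = - lor (N (X y)) N0" for y
  have Ncont: "continuous_on (closure Dom) (\<lambda>y. N (X y))"
    using N smooth_map_continuous_on[of M N] unfolding unit_normal_field_def
    by (intro continuous_on_compose2[OF _ continuous_X]) (auto simp: M_eq)
  have \<tau>cont: "continuous_on (closure Dom) \<tau>"
    unfolding \<tau>_def by (intro continuous_intros continuous_on_lor Ncont)
  have nrm: "N (X y) = frame (\<tau> y *\<^sub>R grad U y) + \<tau> y *\<^sub>R N0" "(\<tau> y)\<^sup>2 * (1 - grad U y \<bullet> grad U y) = 1"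
    if y: "y \<in> Dom" for y
  proof -
    have yM: "X y \<in> M" using y closure_subset by (auto simp: M_eq)
    have "lor (N (X y)) (partial_deriv X i y) = 0" for i
      using N local_param_X y Dom_half_space unfolding unit_normal_field_def by blast
    then have "lor (N (X y)) (frame (axis i 1)) = \<tau> y * pd i U y" for i
      by (simp add: partial_deriv_X[OF y] lor_add_right lor_scaleR_right \<tau>_def eq_neg_iff_add_eq_0 mult.commute)
    then have "(\<chi> i. lor (N (X y)) (frame (axis i 1))) = \<tau> y *\<^sub>R grad U y" by (simp add: vec_eq_iff grad_def)
    then show dec: "N (X y) = frame (\<tau> y *\<^sub>R grad U y) + \<tau> y *\<^sub>R N0"
      using frame_decomposition[of "N (X y)"] by (simp add: \<tau>_def)
    have "lor (N (X y)) (N (X y)) = -1" using N yM unfolding unit_normal_field_def timelike_unit_def by blast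
    moreover have "lor (frame z + t *\<^sub>R N0) (frame z + t *\<^sub>R N0) = z \<bullet> z - t\<^sup>2" for z t
      by (simp add: lor_add_left lor_add_right lor_scaleR_left lor_scaleR_right lor_frame_frame lor_frame_N0
        lor_commute[of N0 "frame z"] lor_N0 power2_eq_square)
    ultimately have "(\<tau> y *\<^sub>R grad U y) \<bullet> (\<tau> y *\<^sub>R grad U y) - (\<tau> y)\<^sup>2 = -1" unfolding dec by simp
    then show "(\<tau> y)\<^sup>2 * (1 - grad U y \<bullet> grad U y) = 1" by (simp add: power2_eq_square algebra_simps)
  qed
  \<comment> \<open>A normal of square \<open>- 1\<close> forces the tangent planes to be spacelike,
    which in coordinates is this slope bound.\<close>
  have slope: "grad U y \<bullet> grad U y < 1" if "y \<in> Dom" for y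
  proof (rule ccontr)
    assume "\<not> ?thesis"
    then have "(\<tau> y)\<^sup>2 * (1 - grad U y \<bullet> grad U y) \<le> 0" by (intro mult_nonneg_nonpos) auto
    then show False using nrm(2)[OF that] by simp
  qed
  interpret g: spacelike_graph Dom U
    by unfold_locales (use open_Dom C1_U slope in auto)
  have \<tau>l: "\<bar>\<tau> y\<bar> = lapse U y" if y: "y \<in> Dom" for y
  proof -
    have "(\<tau> y)\<^sup>2 * (1 - grad U y \<bullet> grad U y) = (lapse U y)\<^sup>2 * (1 - grad U y \<bullet> grad U y)"
      using nrm(2)[OF y] g.lapse_facts(2)[OF y] by simp
    then have "(\<tau> y)\<^sup>2 = (lapse U y)\<^sup>2" using slope[OF y] by simp
    then have "\<bar>\<tau> y\<bar> = \<bar>lapse U y\<bar>" by (simp add: power2_eq_iff abs_eq_iff)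
    then show ?thesis using g.lapse_facts(1)[OF y] by simp
  qed
  \<comment> \<open>\<open>s\<close> is the time orientation of \<open>N\<close> relative to
    \<open>N0\<close>. It is constant on the connected domain because \<open>\<tau>\<close> is
    continuous and has no zero.\<close>
  obtain s where s: "s = 1 \<or> s = -1" "\<And>y. y \<in> Dom \<Longrightarrow> \<tau> y = s * lapse U y"
  proof -
    have ne: "\<tau> y \<noteq> 0" if "y \<in> Dom" for y using \<tau>l[OF that] g.lapse_facts(1)[OF that] by auto
    have con: "connected (\<tau> ` Dom)"
      by (intro connected_continuous_image connected_Dom continuous_on_subset[OF \<tau>cont closure_subset])
    have "(\<forall>y\<in>Dom. \<tau> y > 0) \<or> (\<forall>y\<in>Dom. \<tau> y < 0)"
    proof (rule ccontr)
      assume "\<not> ?thesis"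
      then obtain y z where "y \<in> Dom" "z \<in> Dom" "\<tau> y \<le> 0" "0 \<le> \<tau> z" by force
      then have "0 \<in> \<tau> ` Dom" using connected_contains_Icc[OF con, of "\<tau> y" "\<tau> z"] by force
      then show False using ne by force
    qed
    then show ?thesis
    proof
      assume "\<forall>y\<in>Dom. \<tau> y > 0"
      then show ?thesis using that[of 1] \<tau>l by force
    next
      assume "\<forall>y\<in>Dom. \<tau> y < 0"
      then show ?thesis using that[of "-1"] \<tau>l by force
    qed
  qed
  \<comment> \<open>The transpose comes from the index convention of \<open>h_i^j\<close>, where the
    lower index labels the row; \<open>s\<close> is the orientation of the normal.\<close>
  have so: "shape_operator N X y = s *\<^sub>R transpose (shape U y)" if y: "y \<in> Dom" for y
  proof -
    define G where "G = mat 1 + outer (tilt U y)"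
    have "induced_metric X y = mat 1 - outer (grad U y)"
      by (simp add: induced_metric_def partial_deriv_X[OF y] vec_eq_iff lor_add_left lor_add_right lor_scaleR_left
        lor_scaleR_right lor_frame_frame lor_frame_N0 lor_commute[of N0 "frame _"] lor_N0 outer_def grad_def mat_def inner_axis_axis)
    \<comment> \<open>The Sherman-Morrison inverse: since
      \<open>w^2 (1 - p \<bullet> p) = 1\<close>, the inverse of \<open>I - p p^T\<close> is
      \<open>I + w^2 p p^T\<close>, and \<open>w p\<close> is the tilt.\<close>
    moreover have "(mat 1 - outer (grad U y)) ** G = mat 1"
    proof -
      define w p where "w = lapse U y" and "p = grad U y"
      have out: "outer (tilt U y) = w\<^sup>2 *\<^sub>R outer p"
        by (simp add: outer_def tilt_def w_def p_def vec_eq_iff power2_eq_square mult_ac)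
      have "w\<^sup>2 * (1 - p \<bullet> p) = 1" using g.lapse_facts(2)[OF y] by (simp add: w_def p_def)
      then have w1: "w\<^sup>2 - 1 - w\<^sup>2 * (p \<bullet> p) = 0" by (simp add: algebra_simps)
      have "(mat 1 - outer p) ** (mat 1 + w\<^sup>2 *\<^sub>R outer p) = mat 1 + (w\<^sup>2 - 1 - w\<^sup>2 * (p \<bullet> p)) *\<^sub>R outer p"
        by (simp add: matrix_add_ldistrib matrix_diff_rdistrib matrix_scalar_ac scalar_matrix_assoc[symmetric] outer_mult_outer algebra_simps)
      then show ?thesis unfolding G_def out p_def[symmetric] w1 by simp
    qed
    ultimately have inv: "matrix_inv (induced_metric X y) = G" by (simp add: matrix_inv_eqI)
    have "lor N0 (N (X y)) = - \<tau> y" by (simp add: \<tau>_def lor_commute[of N0])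
    then have sff: "second_fundamental_form N X y $ i $ l = \<tau> y * hess U y $ l $ i" for i l
      by (simp add: second_fundamental_form_def partial_deriv2_X[OF y] lor_scaleR_left hess_def)
    have "shape_operator N X y $ i $ j = s * shape U y $ j $ i" for i j
    proof -
      have "shape_operator N X y $ i $ j = (\<Sum>l\<in>UNIV. G $ j $ l * (\<tau> y * hess U y $ l $ i))"
        by (simp add: shape_operator_def inv sff)
      also have "\<dots> = s * (\<Sum>l\<in>UNIV. G $ j $ l * (lapse U y * hess U y $ l $ i))"
        unfolding s(2)[OF y] sum_distrib_left by (intro sum.cong refl) (simp only: mult_ac)
      also have "\<dots> = s * shape U y $ j $ i"
        by (simp add: g.shape_eq[OF y] G_def[symmetric]) (simp add: matrix_matrix_mult_def)
      finally show ?thesis .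
    qed
    then show ?thesis by (simp add: vec_eq_iff transpose_def)
  qed
  obtain H0 where H0: "\<And>y. y \<in> Dom \<Longrightarrow> mean_curvature k N X y = H0"
    using H local_param_X Dom_half_space unfolding constant_mean_curvature_def by blast
  \<comment> \<open>The curvatures taken with respect to \<open>N\<close> are \<open>s\<close> times
    the eigenvalues of the shape matrix. The resulting factor \<open>s ^ k\<close> is its own
    inverse.\<close>
  have sk: "msigma k (shape U y) = s ^ k * (H0 * real (CARD('n) choose k))" if y: "y \<in> Dom" for y
  proof -
    obtain K :: "real^'n^'n" and l where K: "invertible K" "shape U y ** K = K ** diag l"
      using g.shape_diagonalizable[OF y] by metis
    have ev: "eigenvalue_list (shape_operator N X y) (s *\<^sub>R l)"
      unfolding so[OF y] by (rule eigenvalue_list_diagonalized[OF K])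
    then have "eigenvalue_list (shape_operator N X y) (principal_curvatures N X y)"
      unfolding principal_curvatures_def by (rule someI)
    then have "elem_sym k (principal_curvatures N X y) = esym UNIV (($) (s *\<^sub>R l)) k"
      unfolding elem_sym_eq_esym by (rule eigenvalue_list_esym_unique[OF _ ev])
    also have "($) (s *\<^sub>R l) = (\<lambda>i. s * l $ i)" by (simp add: fun_eq_iff)
    also have "esym UNIV (\<lambda>i. s * l $ i) k = s ^ k * msigma k (shape U y)"
      by (simp add: esym_scale msigma_diagonalized[OF K])
    finally have "s ^ k * msigma k (shape U y) = H0 * real (CARD('n) choose k)"
      using H0[OF y] k by (simp add: mean_curvature_def field_simps)
    moreover have "s ^ k * s ^ k = 1" using s(1) by (auto simp flip: power_mult_distrib)
    ultimately show ?thesis by (metis mult.assoc mult_1)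
  qed
  obtain \<theta> where \<theta>: "\<And>p. p \<in> hypersurface_boundary M \<Longrightarrow> lor (N p) N0 = \<theta>"
    and bd: "hypersurface_boundary M \<subseteq> hyperplane N0 c"
    using A unfolding constant_intersection_angles_def by blast
  have "(\<forall>y\<in>closure Dom. U y = 0) \<or>
    (\<exists>b \<beta> r. r > 0 \<and> (\<forall>y\<in>closure Dom. (y - b) \<bullet> (y - b) - (U y - \<beta>)\<^sup>2 = - r\<^sup>2))"
  proof (rule overdetermined_spacelike_graph[OF g.spacelike_graph_axioms bounded_Dom connected_Dom continuous_U _ _ _ _ hess_bdd k sk])
    show "U y = 0" if "y \<in> frontier Dom" for y
      using frontier_boundary[OF sh that] bd X_hyper_iff by blast
    \<comment> \<open>Through the normal field \<open>\<bar>\<tau>\<bar>\<close> is defined and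
      continuous up to the frontier, and there the angle condition fixes its value; this is the
      required extension of \<open>lapse U\<close>.\<close>
    show "continuous_on (closure Dom) (\<lambda>y. \<bar>\<tau> y\<bar>)" by (intro continuous_intros \<tau>cont)
    show "\<bar>\<tau> y\<bar> = lapse U y" if "y \<in> Dom" for y by (rule \<tau>l[OF that])
    show "\<bar>\<tau> y\<bar> = \<bar>\<theta>\<bar>" if "y \<in> frontier Dom" for y
      using \<theta>[OF frontier_boundary[OF sh that]] by (simp add: \<tau>_def)
  qed
  then show ?thesis
  proof
    assume "\<forall>y\<in>closure Dom. U y = 0"
    then have "M \<subseteq> hyperplane N0 c" unfolding M_eq using X_hyper_iff by blast
    then show ?thesis by blast
  next
    assume "\<exists>b \<beta> r. r > 0 \<and> (\<forall>y\<in>closure Dom. (y - b) \<bullet> (y - b) - (U y - \<beta>)\<^sup>2 = - r\<^sup>2)"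
    then obtain b \<beta> r where r: "r > 0" "\<And>y. y \<in> closure Dom \<Longrightarrow> (y - b) \<bullet> (y - b) - (U y - \<beta>)\<^sup>2 = - r\<^sup>2" by blast
    \<comment> \<open>The frame is isometric and orthogonal to \<open>N0\<close>, so the equation in
      coordinates is that of the hyperboloid centred at the point with coordinates \<open>b\<close>
      and height \<open>\<beta>\<close>.\<close>
    have "M \<subseteq> hyperboloid (par b + \<beta> *\<^sub>R N0) r"
    proof
      fix p assume "p \<in> M"
      then obtain y where y: "y \<in> closure Dom" "p = X y" by (auto simp: M_eq)
      have "X y - (par b + \<beta> *\<^sub>R N0) = frame (y - b) + (U y - \<beta>) *\<^sub>R N0"
        unfolding frame_diff by (simp add: X_def par_def algebra_simps)
      moreover have "lor (frame z + t *\<^sub>R N0) (frame z + t *\<^sub>R N0) = z \<bullet> z - t\<^sup>2" for z t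
        by (simp add: lor_add_left lor_add_right lor_scaleR_left lor_scaleR_right lor_frame_frame lor_frame_N0
          lor_commute[of N0 "frame z"] lor_N0 power2_eq_square)
      ultimately show "p \<in> hyperboloid (par b + \<beta> *\<^sub>R N0) r"
        using r(2)[OF y(1)] by (simp add: hyperboloid_def y(2))
    qed
    then show ?thesis using r(1) by blast
  qed
qed

end

lemma (in lorentz_frame) half_space_shift:
  assumes "bounded D"
  shows "\<exists>e z0. e \<noteq> 0 \<and> (\<forall>x\<in>D. 0 < e \<bullet> (z0 + coord (x - c *\<^sub>R N0)))"
proof -
  have "bounded ((\<lambda>x. coord (x - c *\<^sub>R N0)) ` D)"
  proof -
    have "bounded ((\<lambda>x. x - c *\<^sub>R N0) ` D)" using assms by (rule bounded_translation_minus)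
    from bounded_linear_image[OF this bounded_linear_coord] show ?thesis by (simp add: image_image)
  qed
  then obtain B where B: "\<forall>x\<in>D. norm (coord (x - c *\<^sub>R N0)) \<le> B" by (auto simp: bounded_iff)
  obtain e :: "real^'n" where e: "norm e = 1" using vector_choose_size[of 1] by auto
  \<comment> \<open>A shift by \<open>|B| + 1\<close> along the unit vector \<open>e\<close> exceeds
    every inner product of \<open>e\<close> with a coordinate vector of \<open>D\<close>.\<close>
  have "0 < e \<bullet> ((\<bar>B\<bar> + 1) *\<^sub>R e + coord (x - c *\<^sub>R N0))" if "x \<in> D" for x
  proof -
    have "\<bar>e \<bullet> coord (x - c *\<^sub>R N0)\<bar> \<le> norm e * norm (coord (x - c *\<^sub>R N0))" by (rule Cauchy_Schwarz_ineq2)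
    also have "\<dots> \<le> \<bar>B\<bar>" using B that e by force
    finally show ?thesis using e by (simp add: inner_add_right dot_square_norm)
  qed
  moreover have "e \<noteq> 0" using e by auto
  ultimately show ?thesis by blast
qed

theorem theorem1:
  fixes N0 :: "'n::finite minkowski" and c :: real and k :: nat
    and M :: "'n minkowski set" and N :: "'n minkowski \<Rightarrow> 'n minkowski"
  assumes "1 \<le> k" and "k \<le> CARD('n)"
    and "timelike_unit N0"
    and "connected M" and "compact M" and "smooth_hypersurface M" and "spacelike M"
    and "graph_on N0 c M"
    and "unit_normal_field M N"
    and "constant_mean_curvature k M N"
    and "constant_intersection_angles N0 c M N"
  shows "(\<exists>a r. r > 0 \<and> M \<subseteq> hyperboloid a r) \<or> M \<subseteq> hyperplane N0 c"
proof -
  interpret lorentz_frame N0 by unfold_locales (rule assms)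
  obtain D h where g: "smooth_domain N0 c D" "smooth_map (closure D) h" "M = {x + h x *\<^sub>R N0 | x. x \<in> closure D}"
    using assms(8) unfolding graph_on_def by blast
  obtain e z0 where ez: "e \<noteq> 0" "\<forall>x\<in>D. 0 < e \<bullet> (z0 + coord (x - c *\<^sub>R N0))"
    using half_space_shift[of D c] g(1) unfolding smooth_domain_def by blast
  interpret minkowski_graph N0 c D h M e z0
    by unfold_locales (use g ez in auto)
  show ?thesis by (rule graph_conclusion) (use assms in auto)
qed

end
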